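(* Let $n_x,n_A,n_B$ be non-negative integers with $n_x\ge 1$, let $\Omega=(0,1)$, and consider the system of PDEs $$\partial_t x^\alpha(z,t)=f^\alpha\big(z,t,x(z,t),\partial_z x(z,t),\partial_z^2x(z,t),u(t)\big),\quad \alpha=1,\dots,n_x,$$ on $\Omega$, with boundary conditions $$g^\lambda(t,x(0,t),\partial_z x(0,t))=0,\ \lambda=1,\dots,n_A,\qquad h^\mu(t,x(1,t),\partial_z x(1,t))=0,\ \mu=1,\dots,n_B,$$ where $f^\alpha,g^\lambda,h^\mu$ are smooth. Let $\mathcal{E}$, $J^2(\mathcal{E})$, $\mathcal{S}^2$, $\mathcal{B}_A,\mathcal{B}_B$, $\mathcal{S}^1_A,\mathcal{S}^1_B$ and the prolongations $j^1(v),j^2(v)$ be as defined in the context. Let $$v=v_x^\alpha(z,t,x,u)\,\partial_{x^\alpha}+v_u(z,t,x,u)\,\partial_u$$ be a smooth vector field on $\mathcal{E}$ such that $$L_{j^2(v)}\big(x_t^\alpha-f^\alpha(z,t,x,x_z,x_{zz},u)\big)=0\ (\alpha=1,\dots,n_x),\quad L_{j^2(v)}u_z=0,\quad L_{j^2(v)}u_{zz}=0,\quad L_{j^2(v)}u_{zt}=0$$ at all points of $\mathcal{S}^2\subset J^2(\mathcal{E})$, and $$L_{j^1(v)}g^\lambda(t,x,x_z)\big|_{z=0}=0\ (\lambda=1,\dots,n_A)\ \text{ on }\mathcal{S}^1_A\subset\mathcal{B}_A,\qquad L_{j^1(v)}h^\mu(t,x,x_z)\big|_{z=1}=0\ (\mu=1,\dots,n_B)\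 \text{ on }\mathcal{S}^1_B\subset\mathcal{B}_B.$$ Then $v$ is the infinitesimal generator of a vertical 1-parameter symmetry group of the PDE system with the given boundary conditions; that is, if $\Phi_\varepsilon$ denotes the flow of $v$, then for every solution $\gamma$ of the PDE system with these boundary conditions and every $\varepsilon$ for which $\Phi_\varepsilon\circ\gamma$ is defined, $\Phi_\varepsilon\circ\gamma$ is again a solution of the PDE system with these boundary conditions.
   Context: Everything is smooth and all considerations are local (flows are local flows). The Einstein summation convention is used; $L_w\varphi$ is the Lie derivative of the function $\varphi$ along the vector field $w$. $\bar\Omega=[0,1]$, and $\mathbb{R}^+=[0,\infty)$ is the time axis. Bundle: $(\mathcal{E},\pi,\bar\Omega\times\mathbb{R}^+)$, where $\mathcal{E}$ is a $(3+n_x)$-dimensional manifold with coordinates $(z,t,x,u)$, $x=(x^1,\dots,x^{n_x})$ (concretely $\mathcal{E}=\bar\Omega\times\mathbb{R}^+\times X\times\mathbb{R}$ with $X\subset\mathbb{R}^{n_x}$ open), and $\pi(z,t,x,u)=(z,t)$. The jet manifold $J^1(\mathcal{E})$ has coordinates $(z,t,x,u,x_z,x_t,u_z,u_t)$, and $J^2(\mathcal{E})$ has in addition $(x_{zz},x_{zt},x_{tt},u_{zz},u_{zt},u_{tt})$. $\mathcal{S}^2\subset J^2(\mathcal{E})$ is the subset given by $x_t^\alpha-f^\alpha(z,t,x,x_z,x_{zz},u)=0$ ($\alpha=1,\dots,n_x$), $u_z=0$, $u_{zz}=0$, $u_{zt}=0$. The equations for $u$ encode that the input depends only on $t$. The Jacobian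 of these $n_x+3$ functions is assumed to have maximal rank on $\mathcal{S}^2$, so $\mathcal{S}^2$ is a regular submanifold. $\mathcal{B}_A$ and $\mathcal{B}_B$ are manifolds with coordinates $(t,x,u,x_z,x_t,u_z,u_t)$ (the coordinates of $J^1(\mathcal{E})$ without $z$, corresponding to $z=0$ and $z=1$, respectively). $\mathcal{S}^1_A=\{g^\lambda(t,x,x_z)=0,\ \lambda=1,\dots,n_A\}\subset\mathcal{B}_A$ and $\mathcal{S}^1_B=\{h^\mu(t,x,x_z)=0,\ \mu=1,\dots,n_B\}\subset\mathcal{B}_B$. The Jacobians of $(g^\lambda)$ and $(h^\mu)$ are assumed to have maximal ranks $n_A$ and $n_B$, so these are regular submanifolds. Solution: a smooth section $\gamma:\bar\Omega\times\mathbb{R}^+\to\mathcal{E}$, $(z,t)\mapsto(z,t,\gamma_x(z,t),\gamma_u(z,t))$, whose prolongation $j^2(\gamma)$ (obtained by adding all partial derivatives of $\gamma_x,\gamma_u$ with respect to $z,t$ up to order 2) maps $\Omega\times\mathbb{R}^+$ into $\mathcal{S}^2$, and such that $g^\lambda(t,x,x_z)\circ j^1(\gamma)|_{z=0}=0$ and $h^\mu(t,x,x_z)\circ j^1(\gamma)|_{z=1}=0$ for all $t\in\mathbb{R}^+$. In particular $\gamma_u$ is independent of $z$ for a solution. Total derivatives: $d_z=\partial_z+x_z^\alpha\partial_{x^\alpha}+u_z\partial_u+x_{zz}^\alpha\partial_{x_z^\alpha}+x_{zt}^\alpha\partial_{x_t^\alpha}+u_{zz}\partial_{u_z}+u_{zt}\partial_{u_t}$,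 $d_t=\partial_t+x_t^\alpha\partial_{x^\alpha}+u_t\partial_u+x_{zt}^\alpha\partial_{x_z^\alpha}+x_{tt}^\alpha\partial_{x_t^\alpha}+u_{zt}\partial_{u_z}+u_{tt}\partial_{u_t}$, with $d_{zz}=d_z\circ d_z$, $d_{zt}=d_t\circ d_z$, $d_{tt}=d_t\circ d_t$. Prolongations: $j^1(v)=v_x^\alpha\partial_{x^\alpha}+v_u\partial_u+d_z(v_x^\alpha)\partial_{x_z^\alpha}+d_t(v_x^\alpha)\partial_{x_t^\alpha}+d_z(v_u)\partial_{u_z}+d_t(v_u)\partial_{u_t}$, and $j^2(v)=j^1(v)+d_{zz}(v_x^\alpha)\partial_{x_{zz}^\alpha}+d_{zt}(v_x^\alpha)\partial_{x_{zt}^\alpha}+d_{tt}(v_x^\alpha)\partial_{x_{tt}^\alpha}+d_{zz}(v_u)\partial_{u_{zz}}+d_{zt}(v_u)\partial_{u_{zt}}+d_{tt}(v_u)\partial_{u_{tt}}$. The restrictions $j^1(v)|_{z=0}$, $j^1(v)|_{z=1}$ are vector fields on $\mathcal{B}_A$, $\mathcal{B}_B$. A 1-parameter transformation group is called vertical if it does not change the independent variables $(z,t)$; it is the (local) flow of its infinitesimal generator, a vector field with only $\partial_{x^\alpha}$ and $\partial_u$ components. *)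

theory Defs
  imports "HOL-Analysis.Analysis"
begin

(* Smoothness on sets that may have boundary and corners, such as [0,1] x [0,\<infinity>) x X x R.
   Derivatives are taken within the set (one-sided on the boundary); on the sets used
   below they are unique. *)

primrec Ck_on :: "nat \<Rightarrow> ('a::real_normed_vector \<Rightarrow> 'b::real_normed_vector) \<Rightarrow> 'a set \<Rightarrow> bool" where
  "Ck_on 0 f S \<longleftrightarrow> continuous_on S f"
| "Ck_on (Suc k) f S \<longleftrightarrow>
     (\<exists>f'. (\<forall>x\<in>S. (f has_derivative f' x) (at x within S)) \<and> (\<forall>v. Ck_on k (\<lambda>x. f' x v) S))"

definition smooth_on :: "'a::real_normed_vector set \<Rightarrow> ('a \<Rightarrow> 'b::real_normed_vector) \<Rightarrow> bool" where
  "smooth_on S f \<longleftrightarrow> (\<forall>k. Ck_on k f S)"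

definition Lie :: "'a::real_normed_vector set \<Rightarrow> ('a \<Rightarrow> 'a) \<Rightarrow> ('a \<Rightarrow> 'b::real_normed_vector) \<Rightarrow> 'a \<Rightarrow> 'b" where
  "Lie M w \<phi> p = frechet_derivative \<phi> (at p within M) (w p)"

definition zero_set :: "'a set \<Rightarrow> ('a \<Rightarrow> real) set \<Rightarrow> 'a set" where
  "zero_set M F = {p \<in> M. \<forall>\<phi>\<in>F. \<phi> p = 0}"

definition grad :: "'a::euclidean_space set \<Rightarrow> ('a \<Rightarrow> real) \<Rightarrow> 'a \<Rightarrow> 'a" where
  "grad M \<phi> p = (\<Sum>b\<in>Basis. frechet_derivative \<phi> (at p within M) b *\<^sub>R b)"

(* Row rank of the Jacobian of the functions in F: its rows are the gradients. *)
definition jacobian_rank :: "'a::euclidean_space set \<Rightarrow> ('a \<Rightarrow> real) set \<Rightarrow> 'a \<Rightarrow> nat" where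
  "jacobian_rank M F p = dim ((\<lambda>\<phi>. grad M \<phi> p) ` F)"

(* Coordinates: total space (z, t, x, u);
   first jets add (x_z, x_t, u_z, u_t);
   second jets add (x_zz, x_zt, x_tt, u_zz, u_zt, u_tt);
   boundary jets (t, x, u, x_z, x_t, u_z, u_t) are first jets without z. *)

type_synonym 'n tot = "real \<times> real \<times> (real, 'n) vec \<times> real"
type_synonym 'n jet1 = "'n tot \<times> (real, 'n) vec \<times> (real, 'n) vec \<times> real \<times> real"
type_synonym 'n jet2 =
  "'n jet1 \<times> (real, 'n) vec \<times> (real, 'n) vec \<times> (real, 'n) vec \<times> real \<times> real \<times> real"
type_synonym 'n bjet =
  "real \<times> (real, 'n) vec \<times> real \<times> (real, 'n) vec \<times> (real, 'n) vec \<times> real \<times> real"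

definition base :: "(real \<times> real) set" where
  "base = {0..1} \<times> {0..}"

definition Tot :: "(real^'n) set \<Rightarrow> 'n tot set" where
  "Tot X = {0..1} \<times> {0..} \<times> X \<times> UNIV"

definition Jet1 :: "(real^'n) set \<Rightarrow> 'n jet1 set" where
  "Jet1 X = Tot X \<times> UNIV"

definition Jet2 :: "(real^'n) set \<Rightarrow> 'n jet2 set" where
  "Jet2 X = Jet1 X \<times> UNIV"

definition BJet :: "(real^'n) set \<Rightarrow> 'n bjet set" where
  "BJet X = {0..} \<times> X \<times> UNIV"

fun proj :: "'n tot \<Rightarrow> real \<times> real" where
  "proj (z, t, x, u) = (z, t)"

fun x_of :: "'n tot \<Rightarrow> (real, 'n) vec" where
  "x_of (z, t, x, u) = x"

fun u_of :: "'n tot \<Rightarrow> real" where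
  "u_of (z, t, x, u) = u"

fun drop_z :: "'n jet1 \<Rightarrow> 'n bjet" where
  "drop_z ((z, t, x, u), xz, xt, uz, ut) = (t, x, u, xz, xt, uz, ut)"

fun at_z :: "real \<Rightarrow> 'n bjet \<Rightarrow> 'n jet1" where
  "at_z z0 (t, x, u, xz, xt, uz, ut) = ((z0, t, x, u), xz, xt, uz, ut)"

(* Total derivatives are vector fields along the projection, acting by directional
   derivative. Applied to a function on the total space, only the part
   d_z = \<partial>_z + x_z \<partial>_x + u_z \<partial>_u survives and the result is a function on first jets (dz1, dt1);
   applied to a function on first jets the result lives on second jets (dz2, dt2). *)

fun dz1 :: "(real^'n) set \<Rightarrow> ('n tot \<Rightarrow> 'b::real_normed_vector) \<Rightarrow> 'n jet1 \<Rightarrow> 'b" where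
  "dz1 X \<phi> (e, xz, xt, uz, ut) = frechet_derivative \<phi> (at e within Tot X) (1, 0, xz, uz)"

fun dt1 :: "(real^'n) set \<Rightarrow> ('n tot \<Rightarrow> 'b::real_normed_vector) \<Rightarrow> 'n jet1 \<Rightarrow> 'b" where
  "dt1 X \<phi> (e, xz, xt, uz, ut) = frechet_derivative \<phi> (at e within Tot X) (0, 1, xt, ut)"

fun dz2 :: "(real^'n) set \<Rightarrow> ('n jet1 \<Rightarrow> 'b::real_normed_vector) \<Rightarrow> 'n jet2 \<Rightarrow> 'b" where
  "dz2 X \<phi> ((e, xz, xt, uz, ut), xzz, xzt, xtt, uzz, uzt, utt) =
     frechet_derivative \<phi> (at (e, xz, xt, uz, ut) within Jet1 X)
       ((1, 0, xz, uz), xzz, xzt, uzz, uzt)"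

fun dt2 :: "(real^'n) set \<Rightarrow> ('n jet1 \<Rightarrow> 'b::real_normed_vector) \<Rightarrow> 'n jet2 \<Rightarrow> 'b" where
  "dt2 X \<phi> ((e, xz, xt, uz, ut), xzz, xzt, xtt, uzz, uzt, utt) =
     frechet_derivative \<phi> (at (e, xz, xt, uz, ut) within Jet1 X)
       ((0, 1, xt, ut), xzt, xtt, uzt, utt)"

definition vert :: "('n tot \<Rightarrow> (real, 'n) vec) \<Rightarrow> ('n tot \<Rightarrow> real) \<Rightarrow> 'n tot \<Rightarrow> 'n tot" where
  "vert vx vu e = (0, 0, vx e, vu e)"

definition vprol1 ::
  "(real^'n) set \<Rightarrow> ('n tot \<Rightarrow> real^'n) \<Rightarrow> ('n tot \<Rightarrow> real) \<Rightarrow> 'n jet1 \<Rightarrow> 'n jet1" where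
  "vprol1 X vx vu p =
     (vert vx vu (fst p), dz1 X vx p, dt1 X vx p, dz1 X vu p, dt1 X vu p)"

definition vprol2 ::
  "(real^'n) set \<Rightarrow> ('n tot \<Rightarrow> real^'n) \<Rightarrow> ('n tot \<Rightarrow> real) \<Rightarrow> 'n jet2 \<Rightarrow> 'n jet2" where
  "vprol2 X vx vu p =
     (vprol1 X vx vu (fst p),
      dz2 X (dz1 X vx) p, dt2 X (dz1 X vx) p, dt2 X (dt1 X vx) p,
      dz2 X (dz1 X vu) p, dt2 X (dz1 X vu) p, dt2 X (dt1 X vu) p)"

(* The restriction of the first prolongation to the face z = z0, as a vector field on
   boundary jets; dropping z loses nothing because its z-component is zero. *)
definition vprol1_face ::
  "(real^'n) set \<Rightarrow> ('n tot \<Rightarrow> real^'n) \<Rightarrow> ('n tot \<Rightarrow> real) \<Rightarrow> real \<Rightarrow> 'n bjet \<Rightarrow> 'n bjet" where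
  "vprol1_face X vx vu z0 b = drop_z (vprol1 X vx vu (at_z z0 b))"

type_synonym 'n rhs =
  "real \<times> real \<times> (real, 'n) vec \<times> (real, 'n) vec \<times> (real, 'n) vec \<times> real \<Rightarrow> (real, 'n) vec"

fun pde_x :: "'n rhs \<Rightarrow> 'n::finite \<Rightarrow> 'n jet2 \<Rightarrow> real" where
  "pde_x f \<alpha> (((z, t, x, u), xz, xt, uz, ut), xzz, xzt, xtt, uzz, uzt, utt) =
     xt $ \<alpha> - f (z, t, x, xz, xzz, u) $ \<alpha>"

fun uz_of :: "'n jet2 \<Rightarrow> real" where
  "uz_of ((e, xz, xt, uz, ut), xzz, xzt, xtt, uzz, uzt, utt) = uz"

fun uzz_of :: "'n jet2 \<Rightarrow> real" where
  "uzz_of ((e, xz, xt, uz, ut), xzz, xzt, xtt, uzz, uzt, utt) = uzz"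

fun uzt_of :: "'n jet2 \<Rightarrow> real" where
  "uzt_of ((e, xz, xt, uz, ut), xzz, xzt, xtt, uzz, uzt, utt) = uzt"

definition pde_eqs :: "'n::finite rhs \<Rightarrow> ('n jet2 \<Rightarrow> real) set" where
  "pde_eqs f = range (pde_x f) \<union> {uz_of, uzz_of, uzt_of}"

fun bc :: "(real \<times> (real, 'n) vec \<times> (real, 'n) vec \<Rightarrow> real) \<Rightarrow> 'n bjet \<Rightarrow> real" where
  "bc G (t, x, u, xz, xt, uz, ut) = G (t, x, xz)"

definition bc_eqs ::
  "nat \<Rightarrow> (nat \<Rightarrow> real \<times> (real, 'n) vec \<times> (real, 'n) vec \<Rightarrow> real) \<Rightarrow> ('n bjet \<Rightarrow> real) set" where
  "bc_eqs m G = (\<lambda>i. bc (G i)) ` {..<m}"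

fun pz :: "(real \<times> real \<Rightarrow> 'b::real_normed_vector) \<Rightarrow> real \<times> real \<Rightarrow> 'b" where
  "pz \<phi> (z, t) = vector_derivative (\<lambda>s. \<phi> (s, t)) (at z within {0..1})"

fun pt :: "(real \<times> real \<Rightarrow> 'b::real_normed_vector) \<Rightarrow> real \<times> real \<Rightarrow> 'b" where
  "pt \<phi> (z, t) = vector_derivative (\<lambda>s. \<phi> (z, s)) (at t within {0..})"

definition sprol1 :: "(real \<times> real \<Rightarrow> 'n::finite tot) \<Rightarrow> real \<times> real \<Rightarrow> 'n jet1" where
  "sprol1 \<gamma> p =
     (\<gamma> p, pz (x_of \<circ> \<gamma>) p, pt (x_of \<circ> \<gamma>) p, pz (u_of \<circ> \<gamma>) p, pt (u_of \<circ> \<gamma>) p)"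

definition sprol2 :: "(real \<times> real \<Rightarrow> 'n::finite tot) \<Rightarrow> real \<times> real \<Rightarrow> 'n jet2" where
  "sprol2 \<gamma> p =
     (sprol1 \<gamma> p,
      pz (pz (x_of \<circ> \<gamma>)) p, pt (pz (x_of \<circ> \<gamma>)) p, pt (pt (x_of \<circ> \<gamma>)) p,
      pz (pz (u_of \<circ> \<gamma>)) p, pt (pz (u_of \<circ> \<gamma>)) p, pt (pt (u_of \<circ> \<gamma>)) p)"

definition smooth_section :: "(real^'n) set \<Rightarrow> (real \<times> real \<Rightarrow> 'n tot) \<Rightarrow> bool" where
  "smooth_section X \<gamma> \<longleftrightarrow> smooth_on base \<gamma> \<and> (\<forall>p\<in>base. \<gamma> p \<in> Tot X \<and> proj (\<gamma> p) = p)"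

definition is_solution ::
  "(real^'n) set \<Rightarrow> 'n rhs \<Rightarrow>
   nat \<Rightarrow> (nat \<Rightarrow> real \<times> (real^'n) \<times> (real^'n) \<Rightarrow> real) \<Rightarrow>
   nat \<Rightarrow> (nat \<Rightarrow> real \<times> (real^'n) \<times> (real^'n) \<Rightarrow> real) \<Rightarrow>
   (real \<times> real \<Rightarrow> 'n tot) \<Rightarrow> bool" where
  "is_solution X f nA g nB h \<gamma> \<longleftrightarrow>
     smooth_section X \<gamma> \<and>
     (\<forall>p\<in>{0<..<1} \<times> {0..}. sprol2 \<gamma> p \<in> zero_set (Jet2 X) (pde_eqs f)) \<and>
     (\<forall>t\<ge>0. \<forall>i<nA. bc (g i) (drop_z (sprol1 \<gamma> (0, t))) = 0) \<and>
     (\<forall>t\<ge>0. \<forall>i<nB. bc (h i) (drop_z (sprol1 \<gamma> (1, t))) = 0)"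

(* Local flow: q is the value at time \<epsilon> of an integral curve in M, defined on an open
   interval around 0, that starts at p. *)
definition flows_to :: "'a::real_normed_vector set \<Rightarrow> ('a \<Rightarrow> 'a) \<Rightarrow> real \<Rightarrow> 'a \<Rightarrow> 'a \<Rightarrow> bool" where
  "flows_to M w \<epsilon> p q \<longleftrightarrow>
     (\<exists>J c. open J \<and> is_interval J \<and> 0 \<in> J \<and> \<epsilon> \<in> J \<and> c 0 = p \<and> c \<epsilon> = q \<and>
        (\<forall>s\<in>J. c s \<in> M \<and> (c has_vector_derivative w (c s)) (at s)))"

definition flow_dom :: "'a::real_normed_vector set \<Rightarrow> ('a \<Rightarrow> 'a) \<Rightarrow> real \<Rightarrow> 'a set" where
  "flow_dom M w \<epsilon> = {p. \<exists>q. flows_to M w \<epsilon> p q}"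

definition flow :: "'a::real_normed_vector set \<Rightarrow> ('a \<Rightarrow> 'a) \<Rightarrow> real \<Rightarrow> 'a \<Rightarrow> 'a" where
  "flow M w \<epsilon> p = (THE q. flows_to M w \<epsilon> p q)"

definition generates_vertical_symmetries ::
  "(real^'n) set \<Rightarrow> ('n tot \<Rightarrow> 'n tot) \<Rightarrow> ((real \<times> real \<Rightarrow> 'n tot) \<Rightarrow> bool) \<Rightarrow> bool" where
  "generates_vertical_symmetries X w sol \<longleftrightarrow>
     (\<forall>\<epsilon>. \<forall>p\<in>flow_dom (Tot X) w \<epsilon>. proj (flow (Tot X) w \<epsilon> p) = proj p) \<and>
     (\<forall>\<gamma> \<epsilon>. sol \<gamma> \<and> (\<forall>p\<in>base. \<gamma> p \<in> flow_dom (Tot X) w \<epsilon>) \<longrightarrow>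
        sol (flow (Tot X) w \<epsilon> \<circ> \<gamma>))"

end

theory Submission
  imports Defs
begin

text \<open>
  Let \<open>c (p, s)\<close> be the integral curve of \<open>v\<close>, in time rescaled by \<open>\<epsilon>\<close>, through the point \<open>\<gamma> p\<close> of a
  solution. It is smooth in \<open>(p, s)\<close> by smooth dependence of flows on initial values. As derivatives in
  \<open>z\<close>, \<open>t\<close> and \<open>s\<close> commute, the jets of the sections \<open>c (\<cdot>, s)\<close> over a fixed point \<open>p\<close> form integral
  curves of the prolongations of \<open>v\<close>. By the rank conditions, the distance of a point to the zero set is
  locally bounded by the values of the defining functions, so their Lie derivatives, which vanish on
  the zero set, are bounded by these values as well. Gronwall's inequality then keeps the
  jet curves inside the zero sets.
\<close>

section \<open>Smooth maps\<close>

text \<open>\<open>Tot X\<close> is a manifold with corners, and fields on it are smooth only in the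
  one-sided sense, so the usual theory of flows on open sets does not apply directly. Existence of
  the integral curves is part of the hypothesis on \<epsilon>; only their smooth dependence on the
  starting point has to be proved, and it is proved within the domain. The domain of the flow map is
  never studied: the curves are taken as a family over the closed convex set
  \<open>base \<times> {0..1}\<close>, and rescaling time makes this set the same for all \<epsilon>
  of either sign. Smoothness up to the boundary is what allows derivatives to be exchanged at the
  points where the boundary conditions live. Tangency is known on the zero set only, so a defining
  function cannot simply be shown to be constant along a jet curve; this is the obstacle that the
  rank condition removes. That argument takes place in a full neighbourhood in the jet space, which
  exists for t > 0: the PDE is imposed at interior z only, and boundary jets carry no z.\<close>

lemma Ck_on_cong:
  assumes "Ck_on k f S" "\<And>x. x \<in> S \<Longrightarrow> f x = g x"
  shows "Ck_on k g S"
proof (cases k)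
  case 0
  then show ?thesis using assms by (simp cong: continuous_on_cong_simp)
next
  case (Suc m)
  then obtain f' where f': "\<forall>x\<in>S. (f has_derivative f' x) (at x within S)"
      "\<forall>v. Ck_on m (\<lambda>x. f' x v) S"
    using assms by auto
  have "\<forall>x\<in>S. (g has_derivative f' x) (at x within S)"
    using f'(1) assms(2) by (metis has_derivative_transform)
  then show ?thesis using f'(2) Suc by auto
qed

lemma Ck_on_SucD: "Ck_on (Suc k) f S \<Longrightarrow> Ck_on k f S"
proof (induction k arbitrary: f)
  case 0
  then show ?case
    by (auto simp: continuous_on_eq_continuous_within intro: has_derivative_continuous)
next
  case (Suc k)
  then obtain f' where "\<forall>x\<in>S. (f has_derivative f' x) (at x within S)"
      "\<forall>v. Ck_on (Suc k) (\<lambda>x. f' x v) S"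
    by (metis Ck_on.simps(2))
  then show ?case using Suc.IH by auto
qed

lemma Ck_on_imp_continuous: "Ck_on k f S \<Longrightarrow> continuous_on S f"
  by (induction k) (simp, blast dest: Ck_on_SucD)

lemma Ck_on_const: "Ck_on k (\<lambda>x. c) S"
proof (induction k arbitrary: c)
  case (Suc k)
  show ?case by simp (rule exI[of _ "\<lambda>_ _. 0"], auto simp: Suc)
qed simp

lemma Ck_on_bounded_linear: "bounded_linear L \<Longrightarrow> Ck_on k L S"
proof (cases k)
  case 0
  assume "bounded_linear L"
  then show ?thesis using 0 by (simp add: linear_continuous_on)
next
  case (Suc m)
  assume "bounded_linear L"
  then show ?thesis using Suc
    by (auto intro!: exI[of _ "\<lambda>_. L"] Ck_on_const bounded_linear_imp_has_derivative)
qed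

lemma Ck_on_linear_compose:
  "bounded_linear L \<Longrightarrow> Ck_on k f S \<Longrightarrow> Ck_on k (\<lambda>x. L (f x)) S"
proof (induction k arbitrary: f)
  case 0
  then show ?case by (auto intro: bounded_linear.continuous_on)
next
  case (Suc k)
  then obtain f' where f': "\<forall>x\<in>S. (f has_derivative f' x) (at x within S)"
      "\<forall>v. Ck_on k (\<lambda>x. f' x v) S"
    by auto
  then have "\<forall>x\<in>S. ((\<lambda>x. L (f x)) has_derivative (\<lambda>v. L (f' x v))) (at x within S)"
    using Suc.prems(1) by (auto intro: bounded_linear.has_derivative)
  moreover have "\<forall>v. Ck_on k (\<lambda>x. L (f' x v)) S" using Suc f' by auto
  ultimately show ?case by (auto intro!: exI[of _ "\<lambda>x v. L (f' x v)"])
qed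

lemma Ck_on_add: "Ck_on k f S \<Longrightarrow> Ck_on k g S \<Longrightarrow> Ck_on k (\<lambda>x. f x + g x) S"
proof (induction k arbitrary: f g)
  case 0
  then show ?case by (auto intro: continuous_intros)
next
  case (Suc k)
  then obtain f' g' where "\<forall>x\<in>S. (f has_derivative f' x) (at x within S)"
      "\<forall>v. Ck_on k (\<lambda>x. f' x v) S" "\<forall>x\<in>S. (g has_derivative g' x) (at x within S)"
      "\<forall>v. Ck_on k (\<lambda>x. g' x v) S"
    by auto
  then show ?case using Suc.IH
    by (auto intro!: exI[of _ "\<lambda>x v. f' x v + g' x v"] has_derivative_add)
qed

lemma Ck_on_sum: "(\<And>i. i \<in> I \<Longrightarrow> Ck_on k (f i) S) \<Longrightarrow> Ck_on k (\<lambda>x. \<Sum>i\<in>I. f i x) S"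
  by (induction I rule: infinite_finite_induct) (auto intro: Ck_on_const Ck_on_add)

lemma Ck_on_scaleR:
  fixes g :: "_ \<Rightarrow> _::real_normed_vector"
  shows "Ck_on k f S \<Longrightarrow> Ck_on k g S \<Longrightarrow> Ck_on k (\<lambda>x. f x *\<^sub>R g x) S"
proof (induction k arbitrary: f g)
  case 0
  then show ?case by (auto intro: continuous_intros)
next
  case (Suc k)
  then obtain f' g' where *: "\<forall>x\<in>S. (f has_derivative f' x) (at x within S)"
      "\<forall>v. Ck_on k (\<lambda>x. f' x v) S" "\<forall>x\<in>S. (g has_derivative g' x) (at x within S)"
      "\<forall>v. Ck_on k (\<lambda>x. g' x v) S"
    by auto
  have "Ck_on k f S" "Ck_on k g S" using Suc.prems Ck_on_SucD by blast+
  with * show ?case using Suc.IH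
    by (auto intro!: exI[of _ "\<lambda>x v. f x *\<^sub>R g' x v + f' x v *\<^sub>R g x"] has_derivative_scaleR Ck_on_add)
qed

text \<open>In the derivative \<open>g' (f x) (f' x v)\<close> both the base point and the direction
  vary with \<open>x\<close>, so the induction hypothesis does not fit it directly. Expanding the
  direction over the basis leaves sums of scalar functions times \<open>g' (f x) b\<close> with
  fixed \<open>b\<close>, and to these it applies.\<close>

lemma Ck_on_compose:
  fixes f :: "'a::real_normed_vector \<Rightarrow> 'b::euclidean_space" and g :: "'b \<Rightarrow> 'c::real_normed_vector"
  shows "Ck_on k g T \<Longrightarrow> Ck_on k f S \<Longrightarrow> f ` S \<subseteq> T \<Longrightarrow> Ck_on k (\<lambda>x. g (f x)) S"
proof (induction k arbitrary: g)
  case 0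
  then show ?case by (auto intro: continuous_on_compose2)
next
  case (Suc k)
  obtain f' where f': "\<And>x. x\<in>S \<Longrightarrow> (f has_derivative f' x) (at x within S)"
      "\<And>v. Ck_on k (\<lambda>x. f' x v) S"
    using Suc.prems(2) by auto
  from Suc.prems(1) obtain g' where g': "\<And>x. x\<in>T \<Longrightarrow> (g has_derivative g' x) (at x within T)"
      "\<And>v. Ck_on k (\<lambda>x. g' x v) T"
    by auto
  have der: "((\<lambda>x. g (f x)) has_derivative (\<lambda>v. g' (f x) (f' x v))) (at x within S)" if "x \<in> S" for x
  proof -
    have "f x \<in> T" using that Suc.prems by auto
    then have "(g has_derivative g' (f x)) (at (f x) within f ` S)"
      using g'(1) Suc.prems(3) has_derivative_subset by blast
    then show ?thesis using has_derivative_in_compose[OF f'(1)[OF that]] by auto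
  qed
  have fk: "Ck_on k f S" using Suc.prems Ck_on_SucD by blast
  have "Ck_on k (\<lambda>x. g' (f x) (f' x v)) S" for v
  proof (rule Ck_on_cong)
    show "Ck_on k (\<lambda>x. \<Sum>b\<in>Basis. (f' x v \<bullet> b) *\<^sub>R g' (f x) b) S"
      using Suc.prems(3)
      by (intro Ck_on_sum Ck_on_scaleR Ck_on_linear_compose[OF bounded_linear_inner_left]
          Suc.IH f' g' fk)
  next
    fix x assume "x \<in> S"
    then have "linear (g' (f x))"
      using g'(1) Suc.prems(3) has_derivative_linear by blast
    then have "g' (f x) (\<Sum>b\<in>Basis. (f' x v \<bullet> b) *\<^sub>R b)
        = (\<Sum>b\<in>Basis. (f' x v \<bullet> b) *\<^sub>R g' (f x) b)"
      by (simp add: linear_sum linear_cmul)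
    then show "(\<Sum>b\<in>Basis. (f' x v \<bullet> b) *\<^sub>R g' (f x) b) = g' (f x) (f' x v)"
      by (simp add: euclidean_representation)
  qed
  then show ?case using der by (auto intro!: exI[of _ "\<lambda>x v. g' (f x) (f' x v)"])
qed

lemma Ck_on_Pair:
  assumes "Ck_on k f S" "Ck_on k g S"
  shows "Ck_on k (\<lambda>x. (f x, g x)) S"
proof -
  have "Ck_on k (\<lambda>x. (f x, 0) + (0, g x)) S"
    by (intro Ck_on_add Ck_on_linear_compose[OF _ assms(1), of "\<lambda>y. (y, 0)"]
        Ck_on_linear_compose[OF _ assms(2), of "\<lambda>y. (0, y)"])
      (auto intro!: bounded_linear_intros)
  then show ?thesis by simp
qed

section \<open>Infinitely differentiable functions\<close>

lemma smooth_on_Ck: "smooth_on S f \<Longrightarrow> Ck_on k f S"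
  by (simp add: smooth_on_def)

lemma smooth_on_cong:
  "smooth_on S f \<Longrightarrow> (\<And>x. x \<in> S \<Longrightarrow> f x = g x) \<Longrightarrow> smooth_on S g"
  unfolding smooth_on_def by (metis Ck_on_cong)

lemma smooth_on_imp_continuous_on: "smooth_on S f \<Longrightarrow> continuous_on S f"
  using Ck_on_imp_continuous smooth_on_Ck by blast

lemma smooth_on_const: "smooth_on S (\<lambda>x. c)"
  by (simp add: smooth_on_def Ck_on_const)

lemma smooth_on_bounded_linear: "bounded_linear L \<Longrightarrow> smooth_on S L"
  by (simp add: smooth_on_def Ck_on_bounded_linear)

lemma smooth_on_linear_compose:
  "bounded_linear L \<Longrightarrow> smooth_on S f \<Longrightarrow> smooth_on S (\<lambda>x. L (f x))"
  by (simp add: smooth_on_def Ck_on_linear_compose)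

lemma smooth_on_add: "smooth_on S f \<Longrightarrow> smooth_on S g \<Longrightarrow> smooth_on S (\<lambda>x. f x + g x)"
  by (simp add: smooth_on_def Ck_on_add)

lemma smooth_on_sum: "(\<And>i. i \<in> I \<Longrightarrow> smooth_on S (f i)) \<Longrightarrow> smooth_on S (\<lambda>x. \<Sum>i\<in>I. f i x)"
  by (simp add: smooth_on_def Ck_on_sum)

lemma smooth_on_scaleR:
  "smooth_on S f \<Longrightarrow> smooth_on S g \<Longrightarrow> smooth_on S (\<lambda>x. f x *\<^sub>R g x)"
  by (simp add: smooth_on_def Ck_on_scaleR)

lemma smooth_on_compose:
  fixes f :: "'a::real_normed_vector \<Rightarrow> 'b::euclidean_space"
  shows "smooth_on T g \<Longrightarrow> smooth_on S f \<Longrightarrow> f ` S \<subseteq> T \<Longrightarrow> smooth_on S (\<lambda>x. g (f x))"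
  unfolding smooth_on_def using Ck_on_compose by blast

lemma smooth_on_Pair:
  "smooth_on S f \<Longrightarrow> smooth_on S g \<Longrightarrow> smooth_on S (\<lambda>x. (f x, g x))"
  by (simp add: smooth_on_def Ck_on_Pair)

lemmas smooth_on_fst = smooth_on_linear_compose[OF bounded_linear_fst]
lemmas smooth_on_snd = smooth_on_linear_compose[OF bounded_linear_snd]
lemmas smooth_on_id = smooth_on_bounded_linear[OF bounded_linear_ident]

(* This is the hypothesis of frechet_derivative_unique_within; it passes to products. *)
definition fat :: "'a::euclidean_space set \<Rightarrow> bool" where
  "fat S \<longleftrightarrow> (\<forall>x\<in>S. \<forall>i\<in>Basis. \<forall>e>0. \<exists>d. 0 < \<bar>d\<bar> \<and> \<bar>d\<bar> < e \<and> x + d *\<^sub>R i \<in> S)"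

lemma fat_Times:
  assumes "fat A" "fat B" shows "fat (A \<times> B)"
  unfolding fat_def
proof (intro ballI allI impI)
  fix p i :: "'a \<times> 'b" and e :: real
  assume p: "p \<in> A \<times> B" and i: "i \<in> Basis" and e: "e > 0"
  from i consider j where "j \<in> Basis" "i = (j, 0)" | j where "j \<in> Basis" "i = (0, j)"
    by (auto simp: Basis_prod_def)
  then show "\<exists>d. 0 < \<bar>d\<bar> \<and> \<bar>d\<bar> < e \<and> p + d *\<^sub>R i \<in> A \<times> B"
  proof cases
    case 1
    then show ?thesis using assms(1) p e by (cases p) (auto simp: fat_def)
  next
    case 2
    then show ?thesis using assms(2) p e by (cases p) (auto simp: fat_def)
  qed
qed

lemma fat_open:
  assumes "open S" shows "fat S"
  unfolding fat_def
proof (intro ballI allI impI)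
  fix x i :: 'a and e :: real assume x: "x \<in> S" and i: "i \<in> Basis" "e > 0"
  obtain r where r: "r > 0" "ball x r \<subseteq> S" using assms x openE by blast
  have "x + (min r e / 2) *\<^sub>R i \<in> ball x r" using i r by (auto simp: dist_norm)
  then show "\<exists>d. 0 < \<bar>d\<bar> \<and> \<bar>d\<bar> < e \<and> x + d *\<^sub>R i \<in> S"
    using r i by (intro exI[of _ "min r e / 2"]) auto
qed

lemma fat_interval: "a < b \<Longrightarrow> fat {a..(b::real)}"
  unfolding fat_def
proof (intro ballI allI impI)
  fix x i :: real and e :: real assume ab: "a < b" and x: "x \<in> {a..b}" and i: "i \<in> Basis" "e > 0"
  show "\<exists>d. 0 < \<bar>d\<bar> \<and> \<bar>d\<bar> < e \<and> x + d *\<^sub>R i \<in> {a..b}"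
  proof (cases "x < b")
    case True
    then show ?thesis using x i by (intro exI[of _ "min (b - x) e / 2"]) (auto simp: min_def field_simps)
  next
    case False
    then show ?thesis using x i ab
      by (intro exI[of _ "- min (b - a) e / 2"]) (auto simp: min_def field_simps)
  qed
qed

lemma fat_ray: "fat {(a::real)..}"
  unfolding fat_def
proof (intro ballI allI impI)
  fix x i e :: real assume "x \<in> {a..}" "i \<in> Basis" "e > 0"
  then show "\<exists>d. 0 < \<bar>d\<bar> \<and> \<bar>d\<bar> < e \<and> x + d *\<^sub>R i \<in> {a..}"
    by (intro exI[of _ "e / 2"]) auto
qed

lemma frechet_derivative_within_eq:
  "(f has_derivative f') (at x within S) \<Longrightarrow> fat S \<Longrightarrow> x \<in> S \<Longrightarrow>
    frechet_derivative f (at x within S) = f'"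
  unfolding fat_def
  by (rule frechet_derivative_unique_within[of f _ x S])
    (auto simp: frechet_derivative_works[symmetric] differentiable_def)

section \<open>Derivatives on sets that determine them\<close>

abbreviation frd :: "'a::real_normed_vector set \<Rightarrow> ('a \<Rightarrow> 'b::real_normed_vector) \<Rightarrow> 'a \<Rightarrow> 'a \<Rightarrow> 'b" where
  "frd S f x \<equiv> frechet_derivative f (at x within S)"

text \<open>\<open>frechet_derivative\<close> is a choice among all derivatives, so it suffices that
  both functions have the same derivatives.\<close>

lemma frd_cong:
  assumes "\<And>y. y \<in> S \<Longrightarrow> f y = g y" "x \<in> S"
  shows "frd S f x = frd S g x"
proof -
  have "(f has_derivative D) (at x within S) \<longleftrightarrow> (g has_derivative D) (at x within S)" for D
    by (metis assms has_derivative_transform)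
  then show ?thesis by (simp add: frechet_derivative_def)
qed

lemma Ck_on_has_frd:
  "Ck_on (Suc k) f S \<Longrightarrow> x \<in> S \<Longrightarrow> (f has_derivative frd S f x) (at x within S)"
  by (auto simp: frechet_derivative_works[symmetric] differentiable_def)

lemma Ck_on_frd:
  assumes "Ck_on (Suc k) f S" "fat S"
  shows "Ck_on k (\<lambda>x. frd S f x v) S"
proof -
  obtain f' where f': "\<forall>x\<in>S. (f has_derivative f' x) (at x within S)"
      "\<forall>v. Ck_on k (\<lambda>x. f' x v) S"
    using assms(1) by auto
  show ?thesis
  proof (rule Ck_on_cong)
    show "Ck_on k (\<lambda>x. f' x v) S" using f' by auto
  qed (use f' assms frechet_derivative_within_eq in metis)
qed

lemma smooth_on_has_derivative:
  "smooth_on S f \<Longrightarrow> x \<in> S \<Longrightarrow> (f has_derivative frd S f x) (at x within S)"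
  using smooth_on_Ck Ck_on_has_frd by blast

lemma smooth_on_linear_frd: "smooth_on S f \<Longrightarrow> x \<in> S \<Longrightarrow> linear (frd S f x)"
  using has_derivative_linear smooth_on_has_derivative by blast

lemma smooth_on_frd:
  "smooth_on S f \<Longrightarrow> fat S \<Longrightarrow> smooth_on S (\<lambda>x. frd S f x v)"
  unfolding smooth_on_def by (blast intro: Ck_on_frd)

text \<open>Covers Lie derivatives and total derivatives, where base point and direction both vary.
  As for compositions, the direction is expanded over the basis.\<close>

lemma smooth_on_frd_field:
  fixes f :: "'a::euclidean_space \<Rightarrow> 'b::real_normed_vector"
  assumes "smooth_on S f" "fat S" "smooth_on T w" "smooth_on T m" "m ` T \<subseteq> S"
  shows "smooth_on T (\<lambda>x. frd S f (m x) (w x))"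
proof (rule smooth_on_cong)
  show "smooth_on T (\<lambda>x. \<Sum>b\<in>Basis. (w x \<bullet> b) *\<^sub>R frd S f (m x) b)"
    using assms
    by (intro smooth_on_sum smooth_on_scaleR smooth_on_linear_compose[OF bounded_linear_inner_left]
        smooth_on_compose[OF smooth_on_frd, of S f T m]) auto
next
  fix x assume "x \<in> T"
  then have "linear (frd S f (m x))" using assms smooth_on_linear_frd by blast
  then have "frd S f (m x) (\<Sum>b\<in>Basis. (w x \<bullet> b) *\<^sub>R b)
      = (\<Sum>b\<in>Basis. (w x \<bullet> b) *\<^sub>R frd S f (m x) b)"
    by (simp add: linear_sum linear_cmul)
  then show "(\<Sum>b\<in>Basis. (w x \<bullet> b) *\<^sub>R frd S f (m x) b) = frd S f (m x) (w x)"
    by (simp add: euclidean_representation)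
qed

lemma smooth_on_chain:
  assumes "smooth_on T g" "smooth_on S f" "f ` S \<subseteq> T" "x \<in> S" "fat S"
  shows "frd S (\<lambda>x. g (f x)) x v = frd T g (f x) (frd S f x v)"
proof -
  have "(g has_derivative frd T g (f x)) (at (f x) within f ` S)"
    using smooth_on_has_derivative[OF assms(1)] assms by (meson has_derivative_subset image_subset_iff)
  then have "((\<lambda>x. g (f x)) has_derivative (\<lambda>v. frd T g (f x) (frd S f x v))) (at x within S)"
    using has_derivative_in_compose[OF smooth_on_has_derivative[OF assms(2,4)]] by auto
  then show ?thesis using frechet_derivative_within_eq assms by metis
qed

text \<open>\<open>Ck_on\<close> provides continuity of the derivative in each fixed direction. In
  finite dimension this is continuity in the operator norm, which the estimates for differential
  equations use.\<close>

lemma Ck_on_1_blinfun: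
  fixes f :: "'a::euclidean_space \<Rightarrow> 'b::real_normed_vector"
  assumes "Ck_on (Suc 0) f S"
  obtains F :: "'a \<Rightarrow> ('a \<Rightarrow>\<^sub>L 'b)" where
    "\<And>x. x \<in> S \<Longrightarrow> (f has_derivative blinfun_apply (F x)) (at x within S)" "continuous_on S F"
proof -
  obtain f' where f': "\<And>x. x\<in>S \<Longrightarrow> (f has_derivative f' x) (at x within S)"
      "\<And>v. continuous_on S (\<lambda>x. f' x v)"
    using assms by auto
  have eq: "blinfun_apply (Blinfun (f' x)) = f' x" if "x \<in> S" for x
    using f'(1)[OF that] by (simp add: bounded_linear_Blinfun_apply has_derivative_bounded_linear)
  show ?thesis
  proof
    show "(f has_derivative blinfun_apply (Blinfun (f' x))) (at x within S)" if "x \<in> S" for x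
      using f'(1) eq that by simp
    show "continuous_on S (\<lambda>x. Blinfun (f' x))"
    proof (rule continuous_on_blinfun_componentwise)
      fix i :: 'a
      show "continuous_on S (\<lambda>x. blinfun_apply (Blinfun (f' x)) i)"
        using f'(2)[of i] continuous_on_cong[OF refl, of S "\<lambda>x. blinfun_apply (Blinfun (f' x)) i"] eq by simp
    qed
  qed
qed

section \<open>Gronwall and linear differential equations\<close>

text \<open>The squared norm is differentiable also where \<open>y\<close> vanishes, so the estimate
  is made for it. The interval has length at most 1, which replaces the growing factor by the
  constant \<open>exp (2 * (L + 1))\<close>; taking the root halves the exponent.\<close>

lemma gronwall:
  fixes y :: "real \<Rightarrow> 'a::real_inner"
  assumes der: "\<And>s. s \<in> {a..b} \<Longrightarrow> (y has_vector_derivative y' s) (at s within {a..b})"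
    and bound: "\<And>s. s \<in> {a..b} \<Longrightarrow> norm (y' s) \<le> L * norm (y s) + \<kappa>"
    and "L \<ge> 0" "\<kappa> \<ge> 0" "b - a \<le> 1" and s: "s \<in> {a..b}"
  shows "norm (y s) \<le> exp (L + 1) * (norm (y a) + \<kappa>)"
proof -
  \<comment> \<open>The derivative of the squared norm contributes 2 * L; the additional 1 absorbs
    the cross term, since twice the product of \<open>norm (y s)\<close> and \<kappa> is at most the
    sum of their squares.\<close>
  define K where "K = 2 * L + 1"
  define N where "N s = y s \<bullet> y s" for s
  \<comment> \<open>This function is decreasing: the exponential factor compensates the growth
    \<open>K * N s\<close>, the linear term the remaining square of \<kappa>.\<close>
  define g where "g s = exp (- K * (s - a)) * N s - \<kappa>\<^sup>2 * (s - a)" for s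
  have N: "(N has_real_derivative 2 * (y s \<bullet> y' s)) (at s within {a..b})" if "s \<in> {a..b}" for s
  proof -
    have "(N has_derivative (\<lambda>h. y s \<bullet> (h *\<^sub>R y' s) + (h *\<^sub>R y' s) \<bullet> y s)) (at s within {a..b})"
      unfolding N_def using der[OF that]
      by (intro has_derivative_inner) (auto simp: has_vector_derivative_def)
    then show ?thesis
      by (auto simp: has_field_derivative_def inner_commute algebra_simps mult_commute_abs)
  qed
  have g: "(g has_real_derivative exp (- K * (s - a)) * (2 * (y s \<bullet> y' s) - K * N s) - \<kappa>\<^sup>2)
      (at s within {a..b})" if "s \<in> {a..b}" for s
    unfolding g_def
    by (rule derivative_eq_intros N[OF that] refl | simp)+ (simp add: algebra_simps)
  have neg: "exp (- K * (s - a)) * (2 * (y s \<bullet> y' s) - K * N s) - \<kappa>\<^sup>2 \<le> 0" if s: "s \<in> {a..b}" for s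
  proof -
    have "y s \<bullet> y' s \<le> norm (y s) * (L * norm (y s) + \<kappa>)"
      using norm_cauchy_schwarz bound[OF s] by (meson mult_left_mono norm_ge_zero order_trans)
    moreover have "2 * (norm (y s) * \<kappa>) \<le> (norm (y s))\<^sup>2 + \<kappa>\<^sup>2"
      using sum_squares_bound[of "norm (y s)" \<kappa>] by (simp add: mult.assoc)
    ultimately have "2 * (y s \<bullet> y' s) - K * N s \<le> \<kappa>\<^sup>2"
      by (simp add: K_def N_def dot_square_norm power2_eq_square algebra_simps)
    then have "exp (- K * (s - a)) * (2 * (y s \<bullet> y' s) - K * N s) \<le> exp (- K * (s - a)) * \<kappa>\<^sup>2"
      by simp
    also have "\<dots> \<le> 1 * \<kappa>\<^sup>2"
      using s \<open>L \<ge> 0\<close>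
      by (intro mult_right_mono) (auto simp: K_def intro: mult_nonpos_nonneg)
    finally show ?thesis by simp
  qed
  have "g s \<le> g a"
  proof (rule DERIV_nonpos_imp_decreasing_open[where f = g])
    show "a \<le> s" using s by simp
    have "continuous_on {a..b} g"
      by (rule DERIV_continuous_on) (rule g)
    then show "continuous_on {a..s} g" using s by (auto intro: continuous_on_subset)
    fix x assume "a < x" "x < s"
    then have "(g has_real_derivative exp (- K * (x - a)) * (2 * (y x \<bullet> y' x) - K * N x) - \<kappa>\<^sup>2) (at x)"
      using g[of x] s by (simp add: at_within_Icc_at)
    then show "\<exists>d. (g has_real_derivative d) (at x) \<and> d \<le> 0"
      using neg[of x] \<open>a < x\<close> \<open>x < s\<close> s by (intro exI conjI) auto
  qed
  then have "exp (- K * (s - a)) * N s \<le> N a + \<kappa>\<^sup>2 * (s - a)"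
    by (simp add: g_def)
  also have "\<dots> \<le> N a + \<kappa>\<^sup>2 * 1"
    using s assms by (intro add_left_mono mult_left_mono) auto
  also have "\<dots> \<le> (norm (y a) + \<kappa>)\<^sup>2"
    using \<open>\<kappa> \<ge> 0\<close> by (simp add: N_def dot_square_norm power2_eq_square algebra_simps)
  finally have "exp (- K * (s - a)) * N s \<le> (norm (y a) + \<kappa>)\<^sup>2" .
  moreover have "exp (- K * (s - a)) = inverse (exp (K * (s - a)))"
    by (simp add: exp_minus)
  ultimately have "N s \<le> exp (K * (s - a)) * (norm (y a) + \<kappa>)\<^sup>2"
    using pos_divide_le_eq[OF exp_gt_zero, of "N s" "K * (s - a)" "(norm (y a) + \<kappa>)\<^sup>2"]
    by (metis divide_inverse_commute mult.commute)
  also have "\<dots> \<le> exp (2 * (L + 1)) * (norm (y a) + \<kappa>)\<^sup>2"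
  proof -
    have "K * (s - a) \<le> K * 1" using s assms by (intro mult_left_mono) (auto simp: K_def)
    then show ?thesis by (intro mult_right_mono) (auto simp: K_def)
  qed
  also have "\<dots> = (exp (L + 1) * (norm (y a) + \<kappa>))\<^sup>2"
    by (simp add: power_mult_distrib flip: exp_double)
  finally have "(norm (y s))\<^sup>2 \<le> (exp (L + 1) * (norm (y a) + \<kappa>))\<^sup>2"
    by (simp add: N_def dot_square_norm)
  then show ?thesis by (rule power2_le_imp_le) (use \<open>\<kappa> \<ge> 0\<close> in auto)
qed

text \<open>The solution is the series of iterated integrals starting from the constant initial
  value. Its n-th term is bounded by \<open>L ^ n / fact n\<close> times the initial norm, so the
  series converges uniformly on all of {0..1}, however large \<open>L\<close> is; by linearity no
  smallness or invariant ball is involved.\<close>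

lemma linear_ode_solution:
  fixes A :: "real \<Rightarrow> ('a::banach \<Rightarrow>\<^sub>L 'a)"
  assumes "continuous_on {0..1} A"
  obtains \<eta> where "\<eta> 0 = \<eta>0"
    "\<And>s. s \<in> {0..1} \<Longrightarrow> (\<eta> has_vector_derivative A s (\<eta> s)) (at s within {0..1})"
proof -
  obtain L where L: "\<And>s. s \<in> {0..1} \<Longrightarrow> norm (A s) \<le> L" and "L \<ge> 0"
  proof -
    have "bounded (A ` {0..1})"
      using assms compact_continuous_image compact_imp_bounded compact_Icc by blast
    then obtain L where "\<forall>x\<in>A ` {0..1}. norm x \<le> L" unfolding bounded_iff by blast
    then show ?thesis by (intro that[of "max L 0"]) force+
  qed
  define T where "T h = (\<lambda>s. integral {0..s} (\<lambda>r. blinfun_apply (A r) (h r)))" for h :: "real \<Rightarrow> 'a"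
  define trm where "trm n = (T ^^ n) (\<lambda>_. \<eta>0)" for n
  have trm0: "trm 0 = (\<lambda>_. \<eta>0)" and trm_Suc: "trm (Suc n) = T (trm n)" for n
    by (auto simp: trm_def)
  have Tder: "(T h has_vector_derivative A s (h s)) (at s within {0..1})"
    if "continuous_on {0..1} h" "s \<in> {0..1}" for h s
    unfolding T_def using assms that
    by (intro integral_has_vector_derivative) (auto intro!: continuous_intros)
  have cont: "continuous_on {0..1} (trm n)" for n
  proof (induction n)
    case (Suc n)
    then show ?case unfolding trm_Suc
      by (intro continuous_on_vector_derivative) (rule Tder[OF Suc])
  qed (simp add: trm0)
  have bnd: "norm (trm n s) \<le> L ^ n * s ^ n / fact n * norm \<eta>0" if "s \<in> {0..1}" for n s
    using that
  proof (induction n arbitrary: s)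
    case (Suc n)
    have int: "((\<lambda>r. L * (L ^ n * r ^ n / fact n * norm \<eta>0)) has_integral
        L ^ Suc n * s ^ Suc n / fact (Suc n) * norm \<eta>0) {0..s}"
    proof -
      have nz: "fact n + fact n * real n \<noteq> 0"
        by (metis add_pos_nonneg fact_gt_zero less_irrefl mult_nonneg_nonneg of_nat_0_le_iff less_imp_le)
      have d: "((\<lambda>r. L ^ Suc n * r ^ Suc n / fact (Suc n) * norm \<eta>0) has_vector_derivative
           L * (L ^ n * r ^ n / fact n * norm \<eta>0)) (at r within {0..s})" for r
        unfolding has_real_derivative_iff_has_vector_derivative[symmetric]
        by (rule derivative_eq_intros refl | simp del: fact_Suc)+ (use nz in \<open>simp add: field_simps\<close>)
      then show ?thesis
        using fundamental_theorem_of_calculus[of 0 s, OF _ d] Suc.prems by simp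
    qed
    have "norm (trm (Suc n) s) \<le> integral {0..s} (\<lambda>r. L * (L ^ n * r ^ n / fact n * norm \<eta>0))"
      unfolding trm_Suc T_def
    proof (rule integral_norm_bound_integral)
      show "(\<lambda>r. blinfun_apply (A r) (trm n r)) integrable_on {0..s}"
        using assms cont[of n] Suc.prems
        by (intro integrable_continuous_real)
          (auto intro!: continuous_intros intro: continuous_on_subset)
      show "norm (blinfun_apply (A r) (trm n r)) \<le> L * (L ^ n * r ^ n / fact n * norm \<eta>0)"
        if "r \<in> {0..s}" for r
      proof -
        have r: "r \<in> {0..1}" using that Suc.prems by auto
        have "norm (blinfun_apply (A r) (trm n r)) \<le> norm (A r) * norm (trm n r)"
          by (rule norm_blinfun)
        also have "\<dots> \<le> L * (L ^ n * r ^ n / fact n * norm \<eta>0)"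
          using L[OF r] Suc.IH[OF r] \<open>L \<ge> 0\<close> by (intro mult_mono) auto
        finally show ?thesis .
      qed
    qed (use int in blast)
    then show ?case by (simp only: integral_unique[OF int])
  qed (simp add: trm0)
  define \<eta> where "\<eta> s = (\<Sum>n. trm n s)" for s
  have unif: "uniform_limit {0..1} (\<lambda>n s. \<Sum>i<n. trm i s) \<eta> sequentially"
    unfolding \<eta>_def
  proof (rule Weierstrass_m_test)
    fix n and s :: real assume s: "s \<in> {0..1}"
    have "L ^ n * s ^ n / fact n * norm \<eta>0 \<le> L ^ n * 1 / fact n * norm \<eta>0"
      using s \<open>L \<ge> 0\<close> by (intro mult_right_mono divide_right_mono mult_left_mono power_le_one) auto
    then show "norm (trm n s) \<le> L ^ n / fact n * norm \<eta>0"
      using bnd[OF s, of n] by simp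
  next
    show "summable (\<lambda>n. L ^ n / fact n * norm \<eta>0)"
      using summable_exp[of L] by (intro summable_mult2) (simp add: field_simps)
  qed
  have cont\<eta>: "continuous_on {0..1} \<eta>"
    by (rule uniform_limit_theorem[OF _ unif]) (auto intro!: always_eventually continuous_intros cont)
  have int: "\<eta> s = \<eta>0 + T \<eta> s" if s: "s \<in> {0..1}" for s
  proof -
    have sub: "{0..s} \<subseteq> {0..1}" using s by auto
    have u: "uniform_limit {0..s} (\<lambda>n r. blinfun_apply (A r) (\<Sum>i<n. trm i r))
        (\<lambda>r. blinfun_apply (A r) (\<eta> r)) sequentially"
    proof (rule uniform_limitI)
      fix e :: real assume "e > 0"
      then have e: "e / (L + 1) > 0" using \<open>L \<ge> 0\<close> by simp
      show "\<forall>\<^sub>F n in sequentially. \<forall>r\<in>{0..s}.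
          dist (blinfun_apply (A r) (\<Sum>i<n. trm i r)) (blinfun_apply (A r) (\<eta> r)) < e"
        using uniform_limitD[OF unif e]
      proof eventually_elim
        case (elim n)
        show ?case
        proof
          fix r assume "r \<in> {0..s}"
          then have r: "r \<in> {0..1}" using sub by auto
          have "dist (blinfun_apply (A r) (\<Sum>i<n. trm i r)) (blinfun_apply (A r) (\<eta> r))
              = norm (blinfun_apply (A r) ((\<Sum>i<n. trm i r) - \<eta> r))"
            by (simp add: dist_norm blinfun.diff_right)
          also have "\<dots> \<le> L * dist (\<Sum>i<n. trm i r) (\<eta> r)"
            unfolding dist_norm
            by (rule order_trans[OF norm_blinfun mult_right_mono[OF L[OF r] norm_ge_zero]])
          also have "\<dots> \<le> L * (e / (L + 1))"
            using elim r \<open>L \<ge> 0\<close> by (intro mult_left_mono[OF less_imp_le]) blast+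
          also have "\<dots> < e" using \<open>e > 0\<close> \<open>L \<ge> 0\<close> by (simp add: field_simps)
          finally show "dist (blinfun_apply (A r) (\<Sum>i<n. trm i r)) (blinfun_apply (A r) (\<eta> r)) < e" .
        qed
      qed
    qed
    have c: "continuous_on {0..s} (\<lambda>r. blinfun_apply (A r) (\<Sum>i<n. trm i r))" for n
      using assms by (intro continuous_intros continuous_on_subset[OF _ sub] cont)
    obtain I J where IJ: "\<And>n. ((\<lambda>r. blinfun_apply (A r) (\<Sum>i<n. trm i r)) has_integral I n) {0..s}"
        "((\<lambda>r. blinfun_apply (A r) (\<eta> r)) has_integral J) {0..s}" "I \<longlonglongrightarrow> J"
      using uniform_limit_integral[OF u c] by auto
    \<comment> \<open>Integration turns each term into the next one, so the integral of a partial
      sum is the following partial sum without its term 0.\<close>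
    have I: "I n = (\<Sum>i<Suc n. trm i s) - \<eta>0" for n
    proof -
      have ti: "(\<lambda>r. blinfun_apply (A r) (trm i r)) integrable_on {0..s}" for i
        using assms cont sub
        by (intro integrable_continuous_real continuous_intros continuous_on_subset[OF _ sub])
      have "I n = integral {0..s} (\<lambda>r. \<Sum>i<n. blinfun_apply (A r) (trm i r))"
        using IJ(1)[of n] by (simp add: integral_unique blinfun.sum_right)
      also have "\<dots> = (\<Sum>i<n. trm (Suc i) s)"
        using ti by (simp add: integral_sum trm_Suc T_def)
      also have "\<dots> = (\<Sum>i<Suc n. trm i s) - \<eta>0"
        by (subst sum.lessThan_Suc_shift) (simp add: trm0)
      finally show ?thesis .
    qed
    have "(\<lambda>n. \<Sum>i<n. trm i s) \<longlonglongrightarrow> \<eta> s"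
      using tendsto_uniform_limitI[OF unif s] .
    then have "(\<lambda>n. \<Sum>i<Suc n. trm i s) \<longlonglongrightarrow> \<eta> s"
      by (rule LIMSEQ_Suc)
    then have "I \<longlonglongrightarrow> \<eta> s - \<eta>0"
      unfolding I by (auto intro!: tendsto_intros)
    then have "J = \<eta> s - \<eta>0" using IJ(3) LIMSEQ_unique by blast
    then show ?thesis using IJ(2) by (simp add: T_def integral_unique)
  qed
  show ?thesis
  proof
    show "\<eta> 0 = \<eta>0" using int[of 0] by (simp add: T_def)
    fix s :: real assume s: "s \<in> {0..1}"
    have "((\<lambda>s. \<eta>0 + T \<eta> s) has_vector_derivative A s (\<eta> s)) (at s within {0..1})"
      using Tder[OF cont\<eta> s] by (auto intro!: derivative_eq_intros)
    then show "(\<eta> has_vector_derivative A s (\<eta> s)) (at s within {0..1})"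
      by (rule has_vector_derivative_transform[rotated 2]) (use s int in auto)
  qed
qed

section \<open>Differentiability of families of integral curves\<close>

(* The domain of the field is C \<inter> Q with C closed and convex and Q open: near a compact subset,
   such a set is locally convex and locally compact with uniform radii. *)
locale C1_field =
  fixes C Q :: "'a::euclidean_space set" and w :: "'a \<Rightarrow> 'a" and W :: "'a \<Rightarrow> ('a \<Rightarrow>\<^sub>L 'a)"
  assumes C: "closed C" "convex C" and Q: "open Q"
    and der: "\<And>x. x \<in> C \<inter> Q \<Longrightarrow> (w has_derivative blinfun_apply (W x)) (at x within C \<inter> Q)"
    and contW: "continuous_on (C \<inter> Q) W"
begin

text \<open>The closed \<delta>-balls around \<open>K\<close> lie in \<open>Q\<close>, so on them
  \<open>Q\<close> drops out of \<open>C \<inter> Q\<close> and what remains is convex. The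
  intersection of \<open>C\<close> with the union of these balls is compact, which bounds
  \<open>W\<close>.\<close>

lemma tube:
  assumes K: "compact K" "K \<subseteq> C \<inter> Q"
  obtains \<delta> L D where "\<delta> > 0" "L \<ge> 0" "compact D" "D \<subseteq> C \<inter> Q"
    "\<And>q y. q \<in> K \<Longrightarrow> y \<in> C \<inter> Q \<Longrightarrow> norm (y - q) \<le> \<delta> \<Longrightarrow> y \<in> D"
    "\<And>q. q \<in> K \<Longrightarrow> convex ((C \<inter> Q) \<inter> cball q \<delta>)"
    "\<And>x. x \<in> D \<Longrightarrow> norm (W x) \<le> L"
proof -
  obtain \<delta> where \<delta>: "\<delta> > 0" "(\<Union>x\<in>K. cball x \<delta>) \<subseteq> Q"
    using compact_subset_open_imp_cball_epsilon_subset[OF K(1) Q] K by auto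
  define D where "D = C \<inter> (\<Union>x\<in>K. cball x \<delta>)"
  have D: "compact D" unfolding D_def
    using C K by (intro closed_Int_compact compact_minkowski_sum_cball)
  have DM: "D \<subseteq> C \<inter> Q" using \<delta> by (auto simp: D_def)
  have "bounded (W ` D)"
    using D DM contW compact_continuous_image compact_imp_bounded continuous_on_subset by metis
  then obtain L where L: "\<And>x. x \<in> D \<Longrightarrow> norm (W x) \<le> L" unfolding bounded_iff by blast
  have "convex ((C \<inter> Q) \<inter> cball q \<delta>)" if "q \<in> K" for q
  proof -
    have "(C \<inter> Q) \<inter> cball q \<delta> = C \<inter> cball q \<delta>" using \<delta>(2) that by auto
    then show ?thesis using C by (simp add: convex_Int)
  qed
  moreover have "y \<in> D" if "q \<in> K" "y \<in> C \<inter> Q" "norm (y - q) \<le> \<delta>" for q y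
    using that by (auto simp: D_def dist_norm norm_minus_commute)
  moreover have "norm (W x) \<le> max L 0" if "x \<in> D" for x using L[OF that] by simp
  ultimately show ?thesis
    using that[of \<delta> "max L 0" D] \<delta>(1) D DM by simp
qed

text \<open>This is the mean value inequality on a convex piece around \<open>q\<close>, with
  \<open>W q\<close> as reference. Uniform continuity of \<open>W\<close> on the compact tube makes
  the radius independent of \<open>q\<close>.\<close>

lemma field_linearization:
  assumes K: "compact K" "K \<subseteq> C \<inter> Q" and "\<kappa> > 0"
  obtains \<delta> where "\<delta> > 0"
    "\<And>q y. q \<in> K \<Longrightarrow> y \<in> C \<inter> Q \<Longrightarrow> norm (y - q) \<le> \<delta> \<Longrightarrow>
      norm (W y - W q) \<le> \<kappa> \<and> norm (w y - w q - W q (y - q)) \<le> \<kappa> * norm (y - q)"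
proof -
  obtain \<delta> L D where tube: "\<delta> > 0" "L \<ge> 0" "compact D" "D \<subseteq> C \<inter> Q"
    "\<And>q y. q \<in> K \<Longrightarrow> y \<in> C \<inter> Q \<Longrightarrow> norm (y - q) \<le> \<delta> \<Longrightarrow> y \<in> D"
    "\<And>q. q \<in> K \<Longrightarrow> convex ((C \<inter> Q) \<inter> cball q \<delta>)"
    "\<And>x. x \<in> D \<Longrightarrow> norm (W x) \<le> L"
    using tube[OF K] by metis
  have "uniformly_continuous_on D W"
    using tube contW compact_uniformly_continuous continuous_on_subset by metis
  then obtain d where d: "d > 0"
    "\<And>x y. x \<in> D \<Longrightarrow> y \<in> D \<Longrightarrow> dist x y < d \<Longrightarrow> dist (W x) (W y) < \<kappa>"
    using \<open>\<kappa> > 0\<close> unfolding uniformly_continuous_on_def by metis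
  define r where "r = min \<delta> (d / 2)"
  have r: "r > 0" "r \<le> \<delta>" "r < d" using tube(1) d(1) by (auto simp: r_def)
  have close: "norm (W y - W q) \<le> \<kappa>" if "q \<in> K" "y \<in> C \<inter> Q" "norm (y - q) \<le> r" for q y
    using d(2)[of y q] tube(5)[of q y] tube(5)[of q q] subsetD[OF K(2) that(1)] that r
    by (auto simp: dist_norm)
  show ?thesis
  proof (rule that[OF r(1)])
    fix q y assume q: "q \<in> K" and y: "y \<in> C \<inter> Q" "norm (y - q) \<le> r"
    define S where "S = (C \<inter> Q) \<inter> cball q r"
    have "S = (C \<inter> Q \<inter> cball q \<delta>) \<inter> cball q r" using r by (auto simp: S_def)
    then have "convex S" using tube(6)[OF q] by (simp add: convex_Int)
    moreover have qS: "q \<in> S" "y \<in> S"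
      using q y K r by (auto simp: S_def dist_norm norm_minus_commute)
    ultimately have seg: "q + t *\<^sub>R (y - q) \<in> S" if "t \<in> {0..1}" for t
      using that convexD_alt[of S q y t] by (simp add: algebra_simps)
    have "norm (w y - w q - W q (y - q)) \<le> norm (y - q) * \<kappa>"
    proof (rule differentiable_bound_linearization[where S = S and f' = "\<lambda>x. blinfun_apply (W x)"])
      fix x assume x: "x \<in> S"
      show "(w has_derivative blinfun_apply (W x)) (at x within S)"
        using x by (intro has_derivative_subset[OF der]) (auto simp: S_def)
      have "onorm (blinfun_apply (W x) - blinfun_apply (W q)) = norm (W x - W q)"
        by (simp add: norm_blinfun.rep_eq fun_diff_def minus_blinfun.rep_eq)
      then show "onorm (blinfun_apply (W x) - blinfun_apply (W q)) \<le> \<kappa>"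
        using close[OF q, of x] x by (auto simp: S_def dist_norm norm_minus_commute)
    qed (use seg qS in auto)
    then show "norm (W y - W q) \<le> \<kappa> \<and> norm (w y - w q - W q (y - q)) \<le> \<kappa> * norm (y - q)"
      using close[OF q y] by (simp add: mult.commute)
  qed
qed

definition icurve :: "(real \<Rightarrow> 'a) \<Rightarrow> bool" where
  "icurve c \<longleftrightarrow> (\<forall>s\<in>{0..1}. c s \<in> C \<inter> Q \<and> (c has_vector_derivative w (c s)) (at s within {0..1}))"

lemma icurve_continuous: "icurve c \<Longrightarrow> continuous_on {0..1} c"
  unfolding icurve_def by (rule continuous_on_vector_derivative[of _ _ "\<lambda>s. w (c s)"]) auto

lemma icurve_tube:
  assumes c: "icurve c"
  shows "compact (c ` {0..1})" "c ` {0..1} \<subseteq> C \<inter> Q"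
  using compact_continuous_image[OF icurve_continuous[OF c] compact_Icc] c
  by (auto simp: icurve_def)

text \<open>Gronwall applies only while \<open>c\<close> stays in the tube around \<open>c0\<close>
  on which \<open>w\<close> is Lipschitz. The radius \<delta> / B closes this circle: the resulting
  estimate is strictly below \<delta>, so the tube is never left.\<close>

lemma icurve_Lipschitz:
  assumes c0: "icurve c0"
  obtains r B where "r > 0" "B \<ge> 0"
    "\<And>c s. icurve c \<Longrightarrow> norm (c 0 - c0 0) < r \<Longrightarrow> s \<in> {0..1} \<Longrightarrow>
       norm (c s - c0 s) \<le> B * norm (c 0 - c0 0)"
proof -
  define K where "K = c0 ` {0..1}"
  have K: "compact K" "K \<subseteq> C \<inter> Q" using icurve_tube[OF c0] by (auto simp: K_def)
  obtain \<delta> L D where tube: "\<delta> > 0" "L \<ge> 0" "compact D" "D \<subseteq> C \<inter> Q"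
    "\<And>q y. q \<in> K \<Longrightarrow> y \<in> C \<inter> Q \<Longrightarrow> norm (y - q) \<le> \<delta> \<Longrightarrow> y \<in> D"
    "\<And>q. q \<in> K \<Longrightarrow> convex ((C \<inter> Q) \<inter> cball q \<delta>)"
    "\<And>x. x \<in> D \<Longrightarrow> norm (W x) \<le> L"
    using tube[OF K] by metis
  have Lip: "norm (w y - w q) \<le> L * norm (y - q)"
    if q: "q \<in> K" and y: "y \<in> C \<inter> Q" "norm (y - q) \<le> \<delta>" for q y
  proof (rule differentiable_bound[OF tube(6)[OF q]])
    show "(w has_derivative blinfun_apply (W x)) (at x within C \<inter> Q \<inter> cball q \<delta>)"
      if "x \<in> C \<inter> Q \<inter> cball q \<delta>" for x
      using that by (intro has_derivative_subset[OF der]) auto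
    show "onorm (blinfun_apply (W x)) \<le> L" if "x \<in> C \<inter> Q \<inter> cball q \<delta>" for x
      using tube(5)[OF q, of x] tube(7) that
      by (auto simp: norm_blinfun.rep_eq[symmetric] dist_norm norm_minus_commute)
  qed (use q y K tube in \<open>auto simp: dist_norm norm_minus_commute\<close>)
  define B where "B = exp (L + 1)"
  have "B > 0" by (simp add: B_def)
  have grow: "norm (c s - c0 s) \<le> B * norm (c 0 - c0 0)"
    if c: "icurve c" and T: "0 \<le> T" "T \<le> 1" and le: "\<And>s. s \<in> {0..T} \<Longrightarrow> norm (c s - c0 s) \<le> \<delta>"
      and s: "s \<in> {0..T}" for c T s
  proof -
    have "norm (c s - c0 s) \<le> exp (L + 1) * (norm (c 0 - c0 0) + 0)"
    proof (rule gronwall[where a = 0 and b = T])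
      fix s assume s: "s \<in> {0..T}"
      then have s1: "s \<in> {0..1}" using T by auto
      show "((\<lambda>s. c s - c0 s) has_vector_derivative w (c s) - w (c0 s)) (at s within {0..T})"
        using c c0 s1 T unfolding icurve_def
        by (intro has_vector_derivative_diff has_vector_derivative_within_subset[where S = "{0..1}" and T = "{0..T}"]) auto
      show "norm (w (c s) - w (c0 s)) \<le> L * norm (c s - c0 s) + 0"
        using Lip[of "c0 s" "c s"] le[OF s] c s1 by (auto simp: K_def icurve_def)
    qed (use T s tube in auto)
    then show ?thesis by (simp add: B_def)
  qed
  show ?thesis
  proof (rule that[of "\<delta> / B" B])
    fix c s assume c: "icurve c" and small: "norm (c 0 - c0 0) < \<delta> / B" and s: "s \<in> {0..1::real}"
    have contd: "continuous_on {0..1} (\<lambda>s. norm (c s - c0 s))"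
      by (intro continuous_intros icurve_continuous c c0)
    have small': "B * norm (c 0 - c0 0) < \<delta>" using small \<open>B > 0\<close> by (simp add: field_simps)
    have "norm (c t - c0 t) \<le> \<delta>" if t: "t \<in> {0..1}" for t
    proof (rule ccontr)
      assume far: "\<not> norm (c t - c0 t) \<le> \<delta>"
      have "norm (c 0 - c0 0) \<le> B * norm (c 0 - c0 0)"
        using mult_right_mono[OF _ norm_ge_zero, of 1 B "c 0 - c0 0"] \<open>L \<ge> 0\<close> by (simp add: B_def)
      then have 0: "norm (c 0 - c0 0) \<le> \<delta>" using small' by linarith
      \<comment> \<open>A compact set of times, whose least element \<open>u\<close> is the first
        time at distance \<delta>. On {0..u} the estimate \<open>grow\<close> is available, and at
        \<open>u\<close> it gives a distance below \<delta>.\<close>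
      define A where "A = {s \<in> {0..t}. norm (c s - c0 s) = \<delta>}"
      have hit: "\<exists>u\<in>A. u \<le> s" if "s \<in> {0..t}" "norm (c s - c0 s) > \<delta>" for s
        using IVT'[of "\<lambda>s. norm (c s - c0 s)" 0 \<delta> s] 0 that t continuous_on_subset[OF contd, of "{0..s}"]
        by (force simp: A_def)
      have "closedin (top_of_set {0..t}) A"
        unfolding A_def using t
        by (intro continuous_closedin_preimage_constant continuous_on_subset[OF contd]) auto
      then have "compact A" using closedin_compact compact_Icc by blast
      moreover have "A \<noteq> {}" using hit[of t] far t by auto
      ultimately obtain u where u: "u \<in> A" "\<And>v. v \<in> A \<Longrightarrow> u \<le> v"
        using compact_attains_inf by metis
      have "norm (c s - c0 s) \<le> \<delta>" if s: "s \<in> {0..u}" for s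
      proof (rule ccontr)
        assume far': "\<not> norm (c s - c0 s) \<le> \<delta>"
        then obtain v where v: "v \<in> A" "v \<le> s"
          using hit[of s] s u(1) by (force simp: A_def)
        have "s = u" using u(2)[OF v(1)] v(2) s by auto
        then show False using u(1) far' by (simp add: A_def)
      qed
      then have "norm (c u - c0 u) \<le> B * norm (c 0 - c0 0)"
        using u(1) t by (intro grow[OF c, of u]) (auto simp: A_def)
      then show False using u(1) small' by (auto simp: A_def)
    qed
    then show "norm (c s - c0 s) \<le> B * norm (c 0 - c0 0)"
      using grow[OF c, of 1 s] s by auto
  qed (use tube \<open>B > 0\<close> in auto)
qed

end

lemma continuous_on_Times_uniform:
  fixes h :: "'p::metric_space \<Rightarrow> 's::metric_space \<Rightarrow> 'b::metric_space"
  assumes cont: "\<And>p. p \<in> P \<Longrightarrow> continuous_on S (h p)"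
    and unif: "\<And>p0 e. p0 \<in> P \<Longrightarrow> e > 0 \<Longrightarrow>
      \<exists>d>0. \<forall>p\<in>P. dist p p0 < d \<longrightarrow> (\<forall>s\<in>S. dist (h p s) (h p0 s) < e)"
  shows "continuous_on (P \<times> S) (\<lambda>(p, s). h p s)"
  unfolding continuous_on_iff
proof (intro ballI allI impI)
  fix x and e :: real assume "x \<in> P \<times> S" "e > 0"
  then obtain p0 s0 where x: "x = (p0, s0)" "p0 \<in> P" "s0 \<in> S" by auto
  obtain d1 where d1: "d1 > 0" "\<And>p s. p \<in> P \<Longrightarrow> dist p p0 < d1 \<Longrightarrow> s \<in> S \<Longrightarrow> dist (h p s) (h p0 s) < e / 2"
    using unif[OF x(2), of "e / 2"] \<open>e > 0\<close> by auto
  obtain d2 where d2: "d2 > 0" "\<And>s. s \<in> S \<Longrightarrow> dist s s0 < d2 \<Longrightarrow> dist (h p0 s) (h p0 s0) < e / 2"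
    using cont[OF x(2)] x(3) \<open>e > 0\<close> unfolding continuous_on_iff by (meson half_gt_zero)
  have "dist (h p s) (h p0 s0) < e" if "p \<in> P" "s \<in> S" "dist (p, s) (p0, s0) < min d1 d2" for p s
  proof -
    have "dist p p0 < d1" "dist s s0 < d2"
      using that(3) dist_fst_le[of "(p, s)" "(p0, s0)"] dist_snd_le[of "(p, s)" "(p0, s0)"] by auto
    then have "dist (h p s) (h p0 s) < e / 2" "dist (h p0 s) (h p0 s0) < e / 2"
      using d1 d2 that by auto
    then show ?thesis using dist_triangle[of "h p s" "h p0 s0" "h p0 s"] by linarith
  qed
  then show "\<exists>d>0. \<forall>x'\<in>P \<times> S. dist x' x < d \<longrightarrow>
      dist (case x' of (p, s) \<Rightarrow> h p s) (case x of (p, s) \<Rightarrow> h p s) < e"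
    using d1(1) d2(1) x by (intro exI[of _ "min d1 d2"]) auto
qed

section \<open>Parameter families of integral curves\<close>

context C1_field
begin

lemma icurve_family_uniform:
  fixes c :: "'p::real_normed_vector \<Rightarrow> real \<Rightarrow> 'a"
  assumes c: "\<And>p. p \<in> P \<Longrightarrow> icurve (c p)" and cont: "continuous_on P (\<lambda>p. c p 0)"
    and p0: "p0 \<in> P" and "e > 0"
  obtains d where "d > 0"
    "\<And>p s. p \<in> P \<Longrightarrow> norm (p - p0) < d \<Longrightarrow> s \<in> {0..1} \<Longrightarrow> norm (c p s - c p0 s) < e"
proof -
  obtain r B where rB: "r > 0" "B \<ge> 0"
    "\<And>c' s. icurve c' \<Longrightarrow> norm (c' 0 - c p0 0) < r \<Longrightarrow> s \<in> {0..1} \<Longrightarrow>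
       norm (c' s - c p0 s) \<le> B * norm (c' 0 - c p0 0)"
    using icurve_Lipschitz[OF c[OF p0]] by metis
  define r' where "r' = min r (e / (B + 1))"
  have "r' > 0" using rB \<open>e > 0\<close> by (simp add: r'_def)
  then obtain d where d: "d > 0" "\<And>p. p \<in> P \<Longrightarrow> norm (p - p0) < d \<Longrightarrow> norm (c p 0 - c p0 0) < r'"
    using cont p0 unfolding continuous_on_iff dist_norm by meson
  show ?thesis
  proof (rule that[OF d(1)])
    fix p s assume p: "p \<in> P" "norm (p - p0) < d" and s: "s \<in> {0..1::real}"
    have "norm (c p s - c p0 s) \<le> B * norm (c p 0 - c p0 0)"
      using rB(3)[OF c[OF p(1)] _ s] d(2)[OF p] by (simp add: r'_def)
    also have "\<dots> \<le> B * (e / (B + 1))"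
      using d(2)[OF p] rB by (intro mult_left_mono) (auto simp: r'_def)
    also have "\<dots> < e" using rB \<open>e > 0\<close> by (simp add: field_simps)
    finally show "norm (c p s - c p0 s) < e" .
  qed
qed

lemma icurve_unique:
  assumes "icurve c0" "icurve c" "c 0 = c0 0" "s \<in> {0..1}"
  shows "c s = c0 s"
proof -
  obtain r B where "r > 0" "B \<ge> 0"
    "\<And>c s. icurve c \<Longrightarrow> norm (c 0 - c0 0) < r \<Longrightarrow> s \<in> {0..1} \<Longrightarrow>
       norm (c s - c0 s) \<le> B * norm (c 0 - c0 0)"
    using icurve_Lipschitz[OF assms(1)] by metis
  from this(3)[OF assms(2) _ assms(4)] this(1) show ?thesis using assms(3) by simp
qed

text \<open>The derivative in the parameter is the solution of the variational equation along
  \<open>c p\<close> whose initial value is the derivative of the initial point. Gronwall shows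
  twice that this is so: for the remainder of the first-order expansion, and for the continuity of
  the candidate in the parameter.\<close>

theorem icurve_family_C1:
  fixes c :: "'p::euclidean_space \<Rightarrow> real \<Rightarrow> 'a"
  assumes c: "\<And>p. p \<in> P \<Longrightarrow> icurve (c p)" and init: "Ck_on (Suc 0) (\<lambda>p. c p 0) P"
  shows "Ck_on (Suc 0) (\<lambda>(p, s). c p s) (P \<times> {0..1})"
proof -
  obtain \<gamma>' where \<gamma>': "\<And>p. p \<in> P \<Longrightarrow> ((\<lambda>p. c p 0) has_derivative \<gamma>' p) (at p within P)"
    "\<And>v. continuous_on P (\<lambda>p. \<gamma>' p v)"
    using init by auto
  have init0: "continuous_on P (\<lambda>p. c p 0)" using init Ck_on_imp_continuous by blast
  have unif: "\<exists>d>0. \<forall>p\<in>P. norm (p - p0) < d \<longrightarrow> (\<forall>s\<in>{0..1}. norm (c p s - c p0 s) < e)"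
    if "p0 \<in> P" "e > 0" for p0 e
    using icurve_family_uniform[of P c p0 e] c init0 that by metis
  have Wc: "continuous_on {0..1} (\<lambda>s. W (c p s))" if "p \<in> P" for p
    using continuous_on_compose2[OF contW icurve_continuous[OF c[OF that]]] icurve_tube(2)[OF c[OF that]]
    by auto
  have "\<exists>\<eta>. \<eta> 0 = b \<and>
      (\<forall>s\<in>{0..1}. (\<eta> has_vector_derivative W (c p s) (\<eta> s)) (at s within {0..1}))" if "p \<in> P" for p b
    using linear_ode_solution[OF Wc[OF that]] by metis
  then obtain \<Phi> where \<Phi>: "\<And>p b. p \<in> P \<Longrightarrow> \<Phi> p b 0 = b"
    "\<And>p b s. p \<in> P \<Longrightarrow> s \<in> {0..1} \<Longrightarrow>
      (\<Phi> p b has_vector_derivative W (c p s) (\<Phi> p b s)) (at s within {0..1})"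
    by metis
  \<comment> \<open>Combining the solutions with basis initial values builds linearity in
    \<open>v\<close> into the definition.\<close>
  define \<Psi> where "\<Psi> p s v = (\<Sum>b\<in>Basis. (v \<bullet> b) *\<^sub>R \<Phi> p b s)" for p s and v :: 'a
  have \<Psi>0: "\<Psi> p 0 v = v" if "p \<in> P" for p v
    using \<Phi>(1)[OF that] by (simp add: \<Psi>_def euclidean_representation)
  have \<Psi>der: "((\<lambda>s. \<Psi> p s v) has_vector_derivative W (c p s) (\<Psi> p s v)) (at s within {0..1})"
    if "p \<in> P" "s \<in> {0..1}" for p s v
  proof -
    have "((\<lambda>s. \<Sum>b\<in>Basis. (v \<bullet> b) *\<^sub>R \<Phi> p b s) has_vector_derivative
        (\<Sum>b\<in>Basis. (v \<bullet> b) *\<^sub>R W (c p s) (\<Phi> p b s))) (at s within {0..1})"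
      using \<Phi>(2)[OF that]
      by (intro has_vector_derivative_sum bounded_linear.has_vector_derivative[OF bounded_linear_scaleR_right])
    then show ?thesis by (simp add: \<Psi>_def blinfun.sum_right blinfun.scaleR_right)
  qed
  have \<Psi>lin: "bounded_linear (\<Psi> p s)" for p s
    unfolding \<Psi>_def by (intro bounded_linear_intros)
  have bounds: "\<exists>L\<ge>0. \<forall>s\<in>{0..1}. norm (W (c p s)) \<le> L" if "p \<in> P" for p
  proof -
    have "bounded ((\<lambda>s. W (c p s)) ` {0..1})"
      using compact_continuous_image[OF Wc[OF that] compact_Icc] by (rule compact_imp_bounded)
    then obtain L where "\<forall>s\<in>{0..1}. norm (W (c p s)) \<le> L" unfolding bounded_iff by auto
    then show ?thesis by (intro exI[of _ "max L 0"]) force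
  qed
  have space: "((\<lambda>p. c p s) has_derivative (\<lambda>v. \<Psi> p0 s (\<gamma>' p0 v))) (at p0 within P)"
    if p0: "p0 \<in> P" and s: "s \<in> {0..1}" for p0 s
    unfolding has_derivative_within_alt
  proof (intro conjI allI impI)
    have bl\<gamma>: "bounded_linear (\<gamma>' p0)" using \<gamma>'(1)[OF p0] has_derivative_bounded_linear by blast
    show "bounded_linear (\<lambda>v. \<Psi> p0 s (\<gamma>' p0 v))"
      using bounded_linear_compose[OF \<Psi>lin bl\<gamma>] by simp
    fix e :: real assume "e > 0"
    obtain L where L: "L \<ge> 0" "\<And>s. s \<in> {0..1} \<Longrightarrow> norm (W (c p0 s)) \<le> L" using bounds[OF p0] by auto
    obtain r B where rB: "r > 0" "B \<ge> 0"
      "\<And>c' s. icurve c' \<Longrightarrow> norm (c' 0 - c p0 0) < r \<Longrightarrow> s \<in> {0..1} \<Longrightarrow>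
         norm (c' s - c p0 s) \<le> B * norm (c' 0 - c p0 0)"
      using icurve_Lipschitz[OF c[OF p0]] by metis
    obtain \<Gamma> where \<Gamma>: "\<Gamma> > 0" "\<And>v. norm (\<gamma>' p0 v) \<le> norm v * \<Gamma>"
      using bounded_linear.pos_bounded[OF bl\<gamma>] by auto
    define E where "E = exp (L + 1)"
    \<comment> \<open>After multiplication by the Gronwall factor \<open>E\<close>, the error of the
      initial values and the linearization error of the field may each use half of \<open>e\<close>.
      By \<open>e1 \<le> 1\<close> the initial points differ by at most \<open>\<Gamma> + 1\<close>
      times the parameter distance, hence the curves by at most \<open>B * (\<Gamma> + 1)\<close>
      times that distance.\<close>
    define e1 where "e1 = min 1 (e / (2 * E))"
    define \<kappa> where "\<kappa> = e / (2 * E * (B * (\<Gamma> + 1) + 1))"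
    have E: "E > 0" by (simp add: E_def)
    have e1: "e1 > 0" "e1 \<le> 1" "e1 * E \<le> e / 2" using E \<open>e > 0\<close> by (auto simp: e1_def min_def field_simps)
    have BG: "B * (\<Gamma> + 1) \<ge> 0" using rB \<Gamma> by simp
    have \<kappa>: "\<kappa> > 0" unfolding \<kappa>_def using E BG \<open>e > 0\<close> by (intro divide_pos_pos mult_pos_pos) auto
    have "E * \<kappa> * (B * (\<Gamma> + 1)) = (e / 2) * ((B * (\<Gamma> + 1)) / (B * (\<Gamma> + 1) + 1))"
      using E by (simp add: \<kappa>_def)
    also have "\<dots> \<le> (e / 2) * 1" using BG \<open>e > 0\<close> by (intro mult_left_mono) auto
    finally have \<kappa>e: "E * \<kappa> * (B * (\<Gamma> + 1)) \<le> e / 2" by simp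
    obtain \<delta> where \<delta>: "\<delta> > 0"
      "\<And>q y. q \<in> c p0 ` {0..1} \<Longrightarrow> y \<in> C \<inter> Q \<Longrightarrow> norm (y - q) \<le> \<delta> \<Longrightarrow>
        norm (W y - W q) \<le> \<kappa> \<and> norm (w y - w q - W q (y - q)) \<le> \<kappa> * norm (y - q)"
      using field_linearization[OF icurve_tube[OF c[OF p0]] \<kappa>] by metis
    obtain d1 where d1: "d1 > 0" "\<And>p. p \<in> P \<Longrightarrow> norm (p - p0) < d1 \<Longrightarrow>
        norm (c p 0 - c p0 0 - \<gamma>' p0 (p - p0)) \<le> e1 * norm (p - p0)"
      using \<gamma>'(1)[OF p0] e1(1) unfolding has_derivative_within_alt by meson
    obtain d2 where d2: "d2 > 0" "\<And>p s. p \<in> P \<Longrightarrow> norm (p - p0) < d2 \<Longrightarrow> s \<in> {0..1} \<Longrightarrow>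
        norm (c p s - c p0 s) < min r \<delta>"
      using unif[OF p0, of "min r \<delta>"] rB(1) \<delta>(1) by auto
    have "norm (c p s - c p0 s - \<Psi> p0 s (\<gamma>' p0 (p - p0))) \<le> e * norm (p - p0)"
      if p: "p \<in> P" "norm (p - p0) < min d1 d2" for p
    proof -
      define v where "v = \<gamma>' p0 (p - p0)"
      define \<rho> where "\<rho> s = c p s - c p0 s - \<Psi> p0 s v" for s
      have "norm (c p 0 - c p0 0) \<le> norm (c p 0 - c p0 0 - v) + norm v"
        by (metis add.commute diff_add_cancel norm_triangle_ineq)
      also have "\<dots> \<le> 1 * norm (p - p0) + norm (p - p0) * \<Gamma>"
      proof (rule add_mono)
        have "e1 * norm (p - p0) \<le> 1 * norm (p - p0)" using e1 by (intro mult_right_mono) auto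
        then show "norm (c p 0 - c p0 0 - v) \<le> 1 * norm (p - p0)"
          using d1(2)[OF p(1)] p by (simp add: v_def)
      qed (simp add: v_def \<Gamma>)
      finally have c0: "norm (c p 0 - c p0 0) \<le> (\<Gamma> + 1) * norm (p - p0)" by (simp add: algebra_simps)
      have diff: "norm (c p t - c p0 t) \<le> B * ((\<Gamma> + 1) * norm (p - p0))" if t: "t \<in> {0..1}" for t
      proof -
        have "norm (c p t - c p0 t) \<le> B * norm (c p 0 - c p0 0)"
          using rB(3)[OF c[OF p(1)] _ t] d2(2)[OF p(1), of 0] p(2) by auto
        also have "\<dots> \<le> B * ((\<Gamma> + 1) * norm (p - p0))"
          using c0 rB by (intro mult_left_mono)
        finally show ?thesis .
      qed
      have "norm (\<rho> s) \<le> exp (L + 1) * (norm (\<rho> 0) + \<kappa> * (B * ((\<Gamma> + 1) * norm (p - p0))))"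
      proof (rule gronwall[where a = 0 and b = 1])
        fix t :: real assume t: "t \<in> {0..1}"
        show "(\<rho> has_vector_derivative w (c p t) - w (c p0 t) - W (c p0 t) (\<Psi> p0 t v)) (at t within {0..1})"
          unfolding \<rho>_def using c[OF p(1)] c[OF p0] t unfolding icurve_def
          by (intro has_vector_derivative_diff \<Psi>der[OF p0 t]) auto
        \<comment> \<open>The remainder \<open>\<rho>\<close> itself satisfies the variational
          equation, up to the linearization error of \<open>w\<close>.\<close>
        have "w (c p t) - w (c p0 t) - W (c p0 t) (\<Psi> p0 t v)
            = (w (c p t) - w (c p0 t) - W (c p0 t) (c p t - c p0 t)) + W (c p0 t) (\<rho> t)"
          by (simp add: \<rho>_def blinfun.diff_right)
        also have "norm \<dots> \<le> \<kappa> * norm (c p t - c p0 t) + L * norm (\<rho> t)"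
        proof (rule norm_triangle_le[OF add_mono])
          show "norm (w (c p t) - w (c p0 t) - W (c p0 t) (c p t - c p0 t)) \<le> \<kappa> * norm (c p t - c p0 t)"
            using \<delta>(2)[of "c p0 t" "c p t"] d2(2)[OF p(1) _ t] p c[OF p(1)] t
            by (force simp: icurve_def)
          show "norm (W (c p0 t) (\<rho> t)) \<le> L * norm (\<rho> t)"
            by (rule order_trans[OF norm_blinfun mult_right_mono[OF L(2)[OF t] norm_ge_zero]])
        qed
        also have "\<dots> \<le> L * norm (\<rho> t) + \<kappa> * (B * ((\<Gamma> + 1) * norm (p - p0)))"
          using mult_left_mono[OF diff[OF t], of \<kappa>] \<kappa> by simp
        finally show "norm (w (c p t) - w (c p0 t) - W (c p0 t) (\<Psi> p0 t v))
            \<le> L * norm (\<rho> t) + \<kappa> * (B * ((\<Gamma> + 1) * norm (p - p0)))" .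
      qed (use L(1) \<kappa> rB \<Gamma> s in auto)
      also have "norm (\<rho> 0) \<le> e1 * norm (p - p0)"
        using d1(2)[OF p(1)] p(2) by (simp add: \<rho>_def \<Psi>0[OF p0] v_def)
      finally have "norm (\<rho> s) \<le> (e1 * E + E * \<kappa> * (B * (\<Gamma> + 1))) * norm (p - p0)"
        by (simp add: E_def algebra_simps)
      also have "\<dots> \<le> (e / 2 + e / 2) * norm (p - p0)"
        using e1(3) \<kappa>e by (intro mult_right_mono) (linarith, simp)
      finally show ?thesis by (simp add: \<rho>_def v_def)
    qed
    then show "\<exists>d>0. \<forall>p\<in>P. norm (p - p0) < d \<longrightarrow>
        norm (c p s - c p0 s - \<Psi> p0 s (\<gamma>' p0 (p - p0))) \<le> e * norm (p - p0)"
      using d1(1) d2(1) by (intro exI[of _ "min d1 d2"]) auto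
  qed
  have cont: "continuous_on (P \<times> {0..1}) (\<lambda>(p, s). c p s)"
  proof (rule continuous_on_Times_uniform)
    show "continuous_on {0..1} (c p)" if "p \<in> P" for p using icurve_continuous c that by blast
    show "\<exists>d>0. \<forall>p\<in>P. dist p p0 < d \<longrightarrow> (\<forall>s\<in>{0..1}. dist (c p s) (c p0 s) < e)"
      if "p0 \<in> P" "e > 0" for p0 e
      using unif[OF that] unfolding dist_norm .
  qed
  have contw: "continuous_on (P \<times> {0..1}) (\<lambda>(p, s). w (c p s))"
  proof -
    have "continuous_on (C \<inter> Q) w"
      using der has_derivative_continuous continuous_on_eq_continuous_within by blast
    then have "continuous_on (P \<times> {0..1}) (\<lambda>x. w (case x of (p, s) \<Rightarrow> c p s))"
      by (rule continuous_on_compose2[OF _ cont]) (use c in \<open>auto simp: icurve_def\<close>)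
    then show ?thesis by (simp add: case_prod_unfold)
  qed
  have cont\<eta>: "continuous_on (P \<times> {0..1}) (\<lambda>(p, s). \<Psi> p s (\<gamma>' p v))" for v
  proof (rule continuous_on_Times_uniform)
    show ct: "continuous_on {0..1} (\<lambda>s. \<Psi> p s (\<gamma>' p v))" if "p \<in> P" for p
      by (rule continuous_on_vector_derivative) (rule \<Psi>der[OF that])
    fix p0 and e :: real assume p0: "p0 \<in> P" and "e > 0"
    obtain L where L: "L \<ge> 0" "\<And>s. s \<in> {0..1} \<Longrightarrow> norm (W (c p0 s)) \<le> L" using bounds[OF p0] by auto
    obtain H where H: "H > 0" "\<And>s. s \<in> {0..1} \<Longrightarrow> norm (\<Psi> p0 s (\<gamma>' p0 v)) \<le> H"
      using compact_imp_bounded[OF compact_continuous_image[OF ct[OF p0] compact_Icc]]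
      unfolding bounded_pos by auto
    \<comment> \<open>One more 1 than before: the equation for the difference has the coefficient
      \<open>W (c p t)\<close>, which is bounded by \<open>L + 1\<close> because it differs from
      \<open>W (c p0 t)\<close> by at most \<kappa> \<le> 1.\<close>
    define E where "E = exp (L + 1 + 1)"
    have E: "E > 0" by (simp add: E_def)
    define \<kappa> where "\<kappa> = min 1 (e / (4 * E * H))"
    have \<kappa>: "\<kappa> > 0" "\<kappa> \<le> 1" "E * \<kappa> * H \<le> e / 4" using E H \<open>e > 0\<close> by (auto simp: \<kappa>_def min_def field_simps)
    obtain \<delta> where \<delta>: "\<delta> > 0"
      "\<And>q y. q \<in> c p0 ` {0..1} \<Longrightarrow> y \<in> C \<inter> Q \<Longrightarrow> norm (y - q) \<le> \<delta> \<Longrightarrow>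
        norm (W y - W q) \<le> \<kappa> \<and> norm (w y - w q - W q (y - q)) \<le> \<kappa> * norm (y - q)"
      using field_linearization[OF icurve_tube[OF c[OF p0]] \<kappa>(1)] by metis
    obtain d1 where d1: "d1 > 0" "\<And>p s. p \<in> P \<Longrightarrow> norm (p - p0) < d1 \<Longrightarrow> s \<in> {0..1} \<Longrightarrow>
        norm (c p s - c p0 s) < \<delta>"
      using unif[OF p0 \<delta>(1)] by metis
    have "e / (4 * E) > 0" using E \<open>e > 0\<close> by simp
    then obtain d2 where d2: "d2 > 0"
      "\<And>p. p \<in> P \<Longrightarrow> norm (p - p0) < d2 \<Longrightarrow> norm (\<gamma>' p v - \<gamma>' p0 v) < e / (4 * E)"
      using \<gamma>'(2)[of v] p0 unfolding continuous_on_iff dist_norm by meson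
    have "norm (\<Psi> p s (\<gamma>' p v) - \<Psi> p0 s (\<gamma>' p0 v)) < e"
      if p: "p \<in> P" "norm (p - p0) < min d1 d2" and s: "s \<in> {0..1}" for p s
    proof -
      define \<rho> where "\<rho> s = \<Psi> p s (\<gamma>' p v) - \<Psi> p0 s (\<gamma>' p0 v)" for s
      have "norm (\<rho> s) \<le> exp (L + 1 + 1) * (norm (\<rho> 0) + \<kappa> * H)"
      proof (rule gronwall[where a = 0 and b = 1])
        fix t :: real assume t: "t \<in> {0..1}"
        have close: "norm (W (c p t) - W (c p0 t)) \<le> \<kappa>"
          using \<delta>(2)[of "c p0 t" "c p t"] d1(2)[OF p(1) _ t] p c[OF p(1)] t
          by (force simp: icurve_def)
        have "norm (W (c p t)) \<le> norm (W (c p t) - W (c p0 t)) + norm (W (c p0 t))"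
          by (metis diff_add_cancel norm_triangle_ineq)
        then have L1: "norm (W (c p t)) \<le> L + 1" using close \<kappa>(2) L(2)[OF t] by linarith
        show "(\<rho> has_vector_derivative W (c p t) (\<Psi> p t (\<gamma>' p v)) - W (c p0 t) (\<Psi> p0 t (\<gamma>' p0 v)))
            (at t within {0..1})"
          unfolding \<rho>_def by (intro has_vector_derivative_diff \<Psi>der p p0 t)
        have "W (c p t) (\<Psi> p t (\<gamma>' p v)) - W (c p0 t) (\<Psi> p0 t (\<gamma>' p0 v))
            = W (c p t) (\<rho> t) + (W (c p t) - W (c p0 t)) (\<Psi> p0 t (\<gamma>' p0 v))"
          by (simp add: \<rho>_def blinfun.diff_right blinfun.diff_left)
        also have "norm \<dots> \<le> (L + 1) * norm (\<rho> t) + \<kappa> * H"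
        proof (rule norm_triangle_le[OF add_mono])
          show "norm (W (c p t) (\<rho> t)) \<le> (L + 1) * norm (\<rho> t)"
            by (rule order_trans[OF norm_blinfun mult_right_mono[OF L1 norm_ge_zero]])
          show "norm ((W (c p t) - W (c p0 t)) (\<Psi> p0 t (\<gamma>' p0 v))) \<le> \<kappa> * H"
            using \<kappa> by (intro order_trans[OF norm_blinfun mult_mono[OF close H(2)[OF t]]]) auto
        qed
        finally show "norm (W (c p t) (\<Psi> p t (\<gamma>' p v)) - W (c p0 t) (\<Psi> p0 t (\<gamma>' p0 v)))
            \<le> (L + 1) * norm (\<rho> t) + \<kappa> * H" .
      qed (use L(1) \<kappa> H s in auto)
      also have "norm (\<rho> 0) \<le> e / (4 * E)"
        using d2(2)[OF p(1)] p(2) by (simp add: \<rho>_def \<Psi>0 p0 p)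
      finally have "norm (\<rho> s) \<le> E * (e / (4 * E) + \<kappa> * H)" by (simp add: E_def)
      also have "\<dots> \<le> e / 4 + e / 4" using \<kappa>(3) E by (simp add: field_simps)
      finally show ?thesis using \<open>e > 0\<close> by (simp add: \<rho>_def)
    qed
    then show "\<exists>d>0. \<forall>p\<in>P. dist p p0 < d \<longrightarrow>
        (\<forall>s\<in>{0..1}. dist (\<Psi> p s (\<gamma>' p v)) (\<Psi> p0 s (\<gamma>' p0 v)) < e)"
      using d1(1) d2(1) unfolding dist_norm by (intro exI[of _ "min d1 d2"]) auto
  qed
  \<comment> \<open>Joint differentiability follows from one partial derivative at the point and
    continuity of the other one; the continuous one is the time derivative
    \<open>w (c p s)\<close>.\<close>
  have total: "((\<lambda>(p, s). c p s) has_derivative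
      (\<lambda>(v, h). \<Psi> p s (\<gamma>' p v) + blinfun_apply (blinfun_scaleR_left (w (c p s))) h))
      (at (p, s) within P \<times> {0..1})" if "p \<in> P" "s \<in> {0..1}" for p s
  proof (rule has_derivative_partialsI)
    show "((\<lambda>p. c p s) has_derivative (\<lambda>v. \<Psi> p s (\<gamma>' p v))) (at p within P)"
      by (rule space[OF that])
    show "(c p has_derivative blinfun_apply (blinfun_scaleR_left (w (c p s)))) (at s within {0..1})"
      if "p \<in> P" "s \<in> {0..1}" for p s
      using c[OF that(1)] that(2) by (auto simp: icurve_def has_vector_derivative_def)
    have "continuous_on (P \<times> {0..1}) (\<lambda>x. blinfun_scaleR_left (case x of (p, s) \<Rightarrow> w (c p s)))"
      using bounded_linear.continuous_on[OF bounded_linear_blinfun_scaleR_left contw] .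
    then show "continuous (at (p, s) within P \<times> {0..1}) (\<lambda>(p, s). blinfun_scaleR_left (w (c p s)))"
      using that by (simp add: continuous_on_eq_continuous_within case_prod_unfold)
  qed (use that in auto)
  show ?thesis
    unfolding Ck_on.simps
  proof (intro exI conjI ballI allI)
    show "((\<lambda>(p, s). c p s) has_derivative
        (\<lambda>x (v, h). \<Psi> (fst x) (snd x) (\<gamma>' (fst x) v) + h *\<^sub>R w (c (fst x) (snd x))) x)
        (at x within P \<times> {0..1})" if "x \<in> P \<times> {0..1}" for x
      using total[of "fst x" "snd x"] that by (simp add: mem_Times_iff)
    show "continuous_on (P \<times> {0..1}) (\<lambda>x. (\<lambda>x (v, h). \<Psi> (fst x) (snd x) (\<gamma>' (fst x) v)
        + h *\<^sub>R w (c (fst x) (snd x))) x vh)" for vh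
      using cont\<eta>[of "fst vh"] contw by (auto simp: case_prod_unfold intro!: continuous_intros)
  qed
qed

end

section \<open>Smoothness of families of integral curves\<close>

lemma Ck_on_SucI:
  assumes "\<And>x. x \<in> S \<Longrightarrow> (f has_derivative frd S f x) (at x within S)"
    "\<And>v. Ck_on k (\<lambda>x. frd S f x v) S"
  shows "Ck_on (Suc k) f S"
  using assms by (auto intro!: exI[of _ "frd S f"])

lemma Ck_on_Suc_imp_Ck_on_1: "Ck_on (Suc k) f S \<Longrightarrow> Ck_on (Suc 0) f S"
  by (induction k) (assumption, blast dest: Ck_on_SucD)

lemma has_derivative_slice:
  assumes "(F has_derivative F') (at (p, s) within P \<times> T)" "s \<in> T" "p \<in> P"
  shows "((\<lambda>p. F (p, s)) has_derivative (\<lambda>v. F' (v, 0))) (at p within P)"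
    "((\<lambda>s. F (p, s)) has_derivative (\<lambda>h. F' (0, h))) (at s within T)"
proof -
  have "((\<lambda>p. (p, s)) has_derivative (\<lambda>v. (v, 0))) (at p within P)"
    by (auto intro!: derivative_eq_intros)
  moreover have "(F has_derivative F') (at (p, s) within (\<lambda>p. (p, s)) ` P)"
    by (rule has_derivative_subset[OF assms(1)]) (use assms in auto)
  ultimately show "((\<lambda>p. F (p, s)) has_derivative (\<lambda>v. F' (v, 0))) (at p within P)"
    by (rule has_derivative_in_compose)
  have "((\<lambda>s. (p, s)) has_derivative (\<lambda>h. (0, h))) (at s within T)"
    by (auto intro!: derivative_eq_intros)
  moreover have "(F has_derivative F') (at (p, s) within (\<lambda>s. (p, s)) ` T)"
    by (rule has_derivative_subset[OF assms(1)]) (use assms in auto)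
  ultimately show "((\<lambda>s. F (p, s)) has_derivative (\<lambda>h. F' (0, h))) (at s within T)"
    by (rule has_derivative_in_compose)
qed

lemma has_vector_derivative_slice:
  assumes F: "(F has_derivative F') (at (p, s) within P \<times> T)" and "s \<in> T" "p \<in> P"
  shows "((\<lambda>s. F (p, s)) has_vector_derivative F' (0, 1)) (at s within T)"
proof -
  have eq: "(\<lambda>h. F' (0, h)) = (\<lambda>h. h *\<^sub>R F' (0, 1))"
  proof
    fix h :: real
    have "F' (0, h) = F' (h *\<^sub>R (0, 1))" by simp
    also have "\<dots> = h *\<^sub>R F' (0, 1)" by (rule linear_cmul[OF has_derivative_linear[OF F]])
    finally show "F' (0, h) = h *\<^sub>R F' (0, 1)" .
  qed
  show ?thesis
    using has_derivative_slice(2)[OF assms] unfolding has_vector_derivative_def eq .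
qed

text \<open>Differentiability of \<open>F'\<close> in \<open>s\<close> is a conclusion here. Writing
  \<open>F p t - F p a\<close> as the integral of \<open>R p\<close> and differentiating under the
  integral sign expresses \<open>F' p t v\<close> as an integral over \<open>t\<close>, because
  derivatives on the fat set \<open>P\<close> are unique. The fundamental theorem then
  differentiates it.\<close>

lemma mixed_partial:
  fixes F :: "'p::euclidean_space \<Rightarrow> real \<Rightarrow> 'b::banach"
  assumes P: "convex P" "fat P" and p: "p \<in> P" and s: "s \<in> {a..b}"
    and F: "\<And>p s. p \<in> P \<Longrightarrow> s \<in> {a..b} \<Longrightarrow> ((\<lambda>p. F p s) has_derivative F' p s) (at p within P)"
    and Fs: "\<And>p s. p \<in> P \<Longrightarrow> s \<in> {a..b} \<Longrightarrow> (F p has_vector_derivative R p s) (at s within {a..b})"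
    and R: "\<And>p s. p \<in> P \<Longrightarrow> s \<in> {a..b} \<Longrightarrow>
      ((\<lambda>p. R p s) has_derivative blinfun_apply (R' p s)) (at p within P)"
    and contR': "continuous_on (P \<times> {a..b}) (\<lambda>(p, s). R' p s)"
  shows "((\<lambda>s. F' p s v) has_vector_derivative R' p s v) (at s within {a..b})"
proof -
  have contR'p: "continuous_on {a..b} (R' p)"
  proof -
    have "continuous_on {a..b} (\<lambda>s. (p, s))" by (intro continuous_intros)
    from continuous_on_compose2[OF contR' this] p show ?thesis by auto
  qed
  have eq: "F' p t v = F' p a v + integral {a..t} (\<lambda>r. R' p r v)" if t: "t \<in> {a..b}" for t
  proof -
    have ftc: "(R p has_integral F p t - F p a) {a..t}" if "p \<in> P" for p
      using fundamental_theorem_of_calculus[of a t "F p" "R p"] t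
        has_vector_derivative_within_subset[OF Fs[OF that]] by auto
    have "((\<lambda>p. integral (cbox a t) (R p)) has_derivative integral (cbox a t) (R' p)) (at p within P)"
    proof (rule leibniz_rule)
      show "R p integrable_on cbox a t" if "p \<in> P" for p
        using ftc[OF that] by auto
      show "continuous_on (P \<times> cbox a t) (\<lambda>(p, t). R' p t)"
        using t by (intro continuous_on_subset[OF contR']) auto
    qed (use R t P p in auto)
    moreover have "((\<lambda>p. F p t - F p a) has_derivative (\<lambda>v. F' p t v - F' p a v)) (at p within P)"
      using t p by (intro has_derivative_diff F) auto
    then have "((\<lambda>p. integral (cbox a t) (R p)) has_derivative (\<lambda>v. F' p t v - F' p a v)) (at p within P)"
      by (rule has_derivative_transform[rotated 2]) (use p ftc in \<open>auto simp: integral_unique\<close>)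
    ultimately have "blinfun_apply (integral (cbox a t) (R' p)) = (\<lambda>v. F' p t v - F' p a v)"
      using frechet_derivative_within_eq[OF _ P(2) p] by metis
    moreover have "blinfun_apply (integral (cbox a t) (R' p)) v = integral (cbox a t) (\<lambda>r. R' p r v)"
      using t by (intro blinfun_apply_integral integrable_continuous continuous_on_subset[OF contR'p]) auto
    ultimately show ?thesis by (simp add: fun_eq_iff diff_eq_eq add.commute)
  qed
  have "((\<lambda>t. F' p a v + integral {a..t} (\<lambda>r. R' p r v)) has_vector_derivative R' p s v) (at s within {a..b})"
  proof -
    have "continuous_on {a..b} (\<lambda>r. R' p r v)" by (intro continuous_intros contR'p)
    from has_vector_derivative_add[OF has_vector_derivative_const integral_has_vector_derivative[OF this s]]
    show ?thesis by simp
  qed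
  then show ?thesis
    by (rule has_vector_derivative_transform[OF s, rotated]) (rule eq)
qed

text \<open>Closed and convex, so that parameter, time and a state together range over a domain of
  the kind treated in \<open>C1_field\<close>; convexity also serves differentiation under the
  integral, and fatness makes derivatives unique.\<close>

locale parameter_domain =
  fixes P :: "'p::euclidean_space set"
  assumes P: "closed P" "convex P" "fat P"
begin

abbreviation S where "S \<equiv> P \<times> {0..1::real}"

lemma fat_S: "fat S"
  using P by (intro fat_Times fat_interval) auto

text \<open>The last two parts form the variational equation with its initial value. The right-hand
  side is an arbitrary function \<open>R\<close> of parameter and time, so the result applies to
  linear and nonlinear equations, and with \<open>R\<close> the time derivative it says that
  parameter and time derivatives commute.\<close>

lemma time_evolution_derivatives:
  fixes \<eta> R :: "'p \<times> real \<Rightarrow> 'a::euclidean_space"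
  assumes \<eta>: "Ck_on (Suc 0) \<eta> S" and R: "Ck_on (Suc 0) R S"
    and ode: "\<forall>p\<in>P. \<forall>s\<in>{0..1}.
      ((\<lambda>s. \<eta> (p, s)) has_vector_derivative R (p, s)) (at s within {0..1})"
  shows "\<And>x. x \<in> S \<Longrightarrow> frd S \<eta> x (0, 1) = R x"
    and "\<And>p s. p \<in> P \<Longrightarrow> s \<in> {0..1} \<Longrightarrow>
      ((\<lambda>s. frd S \<eta> (p, s) (v, 0)) has_vector_derivative frd S R (p, s) (v, 0)) (at s within {0..1})"
    and "\<And>p. p \<in> P \<Longrightarrow> frd S \<eta> (p, 0) (v, 0) = frd P (\<lambda>p. \<eta> (p, 0)) p v"
proof -
  note \<eta>der = Ck_on_has_frd[OF \<eta>]
  show "frd S \<eta> x (0, 1) = R x" if xS: "x \<in> S" for x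
  proof -
    obtain p s where x: "x = (p, s)" "p \<in> P" "s \<in> {0..1}" using xS by auto
    then have "((\<lambda>s. \<eta> (p, s)) has_vector_derivative frd S \<eta> x (0, 1)) (at s within {0..1})"
      using has_vector_derivative_slice[OF \<eta>der[OF xS, unfolded x(1)]] by auto
    then show ?thesis
      using vector_derivative_unique_within[OF _ _ ode[rule_format, OF x(2,3)]] x
        trivial_limit_within islimpt_Icc by (metis zero_less_one)
  qed
  show "((\<lambda>s. frd S \<eta> (p, s) (v, 0)) has_vector_derivative frd S R (p, s) (v, 0)) (at s within {0..1})"
    if "p \<in> P" "s \<in> {0..1}" for p s
  proof -
    obtain R' where R': "\<And>x. x \<in> S \<Longrightarrow> (R has_derivative blinfun_apply (R' x)) (at x within S)"
        "continuous_on S R'"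
      using Ck_on_1_blinfun[OF R] by metis
    \<comment> \<open>Composition with this embedding restricts derivatives to the parameter
      directions while keeping them continuous as operators.\<close>
    define emb :: "'p \<Rightarrow>\<^sub>L ('p \<times> real)" where "emb = Blinfun (\<lambda>v. (v, 0))"
    have emb: "blinfun_apply emb = (\<lambda>v. (v, 0))"
      unfolding emb_def by (intro bounded_linear_Blinfun_apply bounded_linear_intros)
    have "((\<lambda>s. frd S \<eta> (p, s) (v, 0)) has_vector_derivative (R' (p, s) o\<^sub>L emb) v) (at s within {0..1})"
    proof (rule mixed_partial[where F = "\<lambda>p s. \<eta> (p, s)" and F' = "\<lambda>p s v. frd S \<eta> (p, s) (v, 0)"
          and R = "\<lambda>p s. R (p, s)", OF P(2,3) that])
      show "((\<lambda>p. \<eta> (p, s)) has_derivative (\<lambda>v. frd S \<eta> (p, s) (v, 0))) (at p within P)"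
        if "p \<in> P" "s \<in> {0..1}" for p s
        using has_derivative_slice(1)[OF \<eta>der] that by auto
      show "((\<lambda>p. R (p, s)) has_derivative blinfun_apply (R' (p, s) o\<^sub>L emb)) (at p within P)"
        if "p \<in> P" "s \<in> {0..1}" for p s
        using has_derivative_slice(1)[OF R'(1)] that by (auto simp: emb blinfun_compose.rep_eq o_def)
      show "continuous_on (P \<times> {0..1}) (\<lambda>(p, s). R' (p, s) o\<^sub>L emb)"
        using R'(2) by (auto intro!: continuous_intros)
    qed (use ode in blast)
    moreover have "frd S R (p, s) = R' (p, s)"
      using R'(1) fat_S that by (intro frechet_derivative_within_eq) auto
    ultimately show ?thesis by (simp add: emb)
  qed
  show "frd S \<eta> (p, 0) (v, 0) = frd P (\<lambda>p. \<eta> (p, 0)) p v" if "p \<in> P" for p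
  proof -
    have "((\<lambda>p. \<eta> (p, 0)) has_derivative (\<lambda>v. frd S \<eta> (p, 0) (v, 0))) (at p within P)"
      using has_derivative_slice(1)[OF \<eta>der] that by auto
    then show ?thesis using frechet_derivative_within_eq[OF _ P(3) that] by metis
  qed
qed

text \<open>Every direction is a parameter direction plus a multiple of the time direction, and in
  the latter the equation makes the derivative as smooth as \<open>R\<close>. Only the parameter
  derivatives are left to be controlled.\<close>

lemma Ck_on_time_evolution:
  fixes \<eta> R :: "'p \<times> real \<Rightarrow> 'a::euclidean_space"
  assumes \<eta>: "Ck_on (Suc 0) \<eta> S" and R: "Ck_on (Suc k) R S"
    and ode: "\<forall>p\<in>P. \<forall>s\<in>{0..1}.
      ((\<lambda>s. \<eta> (p, s)) has_vector_derivative R (p, s)) (at s within {0..1})"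
    and space: "\<And>v. Ck_on (Suc k) (\<lambda>x. frd S \<eta> x (v, 0)) S"
  shows "Ck_on (Suc (Suc k)) \<eta> S"
proof (rule Ck_on_SucI)
  show der: "(\<eta> has_derivative frd S \<eta> x) (at x within S)" if "x \<in> S" for x
    using Ck_on_has_frd[OF \<eta> that] .
  fix vh :: "'p \<times> real"
  show "Ck_on (Suc k) (\<lambda>x. frd S \<eta> x vh) S"
  proof (rule Ck_on_cong)
    show "Ck_on (Suc k) (\<lambda>x. frd S \<eta> x (fst vh, 0) + snd vh *\<^sub>R R x) S"
      by (intro Ck_on_add space Ck_on_scaleR Ck_on_const R)
    show "frd S \<eta> x (fst vh, 0) + snd vh *\<^sub>R R x = frd S \<eta> x vh" if "x \<in> S" for x
    proof -
      have lin: "linear (frd S \<eta> x)" using has_derivative_linear der[OF that] by blast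
      have "vh = (fst vh, 0) + snd vh *\<^sub>R (0, 1)" by (cases vh) simp
      then show ?thesis
        using linear_add[OF lin, of "(fst vh, 0)" "snd vh *\<^sub>R (0, 1)"] linear_cmul[OF lin, of "snd vh" "(0, 1)"]
          time_evolution_derivatives(1)[OF \<eta> Ck_on_Suc_imp_Ck_on_1[OF R] ode that]
        by simp
    qed
  qed
qed

(* Induction on k works because the parameter derivative of \<eta> solves a linear equation with the same A
   and a new inhomogeneity: the state space does not grow, as it would for the variational equation
   of the nonlinear flow. The case k = 0 is the nonlinear result for the state ((p, s), \<eta>). *)
lemma Ck_on_linear_ode:
  fixes \<eta> \<beta> :: "'p \<times> real \<Rightarrow> 'a::euclidean_space"
  assumes "\<And>b. b \<in> Basis \<Longrightarrow> Ck_on (Suc k) (A b) S" "Ck_on (Suc k) \<beta> S"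
    "Ck_on (Suc k) (\<lambda>p. \<eta> (p, 0)) P"
    "\<And>p s. p \<in> P \<Longrightarrow> s \<in> {0..1} \<Longrightarrow> ((\<lambda>s. \<eta> (p, s)) has_vector_derivative
       (\<Sum>b\<in>Basis. (\<eta> (p, s) \<bullet> b) *\<^sub>R A b (p, s)) + \<beta> (p, s)) (at s within {0..1})"
  shows "Ck_on (Suc k) \<eta> S"
  using assms
proof (induction k arbitrary: \<eta> \<beta>)
  case 0
  \<comment> \<open>Parameter and time move with velocity (0, 1) as part of the state, which makes
    the equation autonomous on a closed convex set.\<close>
  define M where "M = S \<times> (UNIV :: 'a set)"
  define w where "w y = ((0 :: 'p, 1 :: real), (\<Sum>b\<in>Basis. (snd y \<bullet> b) *\<^sub>R A b (fst y)) + \<beta> (fst y))"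
    for y :: "('p \<times> real) \<times> 'a"
  have pre: "Ck_on (Suc 0) (\<lambda>y. h (fst y)) M" if "Ck_on (Suc 0) h S" for h :: "'p \<times> real \<Rightarrow> 'a"
    by (rule Ck_on_compose[OF that Ck_on_bounded_linear[OF bounded_linear_fst]]) (auto simp: M_def)
  have "Ck_on (Suc 0) w M"
    unfolding w_def
    by (intro Ck_on_Pair Ck_on_const Ck_on_add Ck_on_sum Ck_on_scaleR pre 0
        Ck_on_linear_compose[OF bounded_linear_inner_left] Ck_on_bounded_linear[OF bounded_linear_snd])
  then obtain W where W: "\<And>x. x \<in> M \<Longrightarrow> (w has_derivative blinfun_apply (W x)) (at x within M)"
      "continuous_on M W"
    using Ck_on_1_blinfun by metis
  interpret C1_field M UNIV w W
    using W P by unfold_locales (auto simp: M_def intro!: closed_Times convex_Times)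
  define c where "c p s = ((p, s), \<eta> (p, s))" for p s
  have "Ck_on (Suc 0) (\<lambda>(p, s). c p s) S"
  proof (rule icurve_family_C1)
    show "icurve (c p)" if "p \<in> P" for p
      unfolding icurve_def
    proof (intro ballI conjI)
      fix s :: real assume s: "s \<in> {0..1}"
      show "c p s \<in> M \<inter> UNIV" using that s by (auto simp: c_def M_def)
      have "((\<lambda>s. ((p, s), \<eta> (p, s))) has_vector_derivative
          ((0, 1), (\<Sum>b\<in>Basis. (\<eta> (p, s) \<bullet> b) *\<^sub>R A b (p, s)) + \<beta> (p, s))) (at s within {0..1})"
        using 0(4)[OF that s] by (intro has_vector_derivative_Pair) (auto intro!: derivative_eq_intros)
      then show "(c p has_vector_derivative w (c p s)) (at s within {0..1})"
        by (simp add: c_def[abs_def] w_def)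
    qed
    show "Ck_on (Suc 0) (\<lambda>p. c p 0) P"
      unfolding c_def by (intro Ck_on_Pair 0 Ck_on_const Ck_on_bounded_linear[OF bounded_linear_ident])
  qed
  then have "Ck_on (Suc 0) (\<lambda>x. snd (case x of (p, s) \<Rightarrow> c p s)) S"
    by (rule Ck_on_linear_compose[OF bounded_linear_snd])
  then show ?case by (simp add: c_def case_prod_unfold)
next
  case (Suc k)
  have \<eta>: "Ck_on (Suc k) \<eta> S"
    by (rule Suc.IH[OF Ck_on_SucD[OF Suc.prems(1)] Ck_on_SucD[OF Suc.prems(2)] Ck_on_SucD[OF Suc.prems(3)] Suc.prems(4)])
  define R where "R x = (\<Sum>b\<in>Basis. (\<eta> x \<bullet> b) *\<^sub>R A b x) + \<beta> x" for x
  have A: "Ck_on (Suc k) (A b) S" if "b \<in> Basis" for b using Suc.prems(1)[OF that] by (rule Ck_on_SucD)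
  have \<beta>: "Ck_on (Suc k) \<beta> S" using Suc.prems(2) by (rule Ck_on_SucD)
  have R: "Ck_on (Suc k) R S"
    unfolding R_def
    by (intro Ck_on_add Ck_on_sum Ck_on_scaleR Ck_on_linear_compose[OF bounded_linear_inner_left] \<eta> A \<beta>)
  have ode: "\<forall>p\<in>P. \<forall>s\<in>{0..1}.
      ((\<lambda>s. \<eta> (p, s)) has_vector_derivative R (p, s)) (at s within {0..1})"
    using Suc.prems(4) by (auto simp: R_def)
  note evo = time_evolution_derivatives[OF Ck_on_Suc_imp_Ck_on_1[OF \<eta>] Ck_on_Suc_imp_Ck_on_1[OF R] ode]
  show ?case
  proof (rule Ck_on_time_evolution[OF Ck_on_Suc_imp_Ck_on_1[OF \<eta>] R ode])
    fix v
    \<comment> \<open>By the product rule, these are the terms in which the coefficients are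
      differentiated; those in which \<open>\<eta>\<close> is differentiated keep the old
      coefficients \<open>A b\<close>.\<close>
    define \<beta>' where "\<beta>' x = (\<Sum>b\<in>Basis. (\<eta> x \<bullet> b) *\<^sub>R frd S (A b) x (v, 0)) + frd S \<beta> x (v, 0)" for x
    have R': "frd S R x (v, 0) = (\<Sum>b\<in>Basis. (frd S \<eta> x (v, 0) \<bullet> b) *\<^sub>R A b x) + \<beta>' x"
      if x: "x \<in> S" for x
    proof -
      have Rder: "(R has_derivative (\<lambda>h. (\<Sum>b\<in>Basis. (\<eta> x \<bullet> b) *\<^sub>R frd S (A b) x h
          + (frd S \<eta> x h \<bullet> b) *\<^sub>R A b x) + frd S \<beta> x h)) (at x within S)"
        unfolding R_def
        by (intro has_derivative_add has_derivative_sum has_derivative_scaleR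
            has_derivative_inner_left Ck_on_has_frd[OF \<eta> x] Ck_on_has_frd[OF A x] Ck_on_has_frd[OF \<beta> x])
      have "frd S R x (v, 0) = (\<Sum>b\<in>Basis. (\<eta> x \<bullet> b) *\<^sub>R frd S (A b) x (v, 0)
          + (frd S \<eta> x (v, 0) \<bullet> b) *\<^sub>R A b x) + frd S \<beta> x (v, 0)"
        using fun_cong[OF frechet_derivative_within_eq[OF Rder fat_S x], of "(v, 0)"] .
      then show ?thesis by (simp add: \<beta>'_def sum.distrib)
    qed
    show "Ck_on (Suc k) (\<lambda>x. frd S \<eta> x (v, 0)) S"
    proof (rule Suc.IH)
      show "Ck_on (Suc k) \<beta>' S"
        unfolding \<beta>'_def
        by (intro Ck_on_add Ck_on_sum Ck_on_scaleR Ck_on_linear_compose[OF bounded_linear_inner_left]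
            \<eta> Ck_on_frd[OF _ fat_S] Suc.prems)
      show "Ck_on (Suc k) (\<lambda>p. frd S \<eta> (p, 0) (v, 0)) P"
        using Ck_on_frd[OF Suc.prems(3) P(3), of v] by (rule Ck_on_cong) (rule evo(3)[symmetric])
      show "((\<lambda>s. frd S \<eta> (p, s) (v, 0)) has_vector_derivative
          (\<Sum>b\<in>Basis. (frd S \<eta> (p, s) (v, 0) \<bullet> b) *\<^sub>R A b (p, s)) + \<beta>' (p, s)) (at s within {0..1})"
        if "p \<in> P" "s \<in> {0..1}" for p s
      proof -
        have "(p, s) \<in> S" using that by auto
        with evo(2)[OF that, of v] show ?thesis by (simp only: R')
      qed
    qed (rule A)
  qed
qed

text \<open>Smoothness is gained one order at a time: if \<open>c\<close> is C^k, then so are the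
  coefficients \<open>frd (C \<inter> Q) w (c x) b\<close> of the variational equation. Its
  solutions, the parameter derivatives of \<open>c\<close>, are then C^k by the linear theory, and
  \<open>c\<close> is C^(k+1).\<close>

theorem smooth_on_flow_family:
  fixes c :: "'p \<times> real \<Rightarrow> 'a::euclidean_space"
  assumes M: "closed C" "convex C" "open Q" "fat (C \<inter> Q)" and w: "smooth_on (C \<inter> Q) w"
    and c: "\<And>x. x \<in> S \<Longrightarrow> c x \<in> C \<inter> Q"
    and ode: "\<forall>p\<in>P. \<forall>s\<in>{0..1}.
      ((\<lambda>s. c (p, s)) has_vector_derivative w (c (p, s))) (at s within {0..1})"
    and init: "smooth_on P (\<lambda>p. c (p, 0))"
  shows "smooth_on S c"
proof -
  obtain W where W: "\<And>x. x \<in> C \<inter> Q \<Longrightarrow> (w has_derivative blinfun_apply (W x)) (at x within C \<inter> Q)"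
      "continuous_on (C \<inter> Q) W"
    using Ck_on_1_blinfun[OF smooth_on_Ck[OF w]] by metis
  interpret C1_field C Q w W
    using W M by unfold_locales auto
  have Ck: "Ck_on (Suc k) c S" for k
  proof (induction k)
    case 0
    have "Ck_on (Suc 0) (\<lambda>(p, s). (\<lambda>s. c (p, s)) s) S"
      by (rule icurve_family_C1[where c = "\<lambda>p s. c (p, s)"])
        (use c ode in \<open>auto simp: icurve_def simp del: Ck_on.simps intro: smooth_on_Ck[OF init]\<close>)
    then show ?case by simp
  next
    case (Suc k)
    have R: "Ck_on (Suc k) (\<lambda>x. w (c x)) S"
      using c by (intro Ck_on_compose[OF smooth_on_Ck[OF w] Suc]) auto
    note evo = time_evolution_derivatives[OF Ck_on_Suc_imp_Ck_on_1[OF Suc] Ck_on_Suc_imp_Ck_on_1[OF R] ode]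
    show ?case
    proof (rule Ck_on_time_evolution[OF Ck_on_Suc_imp_Ck_on_1[OF Suc] R ode])
      fix v
      \<comment> \<open>The basis expansion and the summand 0 put the variational equation into the
        form required by \<open>Ck_on_linear_ode\<close>.\<close>
      have R': "frd S (\<lambda>x. w (c x)) x (v, 0)
          = (\<Sum>b\<in>Basis. (frd S c x (v, 0) \<bullet> b) *\<^sub>R frd (C \<inter> Q) w (c x) b) + 0" if x: "x \<in> S" for x
      proof -
        have lin: "linear (frd (C \<inter> Q) w (c x))"
          using smooth_on_linear_frd[OF w] c[OF x] by auto
        have "(w has_derivative frd (C \<inter> Q) w (c x)) (at (c x) within c ` S)"
          using smooth_on_has_derivative[OF w] c x by (meson has_derivative_subset image_subset_iff)
        then have der: "((\<lambda>x. w (c x)) has_derivative (\<lambda>h. frd (C \<inter> Q) w (c x) (frd S c x h))) (at x within S)"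
          using has_derivative_in_compose[OF Ck_on_has_frd[OF Suc x]] by auto
        have "frd S (\<lambda>x. w (c x)) x (v, 0) = frd (C \<inter> Q) w (c x) (frd S c x (v, 0))"
          using fun_cong[OF frechet_derivative_within_eq[OF der fat_S x], of "(v, 0)"] .
        also have "\<dots> = frd (C \<inter> Q) w (c x) (\<Sum>b\<in>Basis. (frd S c x (v, 0) \<bullet> b) *\<^sub>R b)"
          by (simp add: euclidean_representation)
        also have "\<dots> = (\<Sum>b\<in>Basis. (frd S c x (v, 0) \<bullet> b) *\<^sub>R frd (C \<inter> Q) w (c x) b)"
          by (simp add: linear_sum[OF lin] linear_cmul[OF lin])
        finally show ?thesis by simp
      qed
      show "Ck_on (Suc k) (\<lambda>x. frd S c x (v, 0)) S"
      proof (rule Ck_on_linear_ode[where A = "\<lambda>b x. frd (C \<inter> Q) w (c x) b" and \<beta> = "\<lambda>_. 0"])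
        show "Ck_on (Suc k) (\<lambda>x. frd (C \<inter> Q) w (c x) b) S" for b
          using c by (intro Ck_on_compose[OF smooth_on_Ck[OF smooth_on_frd[OF w M(4)]] Suc]) auto
        show "Ck_on (Suc k) (\<lambda>p. frd S c (p, 0) (v, 0)) P"
          using Ck_on_frd[OF smooth_on_Ck[OF init] P(3), of _ v] by (rule Ck_on_cong) (rule evo(3)[symmetric])
        show "((\<lambda>s. frd S c (p, s) (v, 0)) has_vector_derivative
            (\<Sum>b\<in>Basis. (frd S c (p, s) (v, 0) \<bullet> b) *\<^sub>R frd (C \<inter> Q) w (c (p, s)) b) + 0) (at s within {0..1})"
          if "p \<in> P" "s \<in> {0..1}" for p s
        proof -
        have "(p, s) \<in> S" using that by auto
        with evo(2)[OF that, of v] show ?thesis by (simp only: R')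
      qed
      qed (rule Ck_on_const)
    qed
  qed
  show ?thesis unfolding smooth_on_def
  proof
    show "Ck_on k c S" for k using Ck_on_SucD[OF Ck] .
  qed
qed

end

section \<open>Invariance of regular zero sets\<close>

(* Newton-type iteration y \<mapsto> y - (\<Sum>\<phi>. \<phi> (p + y) b\<^sub>\<phi>) on the span of a family b dual to the differentials at p0. *)
lemma regular_zero_set_distance:
  fixes F :: "('a::euclidean_space \<Rightarrow> real) set" and D :: "('a \<Rightarrow> real) \<Rightarrow> 'a \<Rightarrow> ('a \<Rightarrow>\<^sub>L real)"
  assumes F: "finite F" and U: "open U" "p0 \<in> U"
    and der: "\<And>\<phi> x. \<phi> \<in> F \<Longrightarrow> x \<in> U \<Longrightarrow> (\<phi> has_derivative blinfun_apply (D \<phi> x)) (at x)"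
    and cont: "\<And>\<phi>. \<phi> \<in> F \<Longrightarrow> continuous_on U (D \<phi>)"
    and zero: "\<And>\<phi>. \<phi> \<in> F \<Longrightarrow> \<phi> p0 = 0"
    and dual: "\<And>\<phi> \<psi>. \<phi> \<in> F \<Longrightarrow> \<psi> \<in> F \<Longrightarrow> D \<phi> p0 (b \<psi>) = (if \<phi> = \<psi> then 1 else 0)"
  obtains r B where "r > 0" "B \<ge> 0" "ball p0 r \<subseteq> U"
    "\<And>p. p \<in> ball p0 r \<Longrightarrow> \<exists>p'\<in>U. (\<forall>\<phi>\<in>F. \<phi> p' = 0) \<and> norm (p - p') \<le> B * (\<Sum>\<phi>\<in>F. \<bar>\<phi> p\<bar>)"
proof -
  define \<beta> where "\<beta> = (\<Sum>\<phi>\<in>F. norm (b \<phi>))"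
  have \<beta>: "\<beta> \<ge> 0" by (simp add: \<beta>_def sum_nonneg)
  \<comment> \<open>If the differentials vary by at most \<kappa>, the iteration contracts by
    \<kappa> * \<beta> \<le> 1 / 2.\<close>
  define \<kappa> where "\<kappa> = 1 / (2 * (\<beta> + 1))"
  have \<kappa>: "\<kappa> > 0" "\<kappa> * \<beta> \<le> 1 / 2" using \<beta> by (auto simp: \<kappa>_def field_simps)
  obtain d0 where d0: "d0 > 0" "cball p0 d0 \<subseteq> U" using U open_contains_cball by blast
  have "\<exists>d>0. \<forall>x\<in>U. dist x p0 < d \<longrightarrow> dist (D \<phi> x) (D \<phi> p0) < \<kappa>" if "\<phi> \<in> F" for \<phi>
    using cont[OF that] U(2) \<kappa>(1) unfolding continuous_on_iff by blast
  then obtain d where d: "\<And>\<phi>. \<phi> \<in> F \<Longrightarrow> d \<phi> > 0"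
    "\<And>\<phi> x. \<phi> \<in> F \<Longrightarrow> x \<in> U \<Longrightarrow> dist x p0 < d \<phi> \<Longrightarrow> dist (D \<phi> x) (D \<phi> p0) < \<kappa>"
    by metis
  \<comment> \<open>Both \<open>p - p0\<close> and the correction \<open>y\<close> will have norm at
    most \<open>r1\<close>, so \<open>p + y\<close> stays within 2 * r1 of \<open>p0\<close>; a
    third leaves this strictly below every given radius.\<close>
  define r1 where "r1 = Min (insert d0 (d ` F)) / 3"
  have r1: "r1 > 0" unfolding r1_def using F d0(1) d(1) by simp
  have "3 * r1 \<le> d0" "\<And>\<phi>. \<phi> \<in> F \<Longrightarrow> 3 * r1 \<le> d \<phi>" unfolding r1_def using F by auto
  then have r1d: "2 * r1 < d0" "\<And>\<phi>. \<phi> \<in> F \<Longrightarrow> 2 * r1 < d \<phi>" using r1 by force+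
  define V where "V = cball p0 (2 * r1)"
  have VU: "V \<subseteq> U" using r1d(1) d0(2) by (auto simp: V_def)
  have lin: "\<bar>\<phi> x - \<phi> y - D \<phi> p0 (x - y)\<bar> \<le> \<kappa> * norm (x - y)"
    if \<phi>: "\<phi> \<in> F" and "x \<in> V" "y \<in> V" for \<phi> x y
  proof -
    have "norm (\<phi> x - \<phi> y - blinfun_apply (D \<phi> p0) (x - y)) \<le> norm (x - y) * \<kappa>"
    proof (rule differentiable_bound_linearization[where S = V and f' = "\<lambda>x. blinfun_apply (D \<phi> x)"])
      show "y + t *\<^sub>R (x - y) \<in> V" if "t \<in> {0..1}" for t
        using convexD_alt[of V y x t] \<open>x \<in> V\<close> \<open>y \<in> V\<close> that by (simp add: V_def algebra_simps)
      fix z assume z: "z \<in> V"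
      show "(\<phi> has_derivative blinfun_apply (D \<phi> z)) (at z within V)"
        using der[OF \<phi>] z VU has_derivative_at_withinI by blast
      have "onorm (blinfun_apply (D \<phi> z) - blinfun_apply (D \<phi> p0)) = norm (D \<phi> z - D \<phi> p0)"
        by (simp add: norm_blinfun.rep_eq fun_diff_def minus_blinfun.rep_eq)
      also have "\<dots> \<le> \<kappa>"
        using d(2)[OF \<phi>, of z] z VU r1d(2)[OF \<phi>] by (auto simp: dist_norm V_def norm_minus_commute)
      finally show "onorm (blinfun_apply (D \<phi> z) - blinfun_apply (D \<phi> p0)) \<le> \<kappa>" .
    next
      show "p0 \<in> V" using r1 by (simp add: V_def)
    qed
    then show ?thesis by (simp add: mult.commute)
  qed
  have contF: "continuous_on U (\<lambda>p. \<Sum>\<phi>\<in>F. \<bar>\<phi> p\<bar> * norm (b \<phi>))"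
    by (intro continuous_intros) (meson der has_derivative_at_withinI has_derivative_continuous continuous_on_eq_continuous_within)
  \<comment> \<open>For \<open>p\<close> this close to \<open>p0\<close> the first correction has
    norm at most r1 / 2; with contraction factor 1 / 2 the iteration then preserves the ball of
    radius \<open>r1\<close>.\<close>
  obtain d1 where d1: "d1 > 0"
    "\<And>p. p \<in> U \<Longrightarrow> dist p p0 < d1 \<Longrightarrow> (\<Sum>\<phi>\<in>F. \<bar>\<phi> p\<bar> * norm (b \<phi>)) \<le> r1 / 2"
  proof -
    have "r1 / 2 > 0" using r1 by simp
    from contF[unfolded continuous_on_iff, rule_format, OF U(2) this] obtain d1 where d1: "d1 > 0" "\<And>p. p \<in> U \<Longrightarrow> dist p p0 < d1 \<Longrightarrow>
        dist (\<Sum>\<phi>\<in>F. \<bar>\<phi> p\<bar> * norm (b \<phi>)) (\<Sum>\<phi>\<in>F. \<bar>\<phi> p0\<bar> * norm (b \<phi>)) < r1 / 2"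
      by blast
    moreover have "(\<Sum>\<phi>\<in>F. \<bar>\<phi> p0\<bar> * norm (b \<phi>)) = 0"
    proof (intro sum.neutral ballI)
      show "\<bar>\<phi> p0\<bar> * norm (b \<phi>) = 0" if "\<phi> \<in> F" for \<phi> using zero[OF that] by simp
    qed
    ultimately have "(\<Sum>\<phi>\<in>F. \<bar>\<phi> p\<bar> * norm (b \<phi>)) \<le> r1 / 2" if "p \<in> U" "dist p p0 < d1" for p
      using d1(2)[OF that] by (simp add: dist_real_def abs_le_iff less_imp_le)
    with d1(1) show ?thesis by (rule that)
  qed
  define r where "r = min r1 d1"
  have sub: "ball p0 r \<subseteq> U" using VU r1 by (force simp: r_def V_def)
  have "\<exists>p'\<in>U. (\<forall>\<phi>\<in>F. \<phi> p' = 0) \<and> norm (p - p') \<le> (2 * \<beta>) * (\<Sum>\<phi>\<in>F. \<bar>\<phi> p\<bar>)"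
    if p: "p \<in> ball p0 r" for p
  proof -
    define Y where "Y = span (b ` F) \<inter> cball 0 r1"
    define T where "T y = y - (\<Sum>\<phi>\<in>F. \<phi> (p + y) *\<^sub>R b \<phi>)" for y
    have pV: "p + y \<in> V" if "y \<in> Y" for y
    proof -
      have "dist p0 (p + y) \<le> dist p0 p + norm y"
        using norm_triangle_ineq4[of "p0 - p" y] by (simp add: dist_norm algebra_simps)
      then show ?thesis using that p by (auto simp: Y_def V_def r_def)
    qed
    \<comment> \<open>On this span the linearized correction reproduces \<open>y\<close>. Hence the
      linear part of \<open>T\<close> at \<open>p0\<close> cancels there and only the variation of
      the differentials is left.\<close>
    have recon: "(\<Sum>\<phi>\<in>F. D \<phi> p0 y *\<^sub>R b \<phi>) = y" if "y \<in> span (b ` F)" for y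
    proof -
      have "linear (\<lambda>y. \<Sum>\<phi>\<in>F. D \<phi> p0 y *\<^sub>R b \<phi>)"
        by (intro bounded_linear.linear bounded_linear_intros)
      moreover have "(\<Sum>\<phi>\<in>F. D \<phi> p0 x *\<^sub>R b \<phi>) = x" if "x \<in> b ` F" for x
      proof -
        obtain \<psi> where \<psi>: "\<psi> \<in> F" "x = b \<psi>" using \<open>x \<in> b ` F\<close> by auto
        have "(\<Sum>\<phi>\<in>F. D \<phi> p0 x *\<^sub>R b \<phi>) = (\<Sum>\<phi>\<in>F. if \<phi> = \<psi> then b \<phi> else 0)"
          using \<psi> by (intro sum.cong) (auto simp: dual)
        then show ?thesis using \<psi> F by simp
      qed
      ultimately show ?thesis using linear_eq_on[of _ "\<lambda>x. x", OF _ linear_ident that] by blast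
    qed
    have contr: "norm (T y1 - T y2) \<le> 1 / 2 * norm (y1 - y2)" if y: "y1 \<in> Y" "y2 \<in> Y" for y1 y2
    proof -
      have "y1 - y2 = (\<Sum>\<phi>\<in>F. D \<phi> p0 (y1 - y2) *\<^sub>R b \<phi>)"
        using recon[of "y1 - y2"] y by (auto simp: Y_def span_diff)
      then have "T y1 - T y2 = (\<Sum>\<phi>\<in>F. D \<phi> p0 (y1 - y2) *\<^sub>R b \<phi>)
          - (\<Sum>\<phi>\<in>F. \<phi> (p + y1) *\<^sub>R b \<phi>) + (\<Sum>\<phi>\<in>F. \<phi> (p + y2) *\<^sub>R b \<phi>)"
        by (simp add: T_def)
      also have "\<dots> = - (\<Sum>\<phi>\<in>F. (\<phi> (p + y1) - \<phi> (p + y2) - D \<phi> p0 ((p + y1) - (p + y2))) *\<^sub>R b \<phi>)"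
        by (simp add: scaleR_diff_left sum_subtractf)
      also have "norm \<dots> \<le> (\<Sum>\<phi>\<in>F. \<kappa> * norm (y1 - y2) * norm (b \<phi>))"
        unfolding norm_minus_cancel
      proof (rule sum_norm_le)
        fix \<phi> assume "\<phi> \<in> F"
        then show "norm ((\<phi> (p + y1) - \<phi> (p + y2) - D \<phi> p0 ((p + y1) - (p + y2))) *\<^sub>R b \<phi>)
            \<le> \<kappa> * norm (y1 - y2) * norm (b \<phi>)"
          using lin[OF _ pV[OF y(1)] pV[OF y(2)]] by (auto intro!: mult_right_mono)
      qed
      also have "\<dots> = (\<kappa> * \<beta>) * norm (y1 - y2)"
        by (simp add: \<beta>_def sum_distrib_left sum_distrib_right mult_ac)
      also have "\<dots> \<le> 1 / 2 * norm (y1 - y2)" using \<kappa>(2) by (intro mult_right_mono) auto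
      finally show ?thesis .
    qed
    have Y0: "0 \<in> Y" using r1 by (simp add: Y_def span_zero)
    have pU: "p \<in> U" using p sub by auto
    have "norm (T 0) \<le> (\<Sum>\<phi>\<in>F. \<bar>\<phi> p\<bar> * norm (b \<phi>))"
      unfolding T_def by (simp add: sum_norm_le)
    moreover have "(\<Sum>\<phi>\<in>F. \<bar>\<phi> p\<bar> * norm (b \<phi>)) \<le> (\<Sum>\<phi>\<in>F. \<bar>\<phi> p\<bar>) * \<beta>"
      unfolding sum_distrib_right \<beta>_def using F by (intro sum_mono mult_left_mono member_le_sum) auto
    moreover have "(\<Sum>\<phi>\<in>F. \<bar>\<phi> p\<bar> * norm (b \<phi>)) \<le> r1 / 2"
      using d1(2)[OF pU] p by (simp add: r_def dist_commute)
    ultimately have T0: "norm (T 0) \<le> r1 / 2" "norm (T 0) \<le> \<beta> * (\<Sum>\<phi>\<in>F. \<bar>\<phi> p\<bar>)"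
      by (simp_all add: mult.commute)
    have Tn: "norm (T y) \<le> norm (T 0) + 1 / 2 * norm y" if "y \<in> Y" for y
      using contr[OF that Y0] norm_triangle_ineq2[of "T y" "T 0"] by simp
    have "\<exists>!y. y \<in> Y \<and> T y = y"
    proof (rule Banach_fix[where c = "1 / 2"])
      show "complete Y"
        unfolding Y_def complete_eq_closed by (intro closed_Int closed_span closed_cball)
      show "T ` Y \<subseteq> Y"
      proof
        fix z assume "z \<in> T ` Y"
        then obtain y where y: "y \<in> Y" "z = T y" by auto
        have "norm z \<le> r1" using Tn[OF y(1)] T0(1) y by (auto simp: Y_def)
        moreover have "z \<in> span (b ` F)"
          using y by (auto simp: T_def Y_def intro!: span_diff span_sum span_scale intro: span_base)
        ultimately show "z \<in> Y" by (simp add: Y_def)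
      qed
      show "dist (T x) (T y) \<le> 1 / 2 * dist x y" if "x \<in> Y" "y \<in> Y" for x y
        using contr[OF that] by (simp add: dist_norm)
    qed (use Y0 in auto)
    then obtain y where y: "y \<in> Y" "T y = y" by auto
    \<comment> \<open>A fixed point makes only this combination vanish; \<open>D \<psi> p0\<close>
      singles out the coefficient of \<open>b \<psi>\<close> by duality. The factor 2 in the final
      bound comes from \<open>norm y \<le> norm (T 0) + 1 / 2 * norm y\<close>.\<close>
    have zs: "(\<Sum>\<phi>\<in>F. \<phi> (p + y) *\<^sub>R b \<phi>) = 0" using y(2) by (simp add: T_def)
    have "\<psi> (p + y) = 0" if "\<psi> \<in> F" for \<psi>
    proof -
      have "0 = D \<psi> p0 (\<Sum>\<phi>\<in>F. \<phi> (p + y) *\<^sub>R b \<phi>)" by (simp add: zs)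
      also have "\<dots> = (\<Sum>\<phi>\<in>F. if \<psi> = \<phi> then \<phi> (p + y) else 0)"
        using that by (auto simp: blinfun.sum_right blinfun.scaleR_right dual intro!: sum.cong)
      finally show ?thesis using that F by simp
    qed
    moreover have "norm y \<le> 2 * \<beta> * (\<Sum>\<phi>\<in>F. \<bar>\<phi> p\<bar>)"
      using Tn[OF y(1)] T0(2) y(2) by simp
    ultimately show ?thesis using pV[OF y(1)] VU by (intro bexI[of _ "p + y"]) auto
  qed
  then show ?thesis using that[of r "2 * \<beta>"] r1 d1(1) \<beta> sub by (auto simp: r_def)
qed

text \<open>The rank is the dimension of the span of the gradients, so
  \<open>card F \<le> jacobian_rank M F p\<close> forces them to be pairwise distinct and
  independent. The functional that is 1 on one gradient and 0 on the others extends linearly, and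
  the inner product represents it by a vector.\<close>

lemma jacobian_rank_dual_basis:
  fixes F :: "('a::euclidean_space \<Rightarrow> real) set"
  assumes F: "finite F" "card F \<le> jacobian_rank M F p"
    and lin: "\<And>\<phi>. \<phi> \<in> F \<Longrightarrow> linear (frd M \<phi> p)"
  obtains b where "\<And>\<phi> \<psi>. \<phi> \<in> F \<Longrightarrow> \<psi> \<in> F \<Longrightarrow> frd M \<phi> p (b \<psi>) = (if \<phi> = \<psi> then 1 else 0)"
proof -
  define G where "G = (\<lambda>\<phi>. grad M \<phi> p)"
  have frd: "frd M \<phi> p v = G \<phi> \<bullet> v" if "\<phi> \<in> F" for \<phi> v
  proof -
    have "frd M \<phi> p v = frd M \<phi> p (\<Sum>i\<in>Basis. (v \<bullet> i) *\<^sub>R i)" by (simp add: euclidean_representation)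
    also have "\<dots> = (\<Sum>i\<in>Basis. (v \<bullet> i) * frd M \<phi> p i)"
      by (simp add: linear_sum[OF lin[OF that]] linear_cmul[OF lin[OF that]])
    also have "\<dots> = G \<phi> \<bullet> v"
      by (simp add: G_def grad_def inner_sum_right inner_commute[of _ v] mult.commute)
    finally show ?thesis .
  qed
  have dim: "card F \<le> dim (G ` F)" using F(2) by (simp add: jacobian_rank_def G_def)
  have "dim (G ` F) \<le> card (G ` F)" using F(1) by (intro dim_le_card') auto
  moreover have "card (G ` F) \<le> card F" using F(1) by (rule card_image_le)
  ultimately have card: "card (G ` F) = card F" "dim (G ` F) = card (G ` F)" using dim by auto
  have inj: "inj_on G F" using card(1) F(1) by (intro eq_card_imp_inj_on) auto
  have indep: "independent (G ` F)"
    using card(2) F(1) by (intro card_le_dim_spanning[of _ "span (G ` F)"]) (auto simp: span_superset)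
  have "\<exists>l. linear l \<and> (\<forall>x\<in>G ` F. l x = (if x = G \<psi> then 1 else 0 :: real))" for \<psi>
    by (rule linear_independent_extend[OF indep])
  then obtain l where l: "\<And>\<psi>. linear (l \<psi>)" "\<And>\<phi> \<psi>. \<phi> \<in> F \<Longrightarrow> l \<psi> (G \<phi>) = (if G \<phi> = G \<psi> then 1 else 0 :: real)"
    by (metis imageI)
  define b where "b \<psi> = (\<Sum>i\<in>Basis. l \<psi> i *\<^sub>R i)" for \<psi>
  have "G \<phi> \<bullet> b \<psi> = l \<psi> (G \<phi>)" for \<phi> \<psi>
  proof -
    have "l \<psi> (G \<phi>) = l \<psi> (\<Sum>i\<in>Basis. (G \<phi> \<bullet> i) *\<^sub>R i)" by (simp add: euclidean_representation)
    also have "\<dots> = (\<Sum>i\<in>Basis. (G \<phi> \<bullet> i) * l \<psi> i)"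
      by (simp add: linear_sum[OF l(1)] linear_cmul[OF l(1)])
    finally show ?thesis by (simp add: b_def inner_sum_right mult.commute)
  qed
  then show ?thesis using that[of b] frd l(2) inj by (auto simp: inj_on_eq_iff)
qed

text \<open>The distance estimate is local, so the curve is examined just after the last time before
  \<open>s1\<close> at which it meets the zero set. Around that point Gronwall extends the vanishing
  a little further, which is a contradiction. The curve has to run in the interior because the
  distance estimate needs a ball inside \<open>M\<close>.\<close>

theorem regular_zero_set_invariant:
  fixes M :: "'a::euclidean_space set" and c :: "real \<Rightarrow> 'a"
  assumes M: "fat M" and F: "finite F" "\<And>\<phi>. \<phi> \<in> F \<Longrightarrow> smooth_on M \<phi>" and w: "smooth_on M w"
    and rank: "\<And>p. p \<in> zero_set M F \<Longrightarrow> card F \<le> jacobian_rank M F p"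
    and tangent: "\<And>p \<phi>. p \<in> zero_set M F \<Longrightarrow> \<phi> \<in> F \<Longrightarrow> Lie M w \<phi> p = 0"
    and cM: "\<And>s. s \<in> {0..1} \<Longrightarrow> c s \<in> interior M"
    and cder: "\<And>s. s \<in> {0..1} \<Longrightarrow> (c has_vector_derivative e *\<^sub>R w (c s)) (at s within {0..1})"
    and c0: "c 0 \<in> zero_set M F" and s1: "s1 \<in> {0..1}"
  shows "c s1 \<in> zero_set M F"
proof (rule ccontr)
  assume notin: "c s1 \<notin> zero_set M F"
  \<comment> \<open>Unlike the sum of the absolute values, this measure of the violation is
    differentiable.\<close>
  define N where "N s = (\<Sum>\<phi>\<in>F. (\<phi> (c s))\<^sup>2)" for s
  have N0: "N s = 0 \<longleftrightarrow> c s \<in> zero_set M F" if "s \<in> {0..1}" for s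
    using F(1) cM[OF that] interior_subset[of M] by (auto simp: N_def zero_set_def sum_nonneg_eq_0_iff)
  have contc: "continuous_on {0..1} c" by (rule continuous_on_vector_derivative) (rule cder)
  have contN: "continuous_on {0..1} N"
    unfolding N_def
  proof (intro continuous_intros)
    show "continuous_on {0..1} (\<lambda>s. \<phi> (c s))" if "\<phi> \<in> F" for \<phi>
      using cM interior_subset[of M]
      by (intro continuous_on_compose2[OF smooth_on_imp_continuous_on[OF F(2)[OF that]] contc]) auto
  qed
  define Z where "Z = {s \<in> {0..s1}. N s = 0}"
  have "closedin (top_of_set {0..s1}) Z"
    unfolding Z_def using s1 by (intro continuous_closedin_preimage_constant continuous_on_subset[OF contN]) auto
  then have "compact Z" using closedin_compact compact_Icc by blast
  moreover have "0 \<in> Z" using c0 N0[of 0] s1 by (auto simp: Z_def)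
  ultimately obtain s0 where s0: "s0 \<in> Z" "\<And>s. s \<in> Z \<Longrightarrow> s \<le> s0"
    using compact_attains_sup[of Z] by blast
  have s01: "0 \<le> s0" "s0 < s1" "s0 \<in> {0..1}" "N s0 = 0"
    using s0(1) notin N0[OF s1] s1 by (auto simp: Z_def order_less_le)
  define p0 where "p0 = c s0"
  have p0: "p0 \<in> zero_set M F" "p0 \<in> interior M" using N0 s01 cM by (auto simp: p0_def)
  define G where "G \<phi> p = Lie M w \<phi> p" for \<phi> :: "'a \<Rightarrow> real" and p
  have Gsmooth: "smooth_on M (G \<phi>)" if "\<phi> \<in> F" for \<phi>
    unfolding G_def Lie_def
    using smooth_on_frd_field[OF F(2)[OF that] M w smooth_on_id] by auto
  obtain R0 where R0: "R0 > 0" "cball p0 R0 \<subseteq> interior M"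
    using p0(2) open_contains_cball open_interior by blast
  have ballM: "cball p0 R0 \<subseteq> M" using R0(2) interior_subset by blast
  \<comment> \<open>Lipschitz bounds for the Lie derivatives convert the distance to a nearby zero,
    where they vanish by tangency, into a bound on their size.\<close>
  have "\<exists>\<Lambda>\<ge>0. \<forall>x\<in>cball p0 R0. \<forall>y\<in>cball p0 R0. \<bar>G \<phi> x - G \<phi> y\<bar> \<le> \<Lambda> * norm (x - y)" if \<phi>: "\<phi> \<in> F" for \<phi>
  proof -
    obtain G' where G': "\<And>x. x \<in> M \<Longrightarrow> (G \<phi> has_derivative blinfun_apply (G' x)) (at x within M)" "continuous_on M G'"
      using Ck_on_1_blinfun[OF smooth_on_Ck[OF Gsmooth[OF \<phi>]]] by metis
    have "bounded (G' ` cball p0 R0)"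
      using compact_continuous_image[OF continuous_on_subset[OF G'(2) ballM] compact_cball] compact_imp_bounded by blast
    then obtain \<Lambda> where \<Lambda>: "\<Lambda> > 0" "\<And>x. x \<in> cball p0 R0 \<Longrightarrow> norm (G' x) \<le> \<Lambda>"
      unfolding bounded_pos by auto
    have "norm (G \<phi> x - G \<phi> y) \<le> \<Lambda> * norm (x - y)" if "x \<in> cball p0 R0" "y \<in> cball p0 R0" for x y
    proof (rule differentiable_bound[OF convex_cball])
      show "(G \<phi> has_derivative blinfun_apply (G' x)) (at x within cball p0 R0)" if "x \<in> cball p0 R0" for x
        using has_derivative_subset[OF G'(1) ballM] that ballM by auto
      show "onorm (blinfun_apply (G' x)) \<le> \<Lambda>" if "x \<in> cball p0 R0" for x
        using \<Lambda>(2)[OF that] by (simp add: norm_blinfun.rep_eq)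
    qed (use that in auto)
    then show ?thesis using \<Lambda>(1) by (intro exI[of _ \<Lambda>]) auto
  qed
  then obtain \<Lambda>f where \<Lambda>f: "\<And>\<phi>. \<phi> \<in> F \<Longrightarrow> \<Lambda>f \<phi> \<ge> 0"
    "\<And>\<phi> x y. \<phi> \<in> F \<Longrightarrow> x \<in> cball p0 R0 \<Longrightarrow> y \<in> cball p0 R0 \<Longrightarrow> \<bar>G \<phi> x - G \<phi> y\<bar> \<le> \<Lambda>f \<phi> * norm (x - y)"
    by metis
  define \<Lambda> where "\<Lambda> = (\<Sum>\<phi>\<in>F. \<Lambda>f \<phi>)"
  have \<Lambda>0: "\<Lambda> \<ge> 0" unfolding \<Lambda>_def using \<Lambda>f(1) by (rule sum_nonneg)
  have \<Lambda>: "\<bar>G \<phi> x - G \<phi> y\<bar> \<le> \<Lambda> * norm (x - y)"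
    if "\<phi> \<in> F" "x \<in> cball p0 R0" "y \<in> cball p0 R0" for \<phi> x y
  proof -
    have "\<Lambda>f \<phi> \<le> \<Lambda>" unfolding \<Lambda>_def using F(1) that(1) \<Lambda>f(1) by (intro member_le_sum) auto
    then show ?thesis using \<Lambda>f(2)[OF that] mult_right_mono[OF _ norm_ge_zero[of "x - y"]] by fastforce
  qed
  obtain r B where rB: "r > 0" "B \<ge> 0" "ball p0 r \<subseteq> ball p0 R0"
    "\<And>p. p \<in> ball p0 r \<Longrightarrow> \<exists>p'\<in>ball p0 R0. (\<forall>\<phi>\<in>F. \<phi> p' = 0) \<and> norm (p - p') \<le> B * (\<Sum>\<phi>\<in>F. \<bar>\<phi> p\<bar>)"
  proof -
    have "\<exists>D. (\<forall>x\<in>M. (\<phi> has_derivative blinfun_apply (D x)) (at x within M)) \<and> continuous_on M D"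
      if "\<phi> \<in> F" for \<phi>
      using Ck_on_1_blinfun[OF smooth_on_Ck[OF F(2)[OF that]]] by metis
    then obtain D where D: "\<And>\<phi> x. \<phi> \<in> F \<Longrightarrow> x \<in> M \<Longrightarrow> (\<phi> has_derivative blinfun_apply (D \<phi> x)) (at x within M)"
        "\<And>\<phi>. \<phi> \<in> F \<Longrightarrow> continuous_on M (D \<phi>)"
      by metis
    have p0M: "p0 \<in> M" using p0(1) by (simp add: zero_set_def)
    obtain b where b: "\<And>\<phi> \<psi>. \<phi> \<in> F \<Longrightarrow> \<psi> \<in> F \<Longrightarrow> frd M \<phi> p0 (b \<psi>) = (if \<phi> = \<psi> then 1 else 0)"
      using jacobian_rank_dual_basis[OF F(1) rank[OF p0(1)] smooth_on_linear_frd[OF F(2) p0M]] by metis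
    have frdD: "frd M \<phi> p0 = blinfun_apply (D \<phi> p0)" if "\<phi> \<in> F" for \<phi>
      using frechet_derivative_within_eq[OF D(1)[OF that p0M] M p0M] .
    show ?thesis
    proof (rule regular_zero_set_distance[OF F(1), of "ball p0 R0" p0 D b])
      show "(\<phi> has_derivative blinfun_apply (D \<phi> x)) (at x)" if "\<phi> \<in> F" "x \<in> ball p0 R0" for \<phi> x
      proof -
        have xi: "x \<in> interior M" using that(2) R0(2) by auto
        then have "(\<phi> has_derivative blinfun_apply (D \<phi> x)) (at x within M)"
          using D(1)[OF that(1)] interior_subset by blast
        then show ?thesis by (simp only: at_within_interior[OF xi])
      qed
      show "continuous_on (ball p0 R0) (D \<phi>)" if "\<phi> \<in> F" for \<phi>
        using continuous_on_subset[OF D(2)[OF that]] ballM ball_subset_cball by blast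
      show "D \<phi> p0 (b \<psi>) = (if \<phi> = \<psi> then 1 else 0)" if "\<phi> \<in> F" "\<psi> \<in> F" for \<phi> \<psi>
        using b[OF that] frdD[OF that(1)] by simp
    qed (use R0(1) p0(1) that in \<open>auto simp: zero_set_def\<close>)
  qed
  have Gbound: "\<bar>G \<phi> p\<bar> \<le> \<Lambda> * (B * (\<Sum>\<phi>\<in>F. \<bar>\<phi> p\<bar>))" if \<phi>: "\<phi> \<in> F" and p: "p \<in> ball p0 r" for \<phi> p
  proof -
    obtain p' where p': "p' \<in> ball p0 R0" "\<forall>\<phi>\<in>F. \<phi> p' = 0" "norm (p - p') \<le> B * (\<Sum>\<phi>\<in>F. \<bar>\<phi> p\<bar>)"
      using rB(4)[OF p] by auto
    have "G \<phi> p' = 0"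
      unfolding G_def using p' ballM \<phi> by (intro tangent) (auto simp: zero_set_def)
    then have "\<bar>G \<phi> p\<bar> \<le> \<Lambda> * norm (p - p')"
      using \<Lambda>[OF \<phi>, of p p'] p p'(1) rB(3) by auto
    also have "\<dots> \<le> \<Lambda> * (B * (\<Sum>\<phi>\<in>F. \<bar>\<phi> p\<bar>))" using p'(3) \<Lambda>0 by (intro mult_left_mono)
    finally show ?thesis .
  qed
  obtain d where d: "d > 0" "\<And>s. s \<in> {0..1} \<Longrightarrow> dist s s0 < d \<Longrightarrow> c s \<in> ball p0 r"
    using contc s01(3) rB(1) unfolding continuous_on_iff p0_def by (metis dist_commute mem_ball)
  define T where "T = min s1 (s0 + d / 2)"
  have T: "s0 < T" "T \<le> s1" "T - s0 \<le> 1" using s01 d(1) s1 by (auto simp: T_def)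
  have sub: "{s0..T} \<subseteq> {0..1}" using T s01 s1 by auto
  \<comment> \<open>The 2 comes from differentiating squares, \<open>e\<close> from the rescaled
    time, and \<open>card F\<close> from bounding the square of the sum of the absolute values by
    \<open>card F\<close> times \<open>N s\<close>.\<close>
  define K where "K = 2 * \<bar>e\<bar> * \<Lambda> * B * card F"
  have "norm (N T) \<le> exp (K + 1) * (norm (N s0) + 0)"
  proof (rule gronwall[where a = s0 and b = T])
    fix s assume s: "s \<in> {s0..T}"
    then have s': "s \<in> {0..1}" using sub by auto
    have pM: "c s \<in> M" using cM[OF s'] interior_subset by blast
    have der: "((\<lambda>s. \<phi> (c s)) has_vector_derivative e * G \<phi> (c s)) (at s within {s0..T})" if "\<phi> \<in> F" for \<phi>
    proof -
      have lin: "linear (frd M \<phi> (c s))" using smooth_on_linear_frd[OF F(2)[OF that] pM] .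
      have cd: "(c has_derivative (\<lambda>h. h *\<^sub>R (e *\<^sub>R w (c s)))) (at s within {s0..T})"
        using cder[OF s'] sub by (auto simp: has_vector_derivative_def intro: has_derivative_subset)
      have "(\<phi> has_derivative frd M \<phi> (c s)) (at (c s) within c ` {s0..T})"
        using sub cM interior_subset[of M]
        by (intro has_derivative_subset[OF smooth_on_has_derivative[OF F(2)[OF that] pM]]) auto
      from has_derivative_in_compose[OF cd this]
      show ?thesis
        by (simp add: has_vector_derivative_def linear_cmul[OF lin] G_def Lie_def mult.assoc)
    qed
    have "(N has_vector_derivative (\<Sum>\<phi>\<in>F. 2 * (\<phi> (c s) * (e * G \<phi> (c s))))) (at s within {s0..T})"
      unfolding N_def
    proof (rule has_vector_derivative_sum)
      fix \<phi> assume "\<phi> \<in> F"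
      then have "((\<lambda>s. \<phi> (c s)) has_real_derivative e * G \<phi> (c s)) (at s within {s0..T})"
        using der has_real_derivative_iff_has_vector_derivative by blast
      then have "((\<lambda>s. (\<phi> (c s))\<^sup>2) has_real_derivative 2 * (\<phi> (c s) * (e * G \<phi> (c s)))) (at s within {s0..T})"
        by (auto intro!: derivative_eq_intros)
      then show "((\<lambda>s. (\<phi> (c s))\<^sup>2) has_vector_derivative 2 * (\<phi> (c s) * (e * G \<phi> (c s)))) (at s within {s0..T})"
        using has_real_derivative_iff_has_vector_derivative by blast
    qed
    then show "(N has_vector_derivative (\<Sum>\<phi>\<in>F. 2 * (\<phi> (c s) * (e * G \<phi> (c s))))) (at s within {s0..T})" .
    have near: "c s \<in> ball p0 r"
      using s T d by (intro d(2)[OF s']) (auto simp: dist_real_def T_def)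
    define A where "A = (\<Sum>\<phi>\<in>F. \<bar>\<phi> (c s)\<bar>)"
    have "norm (\<Sum>\<phi>\<in>F. 2 * (\<phi> (c s) * (e * G \<phi> (c s)))) \<le> (\<Sum>\<phi>\<in>F. 2 * (\<bar>\<phi> (c s)\<bar> * (\<bar>e\<bar> * (\<Lambda> * (B * A)))))"
      using Gbound[OF _ near]
      by (intro sum_norm_le) (auto simp: abs_mult A_def intro!: mult_left_mono)
    also have "\<dots> = 2 * \<bar>e\<bar> * \<Lambda> * B * A\<^sup>2"
      by (simp add: A_def sum_distrib_left[symmetric] sum_distrib_right[symmetric] power2_eq_square)
    also have "\<dots> \<le> 2 * \<bar>e\<bar> * \<Lambda> * B * (N s * card F)"
      using sum_squared_le_sum_of_squares[of "\<lambda>\<phi>. \<bar>\<phi> (c s)\<bar>" F] \<Lambda>0 rB(2) F(1)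
      by (intro mult_left_mono) (auto simp: N_def A_def)
    also have "\<dots> = K * norm (N s) + 0"
      by (simp add: K_def N_def sum_nonneg)
    finally show "norm (\<Sum>\<phi>\<in>F. 2 * (\<phi> (c s) * (e * G \<phi> (c s)))) \<le> K * norm (N s) + 0" .
  qed (use T \<Lambda>0 rB(2) in \<open>auto simp: K_def\<close>)
  then have "N T = 0" using s01(4) by simp
  then have "T \<in> Z" using T s01 by (auto simp: Z_def)
  then show False using s0(2) T(1) by force
qed

section \<open>Flow curves and prolongations\<close>

lemma smooth_on_diff:
  assumes "smooth_on S f" "smooth_on S g"
  shows "smooth_on S (\<lambda>x. f x - g x)"
  using smooth_on_add[OF assms(1) smooth_on_linear_compose[OF bounded_linear_minus[OF bounded_linear_ident] assms(2)]]
  by simp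

lemma frd_Pair:
  assumes "smooth_on S f" "smooth_on S g" "fat S" "x \<in> S"
  shows "frd S (\<lambda>x. (f x, g x)) x v = (frd S f x v, frd S g x v)"
  using frechet_derivative_within_eq[OF has_derivative_Pair[OF smooth_on_has_derivative[OF assms(1,4)]
        smooth_on_has_derivative[OF assms(2,4)]] assms(3,4)]
  by simp

lemma frd_bounded_linear:
  "bounded_linear L \<Longrightarrow> fat S \<Longrightarrow> x \<in> S \<Longrightarrow> frd S L x = L"
  by (intro frechet_derivative_within_eq bounded_linear_imp_has_derivative)

lemma frd_scaleR:
  assumes "smooth_on S f" "fat S" "x \<in> S"
  shows "frd S (\<lambda>x. e *\<^sub>R f x) x v = e *\<^sub>R frd S f x v"
  using frechet_derivative_within_eq[OF has_derivative_scaleR_right[OF smooth_on_has_derivative[OF assms(1,3)]] assms(2,3)]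
  by simp

lemmas smooth_on_intros = smooth_on_Pair smooth_on_fst smooth_on_snd smooth_on_id smooth_on_const

text \<open>An interval that contains 0 and \<open>e\<close> contains all \<open>e * s\<close> with
  \<open>s\<close> in {0..1}, for either sign of \<open>e\<close>.\<close>

lemma flows_to_rescale:
  assumes "flows_to M w e p q"
  obtains c where "c 0 = p" "c 1 = q"
    "\<And>s. s \<in> {0..1} \<Longrightarrow> c s \<in> M \<and> (c has_vector_derivative e *\<^sub>R w (c s)) (at s within {0..1})"
proof -
  obtain J c where J: "is_interval J" "0 \<in> J" "e \<in> J" "c 0 = p" "c e = q"
    "\<And>s. s \<in> J \<Longrightarrow> c s \<in> M \<and> (c has_vector_derivative w (c s)) (at s)"
    using assms unfolding flows_to_def by metis
  have in_J: "e * s \<in> J" if "s \<in> {0..1}" for s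
    using convexD_alt[OF is_interval_convex[OF J(1)] J(2,3), of s] that by (simp add: mult.commute)
  show ?thesis
  proof (rule that[of "\<lambda>s. c (e * s)"])
    fix s :: real assume s: "s \<in> {0..1}"
    have "((\<lambda>s. e * s) has_vector_derivative e) (at s)"
      by (auto intro!: derivative_eq_intros)
    then have "(c \<circ> (\<lambda>s. e * s) has_vector_derivative e *\<^sub>R w (c (e * s))) (at s)"
      using J(6)[OF in_J[OF s]] by (intro vector_diff_chain_at) auto
    then show "c (e * s) \<in> M \<and>
        ((\<lambda>s. c (e * s)) has_vector_derivative e *\<^sub>R w (c (e * s))) (at s within {0..1})"
      using J(6)[OF in_J[OF s]] by (auto simp: o_def intro: has_vector_derivative_at_within)
  qed (use J in auto)
qed

text \<open>This makes the definite description in \<open>flow\<close> meaningful. Both curves are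
  integral curves on {0..1} of the rescaled field and start at \<open>p\<close>.\<close>

lemma flows_to_unique:
  fixes w :: "'a::euclidean_space \<Rightarrow> 'a"
  assumes M: "closed C" "convex C" "open Q" and w: "smooth_on (C \<inter> Q) w"
    and q: "flows_to (C \<inter> Q) w e p q" and q': "flows_to (C \<inter> Q) w e p q'"
  shows "q = q'"
proof -
  have "smooth_on (C \<inter> Q) (\<lambda>x. e *\<^sub>R w x)"
    by (intro smooth_on_scaleR smooth_on_const w)
  then obtain W where W: "\<And>x. x \<in> C \<inter> Q \<Longrightarrow>
      ((\<lambda>x. e *\<^sub>R w x) has_derivative blinfun_apply (W x)) (at x within C \<inter> Q)" "continuous_on (C \<inter> Q) W"
    using Ck_on_1_blinfun[OF smooth_on_Ck] by metis
  interpret C1_field C Q "\<lambda>x. e *\<^sub>R w x" W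
    using W M by unfold_locales auto
  obtain c where c: "c 0 = p" "c 1 = q" "\<And>s. s \<in> {0..1} \<Longrightarrow> c s \<in> C \<inter> Q \<and>
      (c has_vector_derivative e *\<^sub>R w (c s)) (at s within {0..1})"
    using flows_to_rescale[OF q] by metis
  obtain c' where c': "c' 0 = p" "c' 1 = q'" "\<And>s. s \<in> {0..1} \<Longrightarrow> c' s \<in> C \<inter> Q \<and>
      (c' has_vector_derivative e *\<^sub>R w (c' s)) (at s within {0..1})"
    using flows_to_rescale[OF q'] by metis
  have "icurve c" "icurve c'" using c(3) c'(3) by (auto simp: icurve_def)
  then show ?thesis using icurve_unique[of c' c 1] c c' by simp
qed

lemma flow_curve:
  fixes w :: "'a::euclidean_space \<Rightarrow> 'a"
  assumes M: "closed C" "convex C" "open Q" and w: "smooth_on (C \<inter> Q) w"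
    and p: "p \<in> flow_dom (C \<inter> Q) w e"
  obtains c where "c 0 = p" "c 1 = flow (C \<inter> Q) w e p"
    "\<And>s. s \<in> {0..1} \<Longrightarrow> c s \<in> C \<inter> Q \<and> (c has_vector_derivative e *\<^sub>R w (c s)) (at s within {0..1})"
proof -
  obtain q where q: "flows_to (C \<inter> Q) w e p q" using p by (auto simp: flow_dom_def)
  have "flow (C \<inter> Q) w e p = q"
    unfolding flow_def by (rule the_equality[where P = "flows_to (C \<inter> Q) w e p", OF q]) (rule flows_to_unique[OF M w _ q])
  then show ?thesis using flows_to_rescale[OF q] that by metis
qed

text \<open>The closed convex factor of \<open>Tot X\<close>; the other factor is the open cylinder
  over \<open>X\<close>, which may fail to be convex. This is the form of domain on which flows are
  treated.\<close>

definition slab :: "'n::finite tot set" where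
  "slab = {0..1} \<times> {0..} \<times> UNIV \<times> UNIV"

lemma Tot_eq: "Tot X = slab \<inter> (UNIV \<times> UNIV \<times> X \<times> UNIV)"
  by (auto simp: Tot_def slab_def)

lemma slab: "closed slab" "convex slab"
  unfolding slab_def by (auto intro!: closed_Times convex_Times)

lemma open_cylinder: "open X \<Longrightarrow> open (UNIV \<times> UNIV \<times> X \<times> UNIV)"
  by (intro open_Times) auto

section \<open>Smoothness of prolongations on the jet spaces\<close>

lemma fat_UNIV: "fat UNIV"
  by (rule fat_open) simp

lemma fat_jets:
  assumes "open X"
  shows "fat base" "fat (Tot X)" "fat (Jet1 X)" "fat (Jet2 X)" "fat (BJet X)"
  unfolding base_def Tot_def Jet1_def Jet2_def BJet_def
  by (intro fat_Times fat_UNIV fat_open[OF assms] fat_ray fat_interval; simp)+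

text \<open>Projections instead of pattern matching: base point and direction become visibly smooth
  functions of the jet.\<close>

lemma dz1_eq: "dz1 X \<phi> p = frd (Tot X) \<phi> (fst p) (1, 0, fst (snd p), fst (snd (snd (snd p))))"
  by (cases p) auto

lemma dt1_eq: "dt1 X \<phi> p = frd (Tot X) \<phi> (fst p) (0, 1, fst (snd (snd p)), snd (snd (snd (snd p))))"
  by (cases p) auto

lemma dz2_eq: "dz2 X \<phi> (j, xzz, xzt, xtt, uzz, uzt, utt) =
    frd (Jet1 X) \<phi> j ((1, 0, fst (snd j), fst (snd (snd (snd j)))), xzz, xzt, uzz, uzt)"
  by (cases j) auto

lemma dt2_eq: "dt2 X \<phi> (j, xzz, xzt, xtt, uzz, uzt, utt) =
    frd (Jet1 X) \<phi> j ((0, 1, fst (snd (snd j)), snd (snd (snd (snd j)))), xzt, xtt, uzt, utt)"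
  by (cases j) auto

lemma smooth_on_total_derivatives:
  assumes X: "open X" and \<phi>: "smooth_on (Tot X) \<phi>"
  shows "smooth_on (Jet1 X) (dz1 X \<phi>)" "smooth_on (Jet1 X) (dt1 X \<phi>)"
  unfolding dz1_eq[abs_def] dt1_eq[abs_def]
  by (intro smooth_on_frd_field[OF \<phi> fat_jets(2)[OF X]] smooth_on_intros; force simp: Jet1_def)+

lemma smooth_on_total_derivatives2:
  assumes X: "open X" and \<phi>: "smooth_on (Jet1 X) \<phi>"
  shows "smooth_on (Jet2 X) (dz2 X \<phi>)" "smooth_on (Jet2 X) (dt2 X \<phi>)"
proof -
  have eq: "dz2 X \<phi> p = (case p of (j, xzz, xzt, xtt, uzz, uzt, utt) \<Rightarrow>
      frd (Jet1 X) \<phi> j ((1, 0, fst (snd j), fst (snd (snd (snd j)))), xzz, xzt, uzz, uzt))"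
    "dt2 X \<phi> p = (case p of (j, xzz, xzt, xtt, uzz, uzt, utt) \<Rightarrow>
      frd (Jet1 X) \<phi> j ((0, 1, fst (snd (snd j)), snd (snd (snd (snd j)))), xzt, xtt, uzt, utt))" for p
    by (auto simp: dz2_eq dt2_eq split: prod.split)
  show "smooth_on (Jet2 X) (dz2 X \<phi>)" "smooth_on (Jet2 X) (dt2 X \<phi>)"
    unfolding eq[abs_def] case_prod_unfold
    by (intro smooth_on_frd_field[OF \<phi> fat_jets(3)[OF X]] smooth_on_intros; force simp: Jet2_def)+
qed

lemma smooth_on_prolongations:
  assumes X: "open X" and v: "smooth_on (Tot X) vx" "smooth_on (Tot X) vu"
  shows "smooth_on (Tot X) (vert vx vu)" "smooth_on (Jet1 X) (vprol1 X vx vu)" "smooth_on (Jet2 X) (vprol2 X vx vu)"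
proof -
  show ve: "smooth_on (Tot X) (vert vx vu)"
    unfolding vert_def[abs_def] by (intro smooth_on_intros v)
  have fst1: "fst ` Jet1 X \<subseteq> Tot X" and fst2: "fst ` Jet2 X \<subseteq> Jet1 X" by (auto simp: Jet1_def Jet2_def)
  show v1: "smooth_on (Jet1 X) (vprol1 X vx vu)"
    unfolding vprol1_def[abs_def]
    by (intro smooth_on_Pair smooth_on_total_derivatives X v smooth_on_compose[OF ve _ fst1] smooth_on_intros)
  show "smooth_on (Jet2 X) (vprol2 X vx vu)"
    unfolding vprol2_def[abs_def]
    by (intro smooth_on_Pair smooth_on_total_derivatives2 smooth_on_total_derivatives X v
        smooth_on_compose[OF v1 _ fst2] smooth_on_intros)
qed

lemma drop_z_eq: "drop_z p = (fst (snd (fst p)), fst (snd (snd (fst p))), snd (snd (snd (fst p))), snd p)"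
  by (cases p) auto

lemma at_z_eq: "at_z z0 b = ((z0, fst b, fst (snd b), fst (snd (snd b))), snd (snd (snd b)))"
  by (cases b) auto

lemma bounded_linear_drop_z: "bounded_linear drop_z"
  unfolding drop_z_eq[abs_def]
  by (intro bounded_linear_Pair bounded_linear_compose[OF bounded_linear_fst]
      bounded_linear_compose[OF bounded_linear_snd] bounded_linear_fst bounded_linear_snd bounded_linear_ident)

lemma smooth_on_vprol1_face:
  assumes X: "open X" and v: "smooth_on (Tot X) vx" "smooth_on (Tot X) vu" and z0: "z0 \<in> {0..1}"
  shows "smooth_on (BJet X) (vprol1_face X vx vu z0)"
  unfolding vprol1_face_def[abs_def]
proof (intro smooth_on_linear_compose[OF bounded_linear_drop_z] smooth_on_compose[OF smooth_on_prolongations(2)[OF X v]])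
  show "smooth_on (BJet X) (at_z z0)" unfolding at_z_eq[abs_def] by (intro smooth_on_intros)
  show "at_z z0 ` BJet X \<subseteq> Jet1 X"
    using z0 by (auto simp: at_z_eq BJet_def Jet1_def Tot_def)
qed

lemma pde_x_eq: "pde_x f \<alpha> p = fst (snd (snd (fst p))) $ \<alpha>
    - f (fst (fst (fst p)), fst (snd (fst (fst p))), fst (snd (snd (fst (fst p)))), fst (snd (fst p)),
         fst (snd p), snd (snd (snd (fst (fst p))))) $ \<alpha>"
  by (cases "(f, \<alpha>, p)" rule: pde_x.cases) simp

lemma smooth_on_pde_eqs:
  fixes X :: "(real^'n) set"
  assumes f: "smooth_on ({0..1} \<times> {0..} \<times> X \<times> UNIV) f" and \<phi>: "\<phi> \<in> pde_eqs f"
  shows "smooth_on (Jet2 X) \<phi>"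
proof -
  have "smooth_on (Jet2 X) (pde_x f \<alpha>)" for \<alpha>
    unfolding pde_x_eq[abs_def]
    by (intro smooth_on_diff smooth_on_linear_compose[OF bounded_linear_vec_nth] smooth_on_compose[OF f] smooth_on_intros)
      (auto simp: Jet2_def Jet1_def Tot_def)
  moreover have "uz_of = (\<lambda>p :: 'n jet2. fst (snd (snd (snd (fst p)))))"
    proof
    fix p show "uz_of p = fst (snd (snd (snd (fst p))))" by (cases p rule: uz_of.cases) simp
  qed
  moreover have "uzz_of = (\<lambda>p :: 'n jet2. fst (snd (snd (snd (snd p)))))"
    proof
    fix p show "uzz_of p = fst (snd (snd (snd (snd p))))" by (cases p rule: uzz_of.cases) simp
  qed
  moreover have "uzt_of = (\<lambda>p :: 'n jet2. fst (snd (snd (snd (snd (snd p))))))"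
    proof
    fix p show "uzt_of p = fst (snd (snd (snd (snd (snd p)))))" by (cases p rule: uzt_of.cases) simp
  qed
  moreover have "smooth_on (Jet2 X) (\<lambda>p :: 'n jet2. fst (snd (snd (snd (fst p)))))"
    "smooth_on (Jet2 X) (\<lambda>p :: 'n jet2. fst (snd (snd (snd (snd p)))))"
    "smooth_on (Jet2 X) (\<lambda>p :: 'n jet2. fst (snd (snd (snd (snd (snd p))))))"
    by (intro smooth_on_intros)+
  ultimately show ?thesis using \<phi> by (auto simp: pde_eqs_def)
qed

lemma smooth_on_bc:
  assumes G: "smooth_on ({0..} \<times> X \<times> UNIV) G"
  shows "smooth_on (BJet X) (bc G)"
proof -
  have "smooth_on (BJet X) (\<lambda>b. G (fst b, fst (snd b), fst (snd (snd (snd b)))))"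
    by (intro smooth_on_compose[OF G] smooth_on_intros) (auto simp: BJet_def)
  moreover have "bc G = (\<lambda>b. G (fst b, fst (snd b), fst (snd (snd (snd b)))))"
    proof
    fix p show "bc G p = G (fst p, fst (snd p), fst (snd (snd (snd p))))" by (cases "(G, p)" rule: bc.cases) simp
  qed
  ultimately show ?thesis by simp
qed

section \<open>Jets of a moving section\<close>

lemma base: "closed base" "convex base" "fat base"
  unfolding base_def
  by (auto intro!: closed_Times convex_Times fat_Times fat_interval fat_ray)

interpretation base: parameter_domain base
  by unfold_locales (rule base)+

abbreviation E\<^sub>z :: "(real \<times> real) \<times> real" where "E\<^sub>z \<equiv> ((1, 0), 0)"
abbreviation E\<^sub>t :: "(real \<times> real) \<times> real" where "E\<^sub>t \<equiv> ((0, 1), 0)"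
abbreviation E\<^sub>s :: "(real \<times> real) \<times> real" where "E\<^sub>s \<equiv> (0, 1)"

text \<open>\<open>pz\<close> and \<open>pt\<close> differentiate along one coordinate line. The
  joint derivative on \<open>base \<times> {0..1}\<close> carries the smoothness and the chain rule,
  and \<open>pz_eq\<close> and \<open>pt_eq\<close> translate between the two.\<close>

definition ddir :: "(real \<times> real) \<times> real \<Rightarrow> ((real \<times> real) \<times> real \<Rightarrow> 'b::real_normed_vector) \<Rightarrow> (real \<times> real) \<times> real \<Rightarrow> 'b" where
  "ddir v f x = frd (base \<times> {0..1}) f x v"

lemma smooth_on_ddir: "smooth_on base.S f \<Longrightarrow> smooth_on base.S (ddir v f)"
  unfolding ddir_def[abs_def] by (rule smooth_on_frd[OF _ base.fat_S])

lemma ddir_cong: "(\<And>y. y \<in> base.S \<Longrightarrow> f y = g y) \<Longrightarrow> x \<in> base.S \<Longrightarrow> ddir v f x = ddir v g x"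
  unfolding ddir_def by (rule fun_cong[OF frd_cong])

lemma ddir_Pair:
  "smooth_on base.S f \<Longrightarrow> smooth_on base.S g \<Longrightarrow> x \<in> base.S \<Longrightarrow>
    ddir v (\<lambda>x. (f x, g x)) x = (ddir v f x, ddir v g x)"
  unfolding ddir_def by (rule frd_Pair[OF _ _ base.fat_S])

lemma at_within_nontrivial:
  fixes a :: real
  shows "a < b \<Longrightarrow> x \<in> {a..b} \<Longrightarrow> at x within {a..b} \<noteq> bot" "x \<in> {a..} \<Longrightarrow> at x within {a..} \<noteq> bot"
proof -
  show 1: "at x within {a..b} \<noteq> bot" if "a < b" "x \<in> {a..b}" for a b x :: real
    using that islimpt_Icc trivial_limit_within by blast
  show "at x within {a..} \<noteq> bot" if "x \<in> {a..}"
  proof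
    assume "at x within {a..} = bot"
    moreover have "at x within {a..x + 1} \<le> at x within {a..}" by (rule at_le) auto
    ultimately have "at x within {a..x + 1} = bot" by (simp add: bot_unique)
    then show False using 1[of a "x + 1" x] that by auto
  qed
qed

lemma ddir_has_vector_derivative:
  assumes f: "smooth_on base.S f" and x: "z \<in> {0..1}" "t \<ge> 0" "s \<in> {0..1}"
  shows "((\<lambda>z. f ((z, t), s)) has_vector_derivative ddir E\<^sub>z f ((z, t), s)) (at z within {0..1})"
    "((\<lambda>t. f ((z, t), s)) has_vector_derivative ddir E\<^sub>t f ((z, t), s)) (at t within {0..})"
    "((\<lambda>s. f ((z, t), s)) has_vector_derivative ddir E\<^sub>s f ((z, t), s)) (at s within {0..1})"
proof -
  let ?x = "((z, t), s)"
  have xS: "?x \<in> base.S" using x by (auto simp: base_def)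
  note f' = smooth_on_has_derivative[OF f xS]
  have lin: "linear (frd base.S f ?x)" by (rule has_derivative_linear[OF f'])
  have s: "((\<lambda>p. f (p, s)) has_derivative (\<lambda>v. frd base.S f ?x (v, 0))) (at (z, t) within {0..1} \<times> {0..})"
    using has_derivative_slice(1)[OF f'] x by (auto simp: base_def)
  have hz: "(\<lambda>h. frd base.S f ?x ((h, 0), 0)) = (\<lambda>h. h *\<^sub>R frd base.S f ?x E\<^sub>z)"
  proof
    fix h :: real
    have "frd base.S f ?x ((h, 0), 0) = frd base.S f ?x (h *\<^sub>R E\<^sub>z)" by simp
    also have "\<dots> = h *\<^sub>R frd base.S f ?x E\<^sub>z" by (rule linear_cmul[OF lin])
    finally show "frd base.S f ?x ((h, 0), 0) = h *\<^sub>R frd base.S f ?x E\<^sub>z" .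
  qed
  have "((\<lambda>z. f ((z, t), s)) has_derivative (\<lambda>h. frd base.S f ?x ((h, 0), 0))) (at z within {0..1})"
    using has_derivative_slice(1)[OF s] x by auto
  then show "((\<lambda>z. f ((z, t), s)) has_vector_derivative ddir E\<^sub>z f ?x) (at z within {0..1})"
    unfolding has_vector_derivative_def hz ddir_def .
  show "((\<lambda>t. f ((z, t), s)) has_vector_derivative ddir E\<^sub>t f ?x) (at t within {0..})"
    using has_vector_derivative_slice[OF s] x by (auto simp: ddir_def)
  show "((\<lambda>s. f ((z, t), s)) has_vector_derivative ddir E\<^sub>s f ?x) (at s within {0..1})"
    using has_vector_derivative_slice[OF f'] xS by (auto simp: ddir_def)
qed

text \<open>Stated for any \<open>\<phi>\<close> that agrees on \<open>base\<close> with a slice of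
  a smooth \<open>f\<close>. Since the result again describes such an agreement, the lemma can be
  applied repeatedly to obtain second derivatives.\<close>

lemma pz_eq:
  assumes f: "smooth_on base.S f" and x: "p \<in> base" "s \<in> {0..1}"
    and eq: "\<And>p. p \<in> base \<Longrightarrow> \<phi> p = f (p, s)"
  shows "pz \<phi> p = ddir E\<^sub>z f (p, s)"
proof -
  obtain z t where p: "p = (z, t)" "z \<in> {0..1}" "t \<ge> 0" using x(1) by (auto simp: base_def)
  have "((\<lambda>z. \<phi> (z, t)) has_vector_derivative ddir E\<^sub>z f ((z, t), s)) (at z within {0..1})"
    by (rule has_vector_derivative_transform[OF p(2) _ ddir_has_vector_derivative(1)[OF f p(2,3) x(2)]])
      (use p in \<open>auto intro: eq simp: base_def\<close>)
  from vector_derivative_within[OF at_within_nontrivial(1)[OF zero_less_one p(2)] this] show ?thesis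
    using p by simp
qed

lemma pt_eq:
  assumes f: "smooth_on base.S f" and x: "p \<in> base" "s \<in> {0..1}"
    and eq: "\<And>p. p \<in> base \<Longrightarrow> \<phi> p = f (p, s)"
  shows "pt \<phi> p = ddir E\<^sub>t f (p, s)"
proof -
  obtain z t where p: "p = (z, t)" "z \<in> {0..1}" "t \<ge> 0" using x(1) by (auto simp: base_def)
  have "((\<lambda>t. \<phi> (z, t)) has_vector_derivative ddir E\<^sub>t f ((z, t), s)) (at t within {0..})"
    by (rule has_vector_derivative_transform[OF _ _ ddir_has_vector_derivative(2)[OF f p(2,3) x(2)]])
      (use p in \<open>auto intro: eq simp: base_def\<close>)
  from vector_derivative_within[OF at_within_nontrivial(2) this] show ?thesis
    using p by simp
qed

lemma ddir_commute_time:
  fixes f :: "(real \<times> real) \<times> real \<Rightarrow> 'a::euclidean_space"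
  assumes f: "smooth_on base.S f" and x: "x \<in> base.S"
  shows "ddir E\<^sub>s (ddir (v, 0) f) x = ddir (v, 0) (ddir E\<^sub>s f) x"
proof -
  obtain z t s where x': "x = ((z, t), s)" "z \<in> {0..1}" "t \<ge> 0" "s \<in> {0..1}" "(z, t) \<in> base"
    using x by (auto simp: base_def)
  have ode: "\<forall>p\<in>base. \<forall>s\<in>{0..1}. ((\<lambda>s. f (p, s)) has_vector_derivative ddir E\<^sub>s f (p, s)) (at s within {0..1})"
    using ddir_has_vector_derivative(3)[OF f] by (auto simp: base_def)
  have "((\<lambda>s. ddir (v, 0) f ((z, t), s)) has_vector_derivative ddir (v, 0) (ddir E\<^sub>s f) x) (at s within {0..1})"
    using base.time_evolution_derivatives(2)[OF smooth_on_Ck[OF f] smooth_on_Ck[OF smooth_on_ddir[OF f]] ode x'(5,4)]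
    unfolding x'(1) ddir_def[symmetric] .
  from vector_derivative_unique_within[OF at_within_nontrivial(1)
      ddir_has_vector_derivative(3)[OF smooth_on_ddir[OF f] x'(2,3,4)] this] x'(4)
  show ?thesis unfolding x'(1) by simp
qed

lemma ddir_commute:
  fixes f :: "(real \<times> real) \<times> real \<Rightarrow> 'a::euclidean_space"
  assumes f: "smooth_on base.S f" and x: "x \<in> base.S"
  shows "ddir E\<^sub>z (ddir E\<^sub>t f) x = ddir E\<^sub>t (ddir E\<^sub>z f) x"
proof -
  obtain z t s where x': "x = ((z, t), s)" "z \<in> {0..1}" "t \<ge> 0" "s \<in> {0..1}"
    using x by (auto simp: base_def)
  have der: "((\<lambda>z. g ((z, t), s)) has_derivative (\<lambda>h. h *\<^sub>R ddir E\<^sub>z g ((z, t), s))) (at z within {0..1})"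
    if "smooth_on base.S g" "z \<in> {0..1}" "t \<ge> 0" for z t and g :: "(real \<times> real) \<times> real \<Rightarrow> 'a"
    using ddir_has_vector_derivative(1)[OF that x'(4)] by (simp add: has_vector_derivative_def)
  \<comment> \<open>\<open>mixed_partial\<close> works on a bounded interval of the second variable,
    whose role is played by t; derivatives within the ray restrict to this one, which contains
    \<open>t\<close>.\<close>
  have sub: "{0..t + 1} \<subseteq> {0..}" by auto
  have "((\<lambda>t. (\<lambda>h. h *\<^sub>R ddir E\<^sub>z f ((z, t), s)) 1) has_vector_derivative
      blinfun_scaleR_left (ddir E\<^sub>z (ddir E\<^sub>t f) ((z, t), s)) 1) (at t within {0..t + 1})"
  proof (rule mixed_partial[where P = "{0..1}" and F = "\<lambda>z t. f ((z, t), s)" and R = "\<lambda>z t. ddir E\<^sub>t f ((z, t), s)"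
        and F' = "\<lambda>z t h. h *\<^sub>R ddir E\<^sub>z f ((z, t), s)"
        and R' = "\<lambda>z t. blinfun_scaleR_left (ddir E\<^sub>z (ddir E\<^sub>t f) ((z, t), s))"])
    fix z t' :: real assume zt: "z \<in> {0..1}" "t' \<in> {0..t + 1}"
    then have t': "t' \<ge> 0" by auto
    show "((\<lambda>z. f ((z, t'), s)) has_derivative (\<lambda>h. h *\<^sub>R ddir E\<^sub>z f ((z, t'), s))) (at z within {0..1})"
      by (rule der[OF f zt(1) t'])
    show "((\<lambda>t. f ((z, t), s)) has_vector_derivative ddir E\<^sub>t f ((z, t'), s)) (at t' within {0..t + 1})"
      by (rule has_vector_derivative_within_subset[OF ddir_has_vector_derivative(2)[OF f zt(1) t' x'(4)] sub])
    show "((\<lambda>z. ddir E\<^sub>t f ((z, t'), s)) has_derivative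
        blinfun_apply (blinfun_scaleR_left (ddir E\<^sub>z (ddir E\<^sub>t f) ((z, t'), s)))) (at z within {0..1})"
      using der[OF smooth_on_ddir[OF f] zt(1) t'] by simp
  next
    have "continuous_on ({0..1} \<times> {0..t + 1}) (\<lambda>y. ((fst y, snd y), s))"
      by (intro continuous_intros)
    moreover have "(\<lambda>y. ((fst y, snd y), s)) ` ({0..1} \<times> {0..t + 1}) \<subseteq> base.S"
      using x'(4) by (auto simp: base_def)
    ultimately have "continuous_on ({0..1} \<times> {0..t + 1}) (\<lambda>y. ddir E\<^sub>z (ddir E\<^sub>t f) ((fst y, snd y), s))"
      by (rule continuous_on_compose2[OF smooth_on_imp_continuous_on[OF smooth_on_ddir[OF smooth_on_ddir[OF f]]]])
    then show "continuous_on ({0..1} \<times> {0..t + 1}) (\<lambda>(z, t). blinfun_scaleR_left (ddir E\<^sub>z (ddir E\<^sub>t f) ((z, t), s)))"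
      unfolding case_prod_unfold by (rule bounded_linear.continuous_on[OF bounded_linear_blinfun_scaleR_left])
  qed (use x' fat_interval[of 0 1] in auto)
  then have "((\<lambda>t. ddir E\<^sub>z f ((z, t), s)) has_vector_derivative ddir E\<^sub>z (ddir E\<^sub>t f) ((z, t), s)) (at t within {0..t + 1})"
    by simp
  from vector_derivative_unique_within[OF at_within_nontrivial(1) this
      has_vector_derivative_within_subset[OF ddir_has_vector_derivative(2)[OF smooth_on_ddir[OF f] x'(2,3,4)] sub]] x'(3)
  show ?thesis unfolding x'(1) by simp
qed

text \<open>The mechanism of prolongation: exchanging the derivatives and applying the chain rule,
  the derivative of \<open>g\<close> evolves by the differential of \<open>h\<close> in the
  direction in which \<open>m\<close> varies. It is used with \<open>m\<close> the curve family for
  first jets and with \<open>m\<close> the first jets for second jets.\<close>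

lemma ddir_transport:
  fixes g :: "(real \<times> real) \<times> real \<Rightarrow> 'b::euclidean_space" and m :: "_ \<Rightarrow> 'm::euclidean_space"
  assumes g: "smooth_on base.S g" and h: "smooth_on T h" and m: "smooth_on base.S m" "m ` base.S \<subseteq> T"
    and evo: "\<And>x. x \<in> base.S \<Longrightarrow> ddir E\<^sub>s g x = e *\<^sub>R h (m x)" and x: "x \<in> base.S"
  shows "ddir E\<^sub>s (ddir (v, 0) g) x = e *\<^sub>R frd T h (m x) (ddir (v, 0) m x)"
proof -
  have hm: "smooth_on base.S (\<lambda>x. h (m x))" by (rule smooth_on_compose[OF h m])
  have "ddir E\<^sub>s (ddir (v, 0) g) x = ddir (v, 0) (\<lambda>x. e *\<^sub>R h (m x)) x"
    unfolding ddir_commute_time[OF g x] by (rule ddir_cong[OF evo x])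
  also have "\<dots> = e *\<^sub>R frd T h (m x) (ddir (v, 0) m x)"
    unfolding ddir_def frd_scaleR[OF hm base.fat_S x] smooth_on_chain[OF h m x base.fat_S] ..
  finally show ?thesis .
qed

section \<open>Evolution of the jets under a vertical flow\<close>

locale jet_family =
  fixes X :: "(real^'n) set" and vx :: "'n::finite tot \<Rightarrow> real^'n" and vu :: "'n tot \<Rightarrow> real"
    and e :: real and c :: "(real \<times> real) \<times> real \<Rightarrow> 'n tot"
  assumes X: "open X" and v: "smooth_on (Tot X) vx" "smooth_on (Tot X) vu"
    and c: "smooth_on base.S c" "\<And>x. x \<in> base.S \<Longrightarrow> c x \<in> Tot X" "\<And>x. x \<in> base.S \<Longrightarrow> proj (c x) = fst x"
    and ode: "\<And>x. x \<in> base.S \<Longrightarrow> ddir E\<^sub>s c x = e *\<^sub>R vert vx vu (c x)"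
begin

definition cx where "cx = (\<lambda>x. fst (snd (snd (c x))))"
definition cu where "cu = (\<lambda>x. snd (snd (snd (c x))))"

text \<open>At \<open>(p, s)\<close> this is the first jet at \<open>p\<close> of the section at
  time \<open>s\<close>, as \<open>sprol_eq\<close> confirms. Joint derivatives are used so that it
  is smooth in \<open>s\<close> as well.\<close>

definition "J1 = (\<lambda>x. (c x, ddir E\<^sub>z cx x, ddir E\<^sub>t cx x, ddir E\<^sub>z cu x, ddir E\<^sub>t cu x))"
definition "J2 = (\<lambda>x. (J1 x,
  ddir E\<^sub>z (ddir E\<^sub>z cx) x, ddir E\<^sub>t (ddir E\<^sub>z cx) x, ddir E\<^sub>t (ddir E\<^sub>t cx) x,
  ddir E\<^sub>z (ddir E\<^sub>z cu) x, ddir E\<^sub>t (ddir E\<^sub>z cu) x, ddir E\<^sub>t (ddir E\<^sub>t cu) x))"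

lemma smooth_cx: "smooth_on base.S cx" and smooth_cu: "smooth_on base.S cu"
  unfolding cx_def cu_def by (intro smooth_on_fst smooth_on_snd c)+

lemma smooth_J1: "smooth_on base.S J1"
  unfolding J1_def by (intro smooth_on_Pair c smooth_on_ddir smooth_cx smooth_cu)

lemma smooth_J2: "smooth_on base.S J2"
  unfolding J2_def by (intro smooth_on_Pair smooth_J1 smooth_on_ddir smooth_cx smooth_cu)

lemma J_in: "J1 ` base.S \<subseteq> Jet1 X" "J2 ` base.S \<subseteq> Jet2 X"
  using c(2) by (auto simp: J1_def J2_def Jet1_def Jet2_def)

lemma c_eq: "x \<in> base.S \<Longrightarrow> c x = (fst (fst x), snd (fst x), cx x, cu x)"
  using c(3)[of x] by (cases "c x") (auto simp: cx_def cu_def)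

lemma ddir_c:
  assumes x: "x \<in> base.S"
  shows "ddir w c x = (fst (fst w), snd (fst w), ddir w cx x, ddir w cu x)"
proof -
  have "ddir w c x = ddir w (\<lambda>x. (fst (fst x), snd (fst x), cx x, cu x)) x"
    by (rule ddir_cong[OF c_eq x])
  also have "\<dots> = (ddir w (\<lambda>x. fst (fst x)) x, ddir w (\<lambda>x. snd (fst x)) x, ddir w cx x, ddir w cu x)"
    by (simp add: ddir_Pair x smooth_cx smooth_cu smooth_on_intros)
  also have "ddir w (\<lambda>x. fst (fst x)) x = fst (fst w)"
    unfolding ddir_def
    by (subst frd_bounded_linear[OF bounded_linear_compose[OF bounded_linear_fst bounded_linear_fst] base.fat_S x]) simp
  also have "ddir w (\<lambda>x. snd (fst x)) x = snd (fst w)"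
    unfolding ddir_def
    by (subst frd_bounded_linear[OF bounded_linear_compose[OF bounded_linear_snd bounded_linear_fst] base.fat_S x]) simp
  finally show ?thesis .
qed

lemma ddir_J1:
  assumes x: "x \<in> base.S"
  shows "ddir w J1 x = (ddir w c x, ddir w (ddir E\<^sub>z cx) x, ddir w (ddir E\<^sub>t cx) x,
    ddir w (ddir E\<^sub>z cu) x, ddir w (ddir E\<^sub>t cu) x)"
  unfolding J1_def by (simp add: ddir_Pair x c smooth_cx smooth_cu smooth_on_ddir smooth_on_Pair)

lemma ode_components:
  assumes x: "x \<in> base.S"
  shows "ddir E\<^sub>s cx x = e *\<^sub>R vx (c x)" "ddir E\<^sub>s cu x = e *\<^sub>R vu (c x)"
  using ode[OF x] ddir_c[OF x, of "E\<^sub>s"] by (auto simp: vert_def)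

text \<open>A total derivative is a differential in the direction in which jets of sections move:
  the z-derivative of \<open>c\<close> is \<open>(1, 0, x_z, u_z)\<close>, exactly the direction in
  \<open>dz1\<close>, and that of \<open>J1\<close> is the direction in \<open>dz2\<close>. Each
  formula is therefore an instance of \<open>ddir_transport\<close>.\<close>

lemma prolonged_component:
  fixes g :: "(real \<times> real) \<times> real \<Rightarrow> 'b::euclidean_space" and \<nu> :: "'n tot \<Rightarrow> 'b"
  assumes g: "smooth_on base.S g" and \<nu>: "smooth_on (Tot X) \<nu>"
    and evo: "\<And>x. x \<in> base.S \<Longrightarrow> ddir E\<^sub>s g x = e *\<^sub>R \<nu> (c x)" and x: "x \<in> base.S"
  shows "ddir E\<^sub>s (ddir E\<^sub>z g) x = e *\<^sub>R dz1 X \<nu> (J1 x)"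
    "ddir E\<^sub>s (ddir E\<^sub>t g) x = e *\<^sub>R dt1 X \<nu> (J1 x)"
    "ddir E\<^sub>s (ddir E\<^sub>z (ddir E\<^sub>z g)) x = e *\<^sub>R dz2 X (dz1 X \<nu>) (J2 x)"
    "ddir E\<^sub>s (ddir E\<^sub>t (ddir E\<^sub>z g)) x = e *\<^sub>R dt2 X (dz1 X \<nu>) (J2 x)"
    "ddir E\<^sub>s (ddir E\<^sub>t (ddir E\<^sub>t g)) x = e *\<^sub>R dt2 X (dt1 X \<nu>) (J2 x)"
proof -
  have cT: "c ` base.S \<subseteq> Tot X" using c(2) by auto
  have z: "ddir E\<^sub>s (ddir E\<^sub>z g) x = e *\<^sub>R dz1 X \<nu> (J1 x)"
    and t: "ddir E\<^sub>s (ddir E\<^sub>t g) x = e *\<^sub>R dt1 X \<nu> (J1 x)" if x: "x \<in> base.S" for x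
    using ddir_transport[OF g \<nu> c(1) cT evo x, of "(1, 0)"] ddir_transport[OF g \<nu> c(1) cT evo x, of "(0, 1)"]
    by (simp_all add: ddir_c[OF x] dz1_eq dt1_eq J1_def)
  show "ddir E\<^sub>s (ddir E\<^sub>z g) x = e *\<^sub>R dz1 X \<nu> (J1 x)" "ddir E\<^sub>s (ddir E\<^sub>t g) x = e *\<^sub>R dt1 X \<nu> (J1 x)"
    using z t x by auto
  note dz = smooth_on_total_derivatives(1)[OF X \<nu>] and dt = smooth_on_total_derivatives(2)[OF X \<nu>]
  \<comment> \<open>The z-derivative of the x_t and u_t components has to be the mixed coordinate of
    \<open>J2\<close>, which is stored as the t-derivative of x_z and u_z; here z- and t-derivatives
    are exchanged.\<close>
  have Jz: "ddir E\<^sub>z J1 x = ((1, 0, ddir E\<^sub>z cx x, ddir E\<^sub>z cu x), ddir E\<^sub>z (ddir E\<^sub>z cx) x,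
      ddir E\<^sub>t (ddir E\<^sub>z cx) x, ddir E\<^sub>z (ddir E\<^sub>z cu) x, ddir E\<^sub>t (ddir E\<^sub>z cu) x)"
    by (simp add: ddir_J1[OF x] ddir_c[OF x] ddir_commute[OF smooth_cx x] ddir_commute[OF smooth_cu x])
  have Jt: "ddir E\<^sub>t J1 x = ((0, 1, ddir E\<^sub>t cx x, ddir E\<^sub>t cu x), ddir E\<^sub>t (ddir E\<^sub>z cx) x,
      ddir E\<^sub>t (ddir E\<^sub>t cx) x, ddir E\<^sub>t (ddir E\<^sub>z cu) x, ddir E\<^sub>t (ddir E\<^sub>t cu) x)"
    by (simp add: ddir_J1[OF x] ddir_c[OF x])
  have comp: "fst (snd (J1 x)) = ddir E\<^sub>z cx x" "fst (snd (snd (J1 x))) = ddir E\<^sub>t cx x"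
    "fst (snd (snd (snd (J1 x)))) = ddir E\<^sub>z cu x" "snd (snd (snd (snd (J1 x)))) = ddir E\<^sub>t cu x"
    by (simp_all add: J1_def)
  show "ddir E\<^sub>s (ddir E\<^sub>z (ddir E\<^sub>z g)) x = e *\<^sub>R dz2 X (dz1 X \<nu>) (J2 x)"
    unfolding J2_def dz2_eq comp Jz[symmetric]
    by (rule ddir_transport[OF smooth_on_ddir[OF g] dz smooth_J1 J_in(1) z x])
  show "ddir E\<^sub>s (ddir E\<^sub>t (ddir E\<^sub>z g)) x = e *\<^sub>R dt2 X (dz1 X \<nu>) (J2 x)"
    unfolding J2_def dt2_eq comp Jt[symmetric]
    by (rule ddir_transport[OF smooth_on_ddir[OF g] dz smooth_J1 J_in(1) z x])
  show "ddir E\<^sub>s (ddir E\<^sub>t (ddir E\<^sub>t g)) x = e *\<^sub>R dt2 X (dt1 X \<nu>) (J2 x)"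
    unfolding J2_def dt2_eq comp Jt[symmetric]
    by (rule ddir_transport[OF smooth_on_ddir[OF g] dt smooth_J1 J_in(1) t x])
qed

lemma J1_evolution:
  assumes x: "x \<in> base.S"
  shows "ddir E\<^sub>s J1 x = e *\<^sub>R vprol1 X vx vu (J1 x)"
proof -
  have "fst (J1 x) = c x" by (simp add: J1_def)
  then show ?thesis
    unfolding ddir_J1[OF x] ode[OF x] vprol1_def
    by (simp add: prolonged_component(1,2)[OF smooth_cx v(1) ode_components(1) x]
        prolonged_component(1,2)[OF smooth_cu v(2) ode_components(2) x])
qed

lemma J2_evolution:
  assumes x: "x \<in> base.S"
  shows "ddir E\<^sub>s J2 x = e *\<^sub>R vprol2 X vx vu (J2 x)"
proof -
  have "ddir E\<^sub>s J2 x = (ddir E\<^sub>s J1 x,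
      ddir E\<^sub>s (ddir E\<^sub>z (ddir E\<^sub>z cx)) x, ddir E\<^sub>s (ddir E\<^sub>t (ddir E\<^sub>z cx)) x, ddir E\<^sub>s (ddir E\<^sub>t (ddir E\<^sub>t cx)) x,
      ddir E\<^sub>s (ddir E\<^sub>z (ddir E\<^sub>z cu)) x, ddir E\<^sub>s (ddir E\<^sub>t (ddir E\<^sub>z cu)) x, ddir E\<^sub>s (ddir E\<^sub>t (ddir E\<^sub>t cu)) x)"
    unfolding J2_def by (simp add: ddir_Pair x smooth_J1 smooth_cx smooth_cu smooth_on_ddir smooth_on_Pair)
  moreover have "fst (J2 x) = J1 x" by (simp add: J2_def)
  ultimately show ?thesis
    by (simp add: J1_evolution[OF x] vprol2_def prolonged_component(3-5)[OF smooth_cx v(1) ode_components(1) x]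
        prolonged_component(3-5)[OF smooth_cu v(2) ode_components(2) x])
qed

lemma J_evolution:
  assumes "p \<in> base" "s \<in> {0..1}"
  shows "((\<lambda>s. J1 (p, s)) has_vector_derivative e *\<^sub>R vprol1 X vx vu (J1 (p, s))) (at s within {0..1})"
    "((\<lambda>s. J2 (p, s)) has_vector_derivative e *\<^sub>R vprol2 X vx vu (J2 (p, s))) (at s within {0..1})"
proof -
  have x: "(p, s) \<in> base.S" using assms by auto
  obtain z t where p: "p = (z, t)" "z \<in> {0..1}" "t \<ge> 0" using assms by (auto simp: base_def)
  show "((\<lambda>s. J1 (p, s)) has_vector_derivative e *\<^sub>R vprol1 X vx vu (J1 (p, s))) (at s within {0..1})"
    unfolding J1_evolution[OF x, symmetric] unfolding p(1)
    by (rule ddir_has_vector_derivative(3)[OF smooth_J1 p(2,3) assms(2)])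
  show "((\<lambda>s. J2 (p, s)) has_vector_derivative e *\<^sub>R vprol2 X vx vu (J2 (p, s))) (at s within {0..1})"
    unfolding J2_evolution[OF x, symmetric] unfolding p(1)
    by (rule ddir_has_vector_derivative(3)[OF smooth_J2 p(2,3) assms(2)])
qed

lemma sprol_eq:
  assumes \<gamma>: "\<And>p. p \<in> base \<Longrightarrow> \<gamma> p = c (p, s)" and s: "s \<in> {0..1}" and p: "p \<in> base"
  shows "sprol1 \<gamma> p = J1 (p, s)" "sprol2 \<gamma> p = J2 (p, s)"
proof -
  have x_of: "x_of y = fst (snd (snd y))" and u_of: "u_of y = snd (snd (snd y))" for y :: "'n tot"
    by (cases y; auto)+
  have gx: "(x_of \<circ> \<gamma>) p = cx (p, s)" and gu: "(u_of \<circ> \<gamma>) p = cu (p, s)" if "p \<in> base" for p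
    using \<gamma>[OF that] by (simp_all add: x_of u_of cx_def cu_def)
  have xz: "pz (x_of \<circ> \<gamma>) p = ddir E\<^sub>z cx (p, s)" and xt: "pt (x_of \<circ> \<gamma>) p = ddir E\<^sub>t cx (p, s)"
    and uz: "pz (u_of \<circ> \<gamma>) p = ddir E\<^sub>z cu (p, s)" and ut: "pt (u_of \<circ> \<gamma>) p = ddir E\<^sub>t cu (p, s)"
    if "p \<in> base" for p
    by (rule pz_eq[OF smooth_cx that s gx] pt_eq[OF smooth_cx that s gx]
        pz_eq[OF smooth_cu that s gu] pt_eq[OF smooth_cu that s gu]; assumption)+
  show 1: "sprol1 \<gamma> p = J1 (p, s)"
    by (simp add: sprol1_def J1_def \<gamma> p xz xt uz ut)
  have "pz (pz (x_of \<circ> \<gamma>)) p = ddir E\<^sub>z (ddir E\<^sub>z cx) (p, s)"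
    by (rule pz_eq[OF smooth_on_ddir[OF smooth_cx] p s xz])
  moreover have "pt (pz (x_of \<circ> \<gamma>)) p = ddir E\<^sub>t (ddir E\<^sub>z cx) (p, s)"
    by (rule pt_eq[OF smooth_on_ddir[OF smooth_cx] p s xz])
  moreover have "pt (pt (x_of \<circ> \<gamma>)) p = ddir E\<^sub>t (ddir E\<^sub>t cx) (p, s)"
    by (rule pt_eq[OF smooth_on_ddir[OF smooth_cx] p s xt])
  moreover have "pz (pz (u_of \<circ> \<gamma>)) p = ddir E\<^sub>z (ddir E\<^sub>z cu) (p, s)"
    by (rule pz_eq[OF smooth_on_ddir[OF smooth_cu] p s uz])
  moreover have "pt (pz (u_of \<circ> \<gamma>)) p = ddir E\<^sub>t (ddir E\<^sub>z cu) (p, s)"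
    by (rule pt_eq[OF smooth_on_ddir[OF smooth_cu] p s uz])
  moreover have "pt (pt (u_of \<circ> \<gamma>)) p = ddir E\<^sub>t (ddir E\<^sub>t cu) (p, s)"
    by (rule pt_eq[OF smooth_on_ddir[OF smooth_cu] p s ut])
  ultimately show "sprol2 \<gamma> p = J2 (p, s)"
    by (simp only: sprol2_def J2_def 1)
qed

end

section \<open>Symmetries\<close>

lemma zero_at_0:
  fixes h :: "real \<Rightarrow> real"
  assumes "continuous_on {0..} h" "\<And>t. t > 0 \<Longrightarrow> h t = 0"
  shows "h 0 = 0"
proof -
  have "(h \<longlongrightarrow> h 0) (at 0 within {0..})" using assms(1) by (simp add: continuous_on)
  moreover have "\<forall>\<^sub>F t in at 0 within {0..}. h t = 0"
    using assms(2) by (auto simp: eventually_at intro: exI[of _ 1])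
  then have "(h \<longlongrightarrow> 0) (at 0 within {0..})" by (rule tendsto_eventually)
  ultimately show ?thesis
    using tendsto_unique[OF at_within_nontrivial(2)] by force
qed

text \<open>Together with the rank hypothesis this gives the inequality between cardinality and rank
  from which independent gradients are obtained.\<close>

lemma card_pde_eqs: "card (pde_eqs f) \<le> CARD('n) + 3" for f :: "'n::finite rhs"
proof -
  have "card (range (pde_x f)) \<le> CARD('n)" by (rule card_image_le) simp
  moreover have "card {uz_of, uzz_of, uzt_of :: 'n jet2 \<Rightarrow> real} \<le> 3"
    using card_length[of "[uz_of, uzz_of, uzt_of :: 'n jet2 \<Rightarrow> real]"] by simp
  ultimately show ?thesis
    unfolding pde_eqs_def using card_Un_le[of "range (pde_x f)" "{uz_of, uzz_of, uzt_of}"] by linarith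
qed

context jet_family
begin

(* At t = 0 the jets lie on the boundary of the jet space, where full rank may be due to the
   derivative in t alone and does not give invariance; there the equations follow from
   t > 0 by continuity. *)
lemma pde_invariant:
  assumes f: "smooth_on ({0..1} \<times> {0..} \<times> X \<times> UNIV) f"
    and rank: "\<And>p. p \<in> zero_set (Jet2 X) (pde_eqs f) \<Longrightarrow> jacobian_rank (Jet2 X) (pde_eqs f) p = CARD('n) + 3"
    and tangent: "\<And>p \<phi>. p \<in> zero_set (Jet2 X) (pde_eqs f) \<Longrightarrow> \<phi> \<in> pde_eqs f \<Longrightarrow>
      Lie (Jet2 X) (vprol2 X vx vu) \<phi> p = 0"
    and z: "z \<in> {0<..<1}"
    and init: "\<And>t. t \<ge> 0 \<Longrightarrow> J2 ((z, t), 0) \<in> zero_set (Jet2 X) (pde_eqs f)" and t: "t \<ge> 0"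
  shows "J2 ((z, t), 1) \<in> zero_set (Jet2 X) (pde_eqs f)"
proof -
  have pos: "J2 ((z, t), 1) \<in> zero_set (Jet2 X) (pde_eqs f)" if t: "t > 0" for t
  proof (rule regular_zero_set_invariant[where M = "Jet2 X" and w = "vprol2 X vx vu" and c = "\<lambda>s. J2 ((z, t), s)" and e = e])
    show "card (pde_eqs f) \<le> jacobian_rank (Jet2 X) (pde_eqs f) p" if "p \<in> zero_set (Jet2 X) (pde_eqs f)" for p
      using rank[OF that] card_pde_eqs[of f] by simp
    have zt: "(z, t) \<in> base" using z t by (auto simp: base_def)
    fix s :: real assume s: "s \<in> {0..1}"
    show "((\<lambda>s. J2 ((z, t), s)) has_vector_derivative e *\<^sub>R vprol2 X vx vu (J2 ((z, t), s))) (at s within {0..1})"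
      by (rule J_evolution(2)[OF zt s])
    \<comment> \<open>The vertical flow preserves z and t, so for t > 0 and interior z the whole jet
      curve stays in this open set.\<close>
    define U :: "'n jet2 set" where "U = (({0<..<1} \<times> {0<..} \<times> X \<times> UNIV) \<times> UNIV) \<times> UNIV"
    have "open U" unfolding U_def using X by (intro open_Times) auto
    moreover have "U \<subseteq> Jet2 X" by (auto simp: U_def Jet2_def Jet1_def Tot_def)
    moreover have "J2 ((z, t), s) \<in> U"
      using z t s zt c(2)[of "((z, t), s)"] c_eq[of "((z, t), s)"]
      by (auto simp: J2_def J1_def U_def Tot_def)
    ultimately show "J2 ((z, t), s) \<in> interior (Jet2 X)" by (meson interiorI)
  qed (use fat_jets(4)[OF X] smooth_on_pde_eqs[OF f] smooth_on_prolongations(3)[OF X v] init[of t] t tangent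
      in \<open>auto simp: pde_eqs_def\<close>)
  show ?thesis
  proof (cases "t = 0")
    case True
    have "\<phi> (J2 ((z, 0), 1)) = 0" if \<phi>: "\<phi> \<in> pde_eqs f" for \<phi>
    proof (rule zero_at_0)
      have "continuous_on {0..} (\<lambda>t. ((z, t), 1 :: real))" by (intro continuous_intros)
      moreover have "(\<lambda>t. ((z, t), 1)) ` {0..} \<subseteq> base.S" using z by (auto simp: base_def)
      ultimately show "continuous_on {0..} (\<lambda>t. \<phi> (J2 ((z, t), 1)))"
        by (rule continuous_on_compose2[OF smooth_on_imp_continuous_on[OF
              smooth_on_compose[OF smooth_on_pde_eqs[OF f \<phi>] smooth_J2 J_in(2)]]])
      show "\<phi> (J2 ((z, t), 1)) = 0" if "t > 0" for t
        using pos[OF that] \<phi> by (simp add: zero_set_def)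
    qed
    moreover have "J2 ((z, 0), 1) \<in> Jet2 X" using J_in(2) z by (auto simp: base_def)
    ultimately show ?thesis using True by (simp add: zero_set_def)
  qed (use pos t in auto)
qed

text \<open>One argument for both faces: without the coordinate z a jet at z = 0 or z = 1 is an
  interior point of \<open>BJet X\<close> as soon as t > 0. The value at t = 0 follows by
  continuity.\<close>

lemma bc_invariant:
  assumes G: "\<And>i. i < m \<Longrightarrow> smooth_on ({0..} \<times> X \<times> UNIV) (G i)"
    and rank: "\<And>b. b \<in> zero_set (BJet X) (bc_eqs m G) \<Longrightarrow> jacobian_rank (BJet X) (bc_eqs m G) b = m"
    and tangent: "\<And>b i. b \<in> zero_set (BJet X) (bc_eqs m G) \<Longrightarrow> i < m \<Longrightarrow>
      Lie (BJet X) (vprol1_face X vx vu z0) (bc (G i)) b = 0"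
    and z0: "z0 \<in> {0..1}"
    and init: "\<And>t i. t \<ge> 0 \<Longrightarrow> i < m \<Longrightarrow> bc (G i) (drop_z (J1 ((z0, t), 0))) = 0"
    and t: "t \<ge> 0" and i: "i < m"
  shows "bc (G i) (drop_z (J1 ((z0, t), 1))) = 0"
proof -
  define b where "b t s = drop_z (J1 ((z0, t), s))" for t s
  have J1: "J1 ((z0, t), s) = ((z0, t, cx ((z0, t), s), cu ((z0, t), s)), snd (J1 ((z0, t), s)))"
    and cxX: "cx ((z0, t), s) \<in> X" if "t \<ge> 0" "s \<in> {0..1}" for t s
    using c_eq[of "((z0, t), s)"] c(2)[of "((z0, t), s)"] that z0 by (auto simp: J1_def base_def Tot_def)
  have b: "b t s = (t, cx ((z0, t), s), cu ((z0, t), s), snd (J1 ((z0, t), s)))" if "t \<ge> 0" "s \<in> {0..1}" for t s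
    unfolding b_def drop_z_eq by (subst (1 2 3) J1[OF that]) simp
  \<comment> \<open>Restoring z recovers the full jet, because z remains \<open>z0\<close> along the
    curve; thus the field on boundary jets is evaluated at the right point.\<close>
  have at_b: "at_z z0 (b t s) = J1 ((z0, t), s)" if "t \<ge> 0" "s \<in> {0..1}" for t s
    using J1[OF that] by (simp add: b[OF that] at_z_eq)
  have bM: "b t s \<in> BJet X" if "t \<ge> 0" "s \<in> {0..1}" for t s
    using cxX[OF that] that by (simp add: b BJet_def)
  have pos: "b t 1 \<in> zero_set (BJet X) (bc_eqs m G)" if t: "t > 0" for t
  proof (rule regular_zero_set_invariant[where M = "BJet X" and w = "vprol1_face X vx vu z0" and c = "b t" and e = e])
    show "card (bc_eqs m G) \<le> jacobian_rank (BJet X) (bc_eqs m G) p" if "p \<in> zero_set (BJet X) (bc_eqs m G)" for p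
      using rank[OF that] card_image_le[of "{..<m}" "\<lambda>i. bc (G i)"] by (simp add: bc_eqs_def)
    have zt: "(z0, t) \<in> base" using z0 t by (auto simp: base_def)
    show "smooth_on (BJet X) (vprol1_face X vx vu z0)" by (rule smooth_on_vprol1_face[OF X v z0])
    show "b t 0 \<in> zero_set (BJet X) (bc_eqs m G)"
      using bM[of t 0] init[of t] t by (auto simp: zero_set_def bc_eqs_def b_def)
    fix s :: real assume s: "s \<in> {0..1}"
    have "(b t has_vector_derivative drop_z (e *\<^sub>R vprol1 X vx vu (J1 ((z0, t), s)))) (at s within {0..1})"
      unfolding b_def by (rule bounded_linear.has_vector_derivative[OF bounded_linear_drop_z J_evolution(1)[OF zt s]])
    then show "(b t has_vector_derivative e *\<^sub>R vprol1_face X vx vu z0 (b t s)) (at s within {0..1})"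
      using t s by (simp add: vprol1_face_def at_b linear_cmul[OF bounded_linear.linear[OF bounded_linear_drop_z]])
    define U :: "'n bjet set" where "U = {0<..} \<times> X \<times> UNIV"
    have "open U" unfolding U_def using X by (intro open_Times) auto
    moreover have "U \<subseteq> BJet X" by (auto simp: U_def BJet_def)
    moreover have "b t s \<in> U" using cxX[of t s] t s by (simp add: b U_def)
    ultimately show "b t s \<in> interior (BJet X)" by (meson interiorI)
  qed (use fat_jets(5)[OF X] smooth_on_bc[OF G] tangent in \<open>auto simp: bc_eqs_def\<close>)
  have zero: "bc (G i) (b t 1) = 0" if "t > 0" for t
    using pos[OF that] i by (auto simp: zero_set_def bc_eqs_def)
  show ?thesis
  proof (cases "t = 0")
    case True
    have "bc (G i) (b 0 1) = 0"
    proof (rule zero_at_0)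
      have "continuous_on {0..} (\<lambda>t. ((z0, t), 1 :: real))" by (intro continuous_intros)
      moreover have "(\<lambda>t. ((z0, t), 1)) ` {0..} \<subseteq> base.S" using z0 by (auto simp: base_def)
      ultimately have "continuous_on {0..} (\<lambda>t. b t 1)"
        unfolding b_def
        by (rule continuous_on_compose2[OF smooth_on_imp_continuous_on[OF smooth_on_linear_compose[OF bounded_linear_drop_z smooth_J1]]])
      then show "continuous_on {0..} (\<lambda>t. bc (G i) (b t 1))"
        by (rule continuous_on_compose2[OF smooth_on_imp_continuous_on[OF smooth_on_bc[OF G[OF i]]]])
          (use bM in auto)
    qed (rule zero)
    then show ?thesis using True by (simp add: b_def)
  qed (use zero[of t] t in \<open>simp add: b_def\<close>)
qed

end

section \<open>The vertical symmetry group\<close>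

lemma vert_curve_proj:
  assumes der: "\<And>s. s \<in> {0..1} \<Longrightarrow> (c has_vector_derivative e *\<^sub>R vert vx vu (c s)) (at s within {0..1})"
    and s: "s \<in> {0..1}"
  shows "proj (c s) = proj (c 0)"
proof -
  have proj: "proj p = (fst p, fst (snd p))" for p :: "'a tot" by (cases p) auto
  have "\<exists>k. \<forall>s\<in>{0..1}. L (c s) = k" if L: "bounded_linear L" and L0: "\<And>s. L (e *\<^sub>R vert vx vu (c s)) = 0" for L :: "'a tot \<Rightarrow> real"
  proof -
    have "((\<lambda>s. L (c s)) has_vector_derivative 0) (at s within {0..1})" if "s \<in> {0..1}" for s
      using bounded_linear.has_vector_derivative[OF L der[OF that]] by (simp add: L0)
    then have "((\<lambda>s. L (c s)) has_derivative (\<lambda>_. 0)) (at s within {0..1})" if "s \<in> {0..1}" for s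
      using that by (simp add: has_vector_derivative_def)
    then show ?thesis using has_derivative_zero_constant[of "{0..1}" "\<lambda>s. L (c s)"] by fastforce
  qed
  from this[of fst] this[of "\<lambda>p. fst (snd p)"] obtain k k' where
    "\<forall>s\<in>{0..1}. fst (c s) = k" "\<forall>s\<in>{0..1}. fst (snd (c s)) = k'"
    using bounded_linear_fst bounded_linear_compose[OF bounded_linear_fst bounded_linear_snd]
    by (auto simp: vert_def)
  then show ?thesis using s by (simp add: proj)
qed

theorem theorem1:
  fixes X :: "(real^'n) set"
    and f :: "real \<times> real \<times> (real^'n) \<times> (real^'n) \<times> (real^'n) \<times> real \<Rightarrow> real^'n"
    and nA nB :: nat
    and g h :: "nat \<Rightarrow> real \<times> (real^'n) \<times> (real^'n) \<Rightarrow> real"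
    and vx :: "real \<times> real \<times> (real^'n) \<times> real \<Rightarrow> real^'n"
    and vu :: "real \<times> real \<times> (real^'n) \<times> real \<Rightarrow> real"
  assumes "open X"
    and "smooth_on ({0..1} \<times> {0..} \<times> X \<times> UNIV) f"
    and "\<And>i. i < nA \<Longrightarrow> smooth_on ({0..} \<times> X \<times> UNIV) (g i)"
    and "\<And>i. i < nB \<Longrightarrow> smooth_on ({0..} \<times> X \<times> UNIV) (h i)"
    and "\<And>p. p \<in> zero_set (Jet2 X) (pde_eqs f) \<Longrightarrow>
           jacobian_rank (Jet2 X) (pde_eqs f) p = CARD('n) + 3"
    and "\<And>b. b \<in> zero_set (BJet X) (bc_eqs nA g) \<Longrightarrow>
           jacobian_rank (BJet X) (bc_eqs nA g) b = nA"
    and "\<And>b. b \<in> zero_set (BJet X) (bc_eqs nB h) \<Longrightarrow>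
           jacobian_rank (BJet X) (bc_eqs nB h) b = nB"
    and "smooth_on (Tot X) vx"
    and "smooth_on (Tot X) vu"
    and "\<And>p \<phi>. p \<in> zero_set (Jet2 X) (pde_eqs f) \<Longrightarrow> \<phi> \<in> pde_eqs f \<Longrightarrow>
           Lie (Jet2 X) (vprol2 X vx vu) \<phi> p = 0"
    and "\<And>b i. b \<in> zero_set (BJet X) (bc_eqs nA g) \<Longrightarrow> i < nA \<Longrightarrow>
           Lie (BJet X) (vprol1_face X vx vu 0) (bc (g i)) b = 0"
    and "\<And>b i. b \<in> zero_set (BJet X) (bc_eqs nB h) \<Longrightarrow> i < nB \<Longrightarrow>
           Lie (BJet X) (vprol1_face X vx vu 1) (bc (h i)) b = 0"
  shows "generates_vertical_symmetries X (vert vx vu) (is_solution X f nA g nB h)"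
proof -
  let ?w = "vert vx vu" and ?M = "Tot X" and ?sol = "is_solution X f nA g nB h"
  note X = assms(1) and f = assms(2) and v = assms(8,9)
  have w: "smooth_on ?M ?w" by (rule smooth_on_prolongations(1)[OF X v])
  have curve: "\<exists>k. k 0 = p \<and> k 1 = flow ?M ?w \<epsilon> p \<and> (\<forall>s\<in>{0..1}. k s \<in> ?M \<and>
      (k has_vector_derivative \<epsilon> *\<^sub>R ?w (k s)) (at s within {0..1}))" if "p \<in> flow_dom ?M ?w \<epsilon>" for p \<epsilon>
    using flow_curve[OF slab open_cylinder[OF X], of ?w p \<epsilon>] w that unfolding Tot_eq[symmetric] by metis
  have "proj (flow ?M ?w \<epsilon> p) = proj p" if p: "p \<in> flow_dom ?M ?w \<epsilon>" for p \<epsilon>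
  proof -
    obtain k where k: "k 0 = p" "k 1 = flow ?M ?w \<epsilon> p"
      "\<And>s. s \<in> {0..1} \<Longrightarrow> (k has_vector_derivative \<epsilon> *\<^sub>R ?w (k s)) (at s within {0..1})"
      using curve[OF p] by blast
    show ?thesis using vert_curve_proj[OF k(3), of 1] k(1,2) by simp
  qed
  moreover have "?sol (flow ?M ?w \<epsilon> \<circ> \<gamma>)" if sol: "?sol \<gamma>" and dom: "\<forall>p\<in>base. \<gamma> p \<in> flow_dom ?M ?w \<epsilon>" for \<gamma> \<epsilon>
  proof -
    have \<gamma>: "smooth_on base \<gamma>" "\<And>p. p \<in> base \<Longrightarrow> \<gamma> p \<in> ?M" "\<And>p. p \<in> base \<Longrightarrow> proj (\<gamma> p) = p"
      using sol by (auto simp: is_solution_def smooth_section_def)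
    have "\<forall>p\<in>base. \<exists>k. k 0 = \<gamma> p \<and> k 1 = flow ?M ?w \<epsilon> (\<gamma> p) \<and> (\<forall>s\<in>{0..1}. k s \<in> ?M \<and>
        (k has_vector_derivative \<epsilon> *\<^sub>R ?w (k s)) (at s within {0..1}))"
      using curve dom by blast
    then obtain k where k0: "\<And>p. p \<in> base \<Longrightarrow> k p 0 = \<gamma> p"
      and k1: "\<And>p. p \<in> base \<Longrightarrow> k p 1 = flow ?M ?w \<epsilon> (\<gamma> p)"
      and kM: "\<And>p s. p \<in> base \<Longrightarrow> s \<in> {0..1} \<Longrightarrow> k p s \<in> ?M"
      and kder: "\<And>p s. p \<in> base \<Longrightarrow> s \<in> {0..1} \<Longrightarrow>
        (k p has_vector_derivative \<epsilon> *\<^sub>R ?w (k p s)) (at s within {0..1})"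
      by (subst (asm) bchoice_iff) blast
    \<comment> \<open>The curves \<open>k p\<close> are chosen separately for each \<open>p\<close>;
      joint smoothness comes from the differential equation and the smooth initial section, through
      \<open>smooth_on_flow_family\<close>.\<close>
    define c where "c x = k (fst x) (snd x)" for x
    have c0: "c (p, 0) = \<gamma> p" and c1: "c (p, 1) = (flow ?M ?w \<epsilon> \<circ> \<gamma>) p" if "p \<in> base" for p
      using k0[OF that] k1[OF that] by (simp_all add: c_def)
    have cM: "c x \<in> ?M" if "x \<in> base.S" for x using kM that by (auto simp: c_def)
    have cder: "\<forall>p\<in>base. \<forall>s\<in>{0..1}. ((\<lambda>s. c (p, s)) has_vector_derivative \<epsilon> *\<^sub>R ?w (c (p, s))) (at s within {0..1})"
      using kder by (auto simp: c_def)
    have csmooth: "smooth_on base.S c"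
    proof (rule base.smooth_on_flow_family[OF slab open_cylinder[OF X]])
      show "fat (slab \<inter> UNIV \<times> UNIV \<times> X \<times> UNIV)" using fat_jets(2)[OF X] by (simp only: Tot_eq)
      show "smooth_on (slab \<inter> UNIV \<times> UNIV \<times> X \<times> UNIV) (\<lambda>y. \<epsilon> *\<^sub>R ?w y)"
        unfolding Tot_eq[symmetric] by (intro smooth_on_scaleR smooth_on_const w)
      show "c x \<in> slab \<inter> UNIV \<times> UNIV \<times> X \<times> UNIV" if "x \<in> base.S" for x
        using cM[OF that] by (simp only: Tot_eq)
      show "smooth_on base (\<lambda>p. c (p, 0))" by (rule smooth_on_cong[OF \<gamma>(1)]) (simp add: c0)
    qed (rule cder)
    have cproj: "proj (c x) = fst x" if x: "x \<in> base.S" for x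
    proof -
      have p: "fst x \<in> base" "snd x \<in> {0..1}" using x by auto
      have "proj (k (fst x) (snd x)) = proj (k (fst x) 0)"
        by (rule vert_curve_proj[OF kder[OF p(1)] p(2)])
      then show ?thesis using k0[OF p(1)] \<gamma>(3)[OF p(1)] by (simp add: c_def)
    qed
    interpret jet_family X vx vu \<epsilon> c
    proof
      fix x assume x: "x \<in> base.S"
      show "ddir E\<^sub>s c x = \<epsilon> *\<^sub>R ?w (c x)"
        unfolding ddir_def
        by (rule base.time_evolution_derivatives(1)[OF smooth_on_Ck[OF csmooth] _ cder x])
          (intro smooth_on_Ck smooth_on_scaleR smooth_on_const smooth_on_compose[OF w csmooth], use cM in auto)
    qed (use X v csmooth cM cproj in auto)
    have J0: "sprol1 \<gamma> p = J1 (p, 0)" "sprol2 \<gamma> p = J2 (p, 0)" if "p \<in> base" for p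
      using sprol_eq[of \<gamma> 0 p] c0 that by auto
    have J1: "sprol1 (flow ?M ?w \<epsilon> \<circ> \<gamma>) p = J1 (p, 1)" "sprol2 (flow ?M ?w \<epsilon> \<circ> \<gamma>) p = J2 (p, 1)" if "p \<in> base" for p
      using sprol_eq[of "flow ?M ?w \<epsilon> \<circ> \<gamma>" 1 p] c1 that by auto
    have in_base: "(z, t) \<in> base" if "z \<in> {0..1}" "t \<ge> 0" for z t using that by (auto simp: base_def)
    have "smooth_section X (flow ?M ?w \<epsilon> \<circ> \<gamma>)"
      unfolding smooth_section_def
    proof (intro conjI ballI)
      have "smooth_on base (\<lambda>p. c (p, 1))"
        by (intro smooth_on_compose[OF csmooth] smooth_on_intros) auto
      then show "smooth_on base (flow ?M ?w \<epsilon> \<circ> \<gamma>)" by (rule smooth_on_cong) (rule c1)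
      show "(flow ?M ?w \<epsilon> \<circ> \<gamma>) p \<in> ?M" "proj ((flow ?M ?w \<epsilon> \<circ> \<gamma>) p) = p" if "p \<in> base" for p
        using cM[of "(p, 1)"] cproj[of "(p, 1)"] that unfolding c1[OF that] by auto
    qed
    moreover have "sprol2 (flow ?M ?w \<epsilon> \<circ> \<gamma>) p \<in> zero_set (Jet2 X) (pde_eqs f)" if p: "p \<in> {0<..<1} \<times> {0..}" for p
    proof -
      obtain z t where zt: "p = (z, t)" "z \<in> {0<..<1}" "t \<ge> 0" using p by auto
      \<comment> \<open>Required at all times, because the claim at t = 0 is a limit of the claims
        at t > 0.\<close>
      have init: "J2 ((z, t), 0) \<in> zero_set (Jet2 X) (pde_eqs f)" if "t \<ge> 0" for t
      proof -
        have "sprol2 \<gamma> (z, t) \<in> zero_set (Jet2 X) (pde_eqs f)"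
          using sol zt(2) that by (auto simp: is_solution_def)
        then show ?thesis using J0(2)[OF in_base, of z t] zt(2) that by simp
      qed
      show ?thesis
        using pde_invariant[OF f assms(5,10) zt(2) init zt(3)] J1(2)[OF in_base, of z t] zt by auto
    qed
    moreover have "bc (g i) (drop_z (sprol1 (flow ?M ?w \<epsilon> \<circ> \<gamma>) (0, t))) = 0" if "t \<ge> 0" "i < nA" for t i
    proof -
      have init: "bc (g i) (drop_z (J1 ((0, t), 0))) = 0" if "t \<ge> 0" "i < nA" for t i
        using sol that J0(1)[OF in_base, of 0 t] by (auto simp: is_solution_def)
      show ?thesis
        using bc_invariant[OF assms(3,6,11) _ init that] J1(1)[OF in_base, of 0 t] that by auto
    qed
    moreover have "bc (h i) (drop_z (sprol1 (flow ?M ?w \<epsilon> \<circ> \<gamma>) (1, t))) = 0" if "t \<ge> 0" "i < nB" for t i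
    proof -
      have init: "bc (h i) (drop_z (J1 ((1, t), 0))) = 0" if "t \<ge> 0" "i < nB" for t i
        using sol that J0(1)[OF in_base, of 1 t] by (auto simp: is_solution_def)
      show ?thesis
        using bc_invariant[OF assms(4,7,12) _ init that] J1(1)[OF in_base, of 1 t] that by auto
    qed
    ultimately show ?thesis by (simp add: is_solution_def)
  qed
  ultimately show ?thesis unfolding generates_vertical_symmetries_def by blast
qed

end
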